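(* For $i=1,2$ let $X_i$ be a compact metric space, $\sigma_i$ a homeomorphism of $X_i$, and $\alpha_i$ the induced automorphism of $C(X_i)$, $\alpha_i(f)=f\circ\sigma_i$. Let $X=X_1\times X_2$ and let $\alpha=(\alpha_1,\alpha_2)$ be the product $\mathbb{Z}^2$-action on $C(X)$, i.e. $\alpha(m,n)(f_1\otimes f_2)=\alpha_1^m(f_1)\otimes\alpha_2^n(f_2)$ for $f_i\in C(X_i)$. Then $$(\mathbb{Z}\times_{\alpha_1}C(X_1))\,\widehat\otimes\,(\mathbb{Z}\times_{\alpha_2}C(X_2))=\mathbb{Z}^2\times_\alpha C(X)$$ and $$(\mathbb{Z}_+\times_{\alpha_1}C(X_1))\,\widehat\otimes\,(\mathbb{Z}_+\times_{\alpha_2}C(X_2))=\mathbb{Z}_+^2\times_\alpha C(X),$$ where equality means the canonical identification sending $(\delta_m\otimes f_1)\otimes(\delta_n\otimes f_2)$ to $\delta_{m,n}\otimes(f_1\otimes f_2)$.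
   Context: Crossed products: for $G=\mathbb{Z}$ or $\mathbb{Z}^2$ acting on a $\mathrm{C}^*$-algebra $\mathcal{A}$ by $\alpha$, $\ell^1(G,\mathcal{A},\alpha)$ is the Banach $*$-algebra of absolutely summable functions $G\to\mathcal{A}$ with $(\delta_s\otimes f)(\delta_t\otimes g)=\delta_{s+t}\otimes f\alpha_s(g)$ and $(\delta_s\otimes f)^*=\delta_{-s}\otimes\alpha_{-s}(f^* )$, where $\delta_s\otimes f$ takes value $f$ at $s$ and $0$ elsewhere. $G\times_\alpha\mathcal{A}$ is its completion in the norm $\sup\|\pi(F)\|$ over nondegenerate $*$-representations $\pi$. The semicrossed product ($\mathbb{Z}_+\times_\alpha\mathcal{A}$ or $\mathbb{Z}_+^2\times_\alpha\mathcal{A}$) is the closure in $G\times_\alpha\mathcal{A}$ of the subalgebra of functions supported on $\mathbb{Z}_+$, respectively $\mathbb{Z}_+^2$ (nonnegative coordinates). Canonical representation: for a faithful representation $\pi_i$ of $C(X_i)$ on $\mathcal{H}_i$, on $\ell^2(\mathbb{Z},\mathcal{H}_i)$ put $U_i(\delta_m\otimes h)=\delta_{m+1}\otimes h$ and $\tilde\pi_i(f)(\delta_m\otimes h)=\delta_m\otimes\pi_i(\alpha_i^{-m}f)h$; then $\tilde\pi_i\times U_i:\delta_m\otimes f\mapsto\tilde\pi_i(f)U_i^m$ is a faithful representation of $\mathbb{Z}\times_{\alpha_i}C(X_i)$. The symbol $\widehat\otimes$ denotes the spatial tensor product: the norm completion of the algebraic tensor product acting on $\ell^2(\mathbb{Z},\mathcal{H}_1)\otimes\ell^2(\mathbb{Z},\mathcal{H}_2)$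 (Hilbert space tensor product) via $(\tilde\pi_1\times U_1)\otimes(\tilde\pi_2\times U_2)$. *)

theory Defs
  imports "HOL-Analysis.Analysis"
begin

section \<open>Complex vector spaces, Hilbert spaces and \<open>C*\<close>-algebras\<close>

class complex_vector = real_vector +
  fixes scaleC :: "complex \<Rightarrow> 'a \<Rightarrow> 'a" (infixr \<open>*\<^sub>C\<close> 75)
  assumes scaleC_add_right: "c *\<^sub>C (x + y) = c *\<^sub>C x + c *\<^sub>C y"
    and scaleC_add_left: "(c + d) *\<^sub>C x = c *\<^sub>C x + d *\<^sub>C x"
    and scaleC_scaleC: "c *\<^sub>C d *\<^sub>C x = (c * d) *\<^sub>C x"
    and scaleC_of_real: "complex_of_real r *\<^sub>C x = r *\<^sub>R x"

class complex_normed_vector = complex_vector + real_normed_vector +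
  assumes norm_scaleC: "norm (c *\<^sub>C x) = cmod c * norm x"

class complex_hilbert = complex_normed_vector + banach +
  fixes cinner :: "'a \<Rightarrow> 'a \<Rightarrow> complex"
  assumes cinner_commute: "cinner x y = cnj (cinner y x)"
    and cinner_add_left: "cinner (x + y) z = cinner x z + cinner y z"
    and cinner_scaleC_left: "cinner (c *\<^sub>C x) y = c * cinner x y"
    and cinner_self: "cinner x x = complex_of_real ((norm x)\<^sup>2)"

class cstar_algebra = complex_normed_vector + real_normed_algebra + banach +
  fixes star :: "'a \<Rightarrow> 'a"
  assumes mult_scaleC_left: "(c *\<^sub>C x) * y = c *\<^sub>C (x * y)"
    and mult_scaleC_right: "x * (c *\<^sub>C y) = c *\<^sub>C (x * y)"
    and star_star: "star (star x) = x"
    and star_add: "star (x + y) = star x + star y"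
    and star_scaleC: "star (c *\<^sub>C x) = cnj c *\<^sub>C star x"
    and star_mult: "star (x * y) = star y * star x"
    and cstar_identity: "norm (star x * x) = (norm x)\<^sup>2"

global_interpretation complex_vector: vector_space "scaleC :: complex \<Rightarrow> 'a \<Rightarrow> 'a::complex_vector"
  by unfold_locales
    (simp_all add: scaleC_add_right scaleC_add_left scaleC_scaleC scaleC_of_real[where r = 1, simplified])

abbreviation cspan :: "'a::complex_vector set \<Rightarrow> 'a set"
  where "cspan \<equiv> module.span scaleC"

abbreviation csubspace :: "'a::complex_vector set \<Rightarrow> bool"
  where "csubspace \<equiv> module.subspace scaleC"

subsection \<open>The complex numbers\<close>

instantiation complex :: complex_hilbert
begin
definition "scaleC_complex (c::complex) (x::complex) = c * x"
definition "cinner_complex (x::complex) (y::complex) = x * cnj y"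
instance
proof
  show "cinner x x = complex_of_real ((norm x)\<^sup>2)" for x :: complex
    unfolding cinner_complex_def by (rule complex_norm_square[symmetric])
qed (simp_all add: scaleC_complex_def cinner_complex_def algebra_simps scaleR_conv_of_real norm_mult)
end

instantiation complex :: cstar_algebra
begin
definition "star_complex (x::complex) = cnj x"
instance
  by standard
    (simp_all add: scaleC_complex_def star_complex_def algebra_simps norm_mult power2_eq_square)
end

subsection \<open>Bounded operators\<close>

lemma bounded_linear_scaleC: "bounded_linear (\<lambda>x::'a::complex_normed_vector. c *\<^sub>C x)"
proof (rule bounded_linear_intro[where K = "cmod c"])
  fix x y :: 'a and r :: real
  show "c *\<^sub>C (x + y) = c *\<^sub>C x + c *\<^sub>C y" by (rule scaleC_add_right)
  show "c *\<^sub>C (r *\<^sub>R x) = r *\<^sub>R (c *\<^sub>C x)"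
    by (simp add: scaleC_of_real[symmetric] scaleC_scaleC mult.commute)
  show "norm (c *\<^sub>C x) \<le> norm x * cmod c" by (simp add: norm_scaleC mult.commute)
qed

lemma bounded_linear_scaleC_blinfun:
  "bounded_linear (\<lambda>x. c *\<^sub>C blinfun_apply (T::'a::real_normed_vector \<Rightarrow>\<^sub>L 'b::complex_normed_vector) x)"
  by (rule bounded_linear_compose[OF bounded_linear_scaleC blinfun.bounded_linear_right])

instantiation blinfun :: (real_normed_vector, complex_normed_vector) complex_normed_vector
begin
definition scaleC_blinfun :: "complex \<Rightarrow> ('a \<Rightarrow>\<^sub>L 'b) \<Rightarrow> 'a \<Rightarrow>\<^sub>L 'b"
  where "scaleC_blinfun c T = Blinfun (\<lambda>x. c *\<^sub>C blinfun_apply T x)"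

lemma scaleC_blinfun_apply [simp]:
  "blinfun_apply (c *\<^sub>C T) x = c *\<^sub>C blinfun_apply (T::'a \<Rightarrow>\<^sub>L 'b) x"
  by (simp add: scaleC_blinfun_def bounded_linear_Blinfun_apply[OF bounded_linear_scaleC_blinfun])

instance
proof
  fix c d :: complex and S T :: "'a \<Rightarrow>\<^sub>L 'b" and r :: real
  show "c *\<^sub>C (S + T) = c *\<^sub>C S + c *\<^sub>C T"
    by (rule blinfun_eqI) (simp add: blinfun.add_left scaleC_add_right)
  show "(c + d) *\<^sub>C T = c *\<^sub>C T + d *\<^sub>C T"
    by (rule blinfun_eqI) (simp add: blinfun.add_left scaleC_add_left)
  show "c *\<^sub>C d *\<^sub>C T = (c * d) *\<^sub>C T"
    by (rule blinfun_eqI) (simp add: scaleC_scaleC)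
  show "complex_of_real r *\<^sub>C T = r *\<^sub>R T"
    by (rule blinfun_eqI) (simp add: blinfun.scaleR_left scaleC_of_real)
  have le: "norm (c *\<^sub>C T) \<le> cmod c * norm T" for c and T :: "'a \<Rightarrow>\<^sub>L 'b"
    by (rule norm_blinfun_bound)
      (auto simp: norm_scaleC mult.assoc intro!: mult_left_mono norm_blinfun)
  show "norm (c *\<^sub>C T) = cmod c * norm T"
  proof (cases "c = 0")
    case True
    then show ?thesis using le[of 0 T] by simp
  next
    case False
    have "T = inverse c *\<^sub>C c *\<^sub>C T"
      using False by (intro blinfun_eqI)
        (simp add: scaleC_scaleC scaleC_of_real[where r = 1, simplified])
    then have "norm T \<le> cmod (inverse c) * norm (c *\<^sub>C T)"
      using le by metis
    then have "cmod c * norm T \<le> norm (c *\<^sub>C T)"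
      using False by (simp add: norm_inverse norm_divide field_simps)
    with le show ?thesis by (simp add: order_antisym)
  qed
qed
end

definition clinear_op :: "('a::complex_normed_vector \<Rightarrow>\<^sub>L 'b::complex_normed_vector) \<Rightarrow> bool"
  where "clinear_op T \<longleftrightarrow> (\<forall>c x. blinfun_apply T (c *\<^sub>C x) = c *\<^sub>C blinfun_apply T x)"

definition is_adjoint :: "('h::complex_hilbert \<Rightarrow>\<^sub>L 'h) \<Rightarrow> ('h \<Rightarrow>\<^sub>L 'h) \<Rightarrow> bool"
  where "is_adjoint T T' \<longleftrightarrow>
    (\<forall>x y. cinner (blinfun_apply T x) y = cinner x (blinfun_apply T' y))"

definition adjoint_op :: "('h::complex_hilbert \<Rightarrow>\<^sub>L 'h) \<Rightarrow> 'h \<Rightarrow>\<^sub>L 'h"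
  where "adjoint_op T = (THE T'. is_adjoint T T')"

subsection \<open>\<open>C(X)\<close>, for compact \<open>X\<close>, as the algebra of bounded continuous functions\<close>

lemma bcontfun_times:
  fixes f g :: "'a::topological_space \<Rightarrow>\<^sub>C 'b::real_normed_algebra"
  shows "(\<lambda>x. apply_bcontfun f x * apply_bcontfun g x) \<in> bcontfun"
proof (rule bcontfun_normI[where b = "norm f * norm g"])
  show "continuous_on UNIV (\<lambda>x. apply_bcontfun f x * apply_bcontfun g x)"
    by (intro continuous_intros continuous_on_apply_bcontfun)
  show "norm (apply_bcontfun f x * apply_bcontfun g x) \<le> norm f * norm g" for x
    by (rule order_trans[OF norm_mult_ineq]) (intro mult_mono norm_bounded norm_ge_zero)
qed

instantiation bcontfun :: (topological_space, real_normed_algebra) real_normed_algebra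
begin
definition times_bcontfun :: "('a \<Rightarrow>\<^sub>C 'b) \<Rightarrow> ('a \<Rightarrow>\<^sub>C 'b) \<Rightarrow> 'a \<Rightarrow>\<^sub>C 'b"
  where "times_bcontfun f g = Bcontfun (\<lambda>x. apply_bcontfun f x * apply_bcontfun g x)"

lemma times_bcontfun_apply [simp]:
  "apply_bcontfun (f * g) x = apply_bcontfun f x * apply_bcontfun (g::'a \<Rightarrow>\<^sub>C 'b) x"
  by (simp add: times_bcontfun_def Bcontfun_inverse[OF bcontfun_times])

instance
proof
  fix f g h :: "'a \<Rightarrow>\<^sub>C 'b" and r :: real
  show "f * g * h = f * (g * h)" by (rule bcontfun_eqI) (simp add: mult.assoc)
  show "(f + g) * h = f * h + g * h" by (rule bcontfun_eqI) (simp add: distrib_right)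
  show "f * (g + h) = f * g + f * h" by (rule bcontfun_eqI) (simp add: distrib_left)
  show "r *\<^sub>R f * g = r *\<^sub>R (f * g)" by (rule bcontfun_eqI) simp
  show "f * r *\<^sub>R g = r *\<^sub>R (f * g)" by (rule bcontfun_eqI) simp
  show "norm (f * g) \<le> norm f * norm g"
    by (rule norm_bound, simp, rule order_trans[OF norm_mult_ineq])
      (intro mult_mono norm_bounded norm_ge_zero)
qed
end

lemma bcontfun_scaleC:
  fixes f :: "'a::topological_space \<Rightarrow>\<^sub>C 'b::complex_normed_vector"
  shows "(\<lambda>x. c *\<^sub>C apply_bcontfun f x) \<in> bcontfun"
proof (rule bcontfun_normI[where b = "cmod c * norm f"])
  show "continuous_on UNIV (\<lambda>x. c *\<^sub>C apply_bcontfun f x)"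
    by (intro bounded_linear.continuous_on[OF bounded_linear_scaleC] continuous_on_apply_bcontfun)
  show "norm (c *\<^sub>C apply_bcontfun f x) \<le> cmod c * norm f" for x
    by (simp add: norm_scaleC mult_left_mono norm_bounded)
qed

instantiation bcontfun :: (topological_space, complex_normed_vector) complex_normed_vector
begin
definition scaleC_bcontfun :: "complex \<Rightarrow> ('a \<Rightarrow>\<^sub>C 'b) \<Rightarrow> 'a \<Rightarrow>\<^sub>C 'b"
  where "scaleC_bcontfun c f = Bcontfun (\<lambda>x. c *\<^sub>C apply_bcontfun f x)"

lemma scaleC_bcontfun_apply [simp]:
  "apply_bcontfun (c *\<^sub>C f) x = c *\<^sub>C apply_bcontfun (f::'a \<Rightarrow>\<^sub>C 'b) x"
  by (simp add: scaleC_bcontfun_def Bcontfun_inverse[OF bcontfun_scaleC])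

instance
proof
  fix c d :: complex and f g :: "'a \<Rightarrow>\<^sub>C 'b" and r :: real
  show "c *\<^sub>C (f + g) = c *\<^sub>C f + c *\<^sub>C g"
    by (rule bcontfun_eqI) (simp add: scaleC_add_right)
  show "(c + d) *\<^sub>C f = c *\<^sub>C f + d *\<^sub>C f"
    by (rule bcontfun_eqI) (simp add: scaleC_add_left)
  show "c *\<^sub>C d *\<^sub>C f = (c * d) *\<^sub>C f"
    by (rule bcontfun_eqI) (simp add: scaleC_scaleC)
  show "complex_of_real r *\<^sub>C f = r *\<^sub>R f"
    by (rule bcontfun_eqI) (simp add: scaleC_of_real)
  have le: "norm (c *\<^sub>C f) \<le> cmod c * norm f" for c and f :: "'a \<Rightarrow>\<^sub>C 'b"
    by (rule norm_bound) (simp add: norm_scaleC mult_left_mono norm_bounded)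
  show "norm (c *\<^sub>C f) = cmod c * norm f"
  proof (cases "c = 0")
    case True
    then show ?thesis using le[of 0 f] by simp
  next
    case False
    have "f = inverse c *\<^sub>C c *\<^sub>C f"
      using False by (intro bcontfun_eqI)
        (simp add: scaleC_scaleC scaleC_of_real[where r = 1, simplified])
    then have "norm f \<le> cmod (inverse c) * norm (c *\<^sub>C f)"
      using le by metis
    then have "cmod c * norm f \<le> norm (c *\<^sub>C f)"
      using False by (simp add: norm_inverse norm_divide field_simps)
    with le show ?thesis by (simp add: order_antisym)
  qed
qed
end

lemma norm_star [simp]: "norm (star x) = norm (x::'a::cstar_algebra)"
proof -
  have le: "norm y \<le> norm (star y)" for y :: 'a
  proof (cases "y = 0")
    case False
    have "norm y * norm y \<le> norm (star y) * norm y"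
      using cstar_identity[of y] norm_mult_ineq[of "star y" y] by (simp add: power2_eq_square)
    then show ?thesis using False by simp
  qed simp
  show ?thesis using le[of x] le[of "star x"] by (simp add: star_star)
qed

lemma bounded_linear_star: "bounded_linear (star :: 'a \<Rightarrow> 'a::cstar_algebra)"
proof (rule bounded_linear_intro[where K = 1])
  fix x y :: 'a and r :: real
  show "star (x + y) = star x + star y" by (rule star_add)
  show "star (r *\<^sub>R x) = r *\<^sub>R star x"
    by (simp add: scaleC_of_real[symmetric] star_scaleC)
  show "norm (star x) \<le> norm x * 1" by simp
qed

lemma bcontfun_star:
  fixes f :: "'a::metric_space \<Rightarrow>\<^sub>C 'b::cstar_algebra"
  shows "(\<lambda>x. star (apply_bcontfun f x)) \<in> bcontfun"
proof (rule bcontfun_normI[where b = "norm f"])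
  show "continuous_on UNIV (\<lambda>x. star (apply_bcontfun f x))"
    by (intro bounded_linear.continuous_on[OF bounded_linear_star] continuous_on_apply_bcontfun)
  show "norm (star (apply_bcontfun f x)) \<le> norm f" for x
    by (simp add: norm_bounded)
qed

instance bcontfun :: (metric_space, banach) banach ..

instantiation bcontfun :: (metric_space, cstar_algebra) cstar_algebra
begin
definition star_bcontfun :: "('a \<Rightarrow>\<^sub>C 'b) \<Rightarrow> 'a \<Rightarrow>\<^sub>C 'b"
  where "star_bcontfun f = Bcontfun (\<lambda>x. star (apply_bcontfun f x))"

lemma star_bcontfun_apply [simp]:
  "apply_bcontfun (star f) x = star (apply_bcontfun (f::'a \<Rightarrow>\<^sub>C 'b) x)"
  by (simp add: star_bcontfun_def Bcontfun_inverse[OF bcontfun_star])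

instance
proof
  fix c :: complex and f g :: "'a \<Rightarrow>\<^sub>C 'b"
  show "(c *\<^sub>C f) * g = c *\<^sub>C (f * g)"
    by (rule bcontfun_eqI) (simp add: mult_scaleC_left)
  show "f * (c *\<^sub>C g) = c *\<^sub>C (f * g)"
    by (rule bcontfun_eqI) (simp add: mult_scaleC_right)
  show "star (star f) = f" by (rule bcontfun_eqI) (simp add: star_star)
  show "star (f + g) = star f + star g" by (rule bcontfun_eqI) (simp add: star_add)
  show "star (c *\<^sub>C f) = cnj c *\<^sub>C star f" by (rule bcontfun_eqI) (simp add: star_scaleC)
  show "star (f * g) = star g * star f" by (rule bcontfun_eqI) (simp add: star_mult)
  show "norm (star f * f) = (norm f)\<^sup>2"
  proof (rule order_antisym)
    show "norm (star f * f) \<le> (norm f)\<^sup>2"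
      by (rule norm_bound) (simp add: cstar_identity power_mono norm_bounded)
    have "norm (apply_bcontfun f x) \<le> sqrt (norm (star f * f))" for x
      using norm_bounded[of "star f * f" x] by (simp add: cstar_identity real_le_rsqrt)
    then have "norm f \<le> sqrt (norm (star f * f))" by (rule norm_bound)
    then show "(norm f)\<^sup>2 \<le> norm (star f * f)"
      by (metis norm_ge_zero real_sqrt_le_iff real_sqrt_unique sqrt_le_D)
  qed
qed
end


section \<open>The Hilbert space \<open>\<ell>\<^sup>2(I, H)\<close>\<close>

typedef (overloaded) ('i, 'h) l2 =
  "{f :: 'i \<Rightarrow> 'h::complex_hilbert. (\<lambda>i. (norm (f i))\<^sup>2) summable_on UNIV}"
  morphisms l2_apply Abs_l2
  by (rule exI[where x = "\<lambda>_. 0"]) simp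

lemma l2_eqI: "(\<And>i. l2_apply x i = l2_apply y i) \<Longrightarrow> x = y"
  by (metis ext l2_apply_inject)

lemma L2_set_sq: "(L2_set f F)\<^sup>2 = (\<Sum>i\<in>F. (f i)\<^sup>2)"
  by (simp add: L2_set_def sum_nonneg)

lemma l2_memI:
  fixes f :: "'i \<Rightarrow> 'h::complex_hilbert"
  assumes "\<And>F. finite F \<Longrightarrow> L2_set (\<lambda>i. norm (f i)) F \<le> C"
  shows "f \<in> {f. (\<lambda>i. (norm (f i))\<^sup>2) summable_on UNIV}"
proof -
  have "(\<Sum>i\<in>F. (norm (f i))\<^sup>2) \<le> C\<^sup>2" if "finite F" for F
    using power_mono[OF assms[OF that] L2_set_nonneg, of 2] by (simp add: L2_set_sq)
  then have "(\<lambda>i. (norm (f i))\<^sup>2) summable_on UNIV"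
    by (intro nonneg_bdd_above_summable_on bdd_aboveI) auto
  then show ?thesis by simp
qed

lemma l2_apply_summable: "(\<lambda>i. (norm (l2_apply x i))\<^sup>2) summable_on UNIV"
  using l2_apply[of x] by simp

lemma L2_set_le_sqrt_infsum:
  assumes "finite F"
  shows "L2_set (\<lambda>i. norm (l2_apply x i)) F \<le> sqrt (\<Sum>\<^sub>\<infinity>i. (norm (l2_apply x i))\<^sup>2)"
  unfolding L2_set_def
  by (intro real_sqrt_le_mono finite_sum_le_infsum l2_apply_summable assms) auto

lemma sqrt_infsum_le:
  assumes "\<And>F. finite F \<Longrightarrow> L2_set (\<lambda>i. norm (l2_apply x i)) F \<le> C"
  shows "sqrt (\<Sum>\<^sub>\<infinity>i. (norm (l2_apply x i))\<^sup>2) \<le> C"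
proof (rule real_le_lsqrt)
  show "0 \<le> C" using assms[of "{}"] by simp
  show "(\<Sum>\<^sub>\<infinity>i. (norm (l2_apply x i))\<^sup>2) \<le> C\<^sup>2"
  proof (rule infsum_le_finite_sums[OF l2_apply_summable])
    fix F :: "'a set" assume "finite F"
    then show "(\<Sum>i\<in>F. (norm (l2_apply x i))\<^sup>2) \<le> C\<^sup>2"
      using power_mono[OF assms L2_set_nonneg, of F 2] by (simp add: L2_set_sq)
  qed
qed

lemma L2_set_norm_add:
  fixes f g :: "'i \<Rightarrow> 'h::real_normed_vector"
  shows "L2_set (\<lambda>i. norm (f i + g i)) F
    \<le> L2_set (\<lambda>i. norm (f i)) F + L2_set (\<lambda>i. norm (g i)) F"
  by (rule order_trans[OF L2_set_mono L2_set_triangle_ineq]) (auto intro: norm_triangle_ineq)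

lemma L2_set_norm_scaleC:
  fixes f :: "'i \<Rightarrow> 'h::complex_normed_vector"
  shows "L2_set (\<lambda>i. norm (c *\<^sub>C f i)) F = cmod c * L2_set (\<lambda>i. norm (f i)) F"
  by (simp add: norm_scaleC L2_set_right_distrib[of "cmod c"])

lemma Abs_l2_add_apply:
  "l2_apply (Abs_l2 (\<lambda>i. l2_apply x i + l2_apply y i)) = (\<lambda>i. l2_apply x i + l2_apply y i)"
proof (rule Abs_l2_inverse, rule l2_memI)
  fix F :: "'a set" assume "finite F"
  then show "L2_set (\<lambda>i. norm (l2_apply x i + l2_apply y i)) F
      \<le> sqrt (\<Sum>\<^sub>\<infinity>i. (norm (l2_apply x i))\<^sup>2) + sqrt (\<Sum>\<^sub>\<infinity>i. (norm (l2_apply y i))\<^sup>2)"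
    by (intro order_trans[OF L2_set_norm_add] add_mono L2_set_le_sqrt_infsum)
qed

lemma Abs_l2_scaleC_apply:
  "l2_apply (Abs_l2 (\<lambda>i. c *\<^sub>C l2_apply x i)) = (\<lambda>i. c *\<^sub>C l2_apply x i)"
proof (rule Abs_l2_inverse, rule l2_memI)
  fix F :: "'a set" assume "finite F"
  then show "L2_set (\<lambda>i. norm (c *\<^sub>C l2_apply x i)) F
      \<le> cmod c * sqrt (\<Sum>\<^sub>\<infinity>i. (norm (l2_apply x i))\<^sup>2)"
    unfolding L2_set_norm_scaleC by (intro mult_left_mono L2_set_le_sqrt_infsum norm_ge_zero)
qed

lemma scaleR_eq_scaleC: "r *\<^sub>R x = complex_of_real r *\<^sub>C x"
  by (rule scaleC_of_real[symmetric])

lemma uminus_eq_scaleC: "- x = (- 1) *\<^sub>C (x::'a::complex_vector)"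
  using scaleC_of_real[of "- 1" x] by simp

instantiation l2 :: (type, complex_hilbert) complex_vector
begin
definition "plus_l2 x y = Abs_l2 (\<lambda>i. l2_apply x i + l2_apply y i)"
definition "zero_l2 = Abs_l2 (\<lambda>i. 0)"
definition "uminus_l2 x = Abs_l2 (\<lambda>i. - l2_apply x i)"
definition "minus_l2 x y = Abs_l2 (\<lambda>i. l2_apply x i - l2_apply y i)"
definition "scaleR_l2 r x = Abs_l2 (\<lambda>i. r *\<^sub>R l2_apply x i)"
definition "scaleC_l2 c x = Abs_l2 (\<lambda>i. c *\<^sub>C l2_apply x i)"

lemma l2_apply_plus [simp]: "l2_apply (x + y) i = l2_apply x i + l2_apply y i"
  by (simp add: plus_l2_def Abs_l2_add_apply)

lemma l2_apply_zero [simp]: "l2_apply 0 i = 0"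
  by (simp add: zero_l2_def Abs_l2_inverse)

lemma l2_apply_scaleC [simp]: "l2_apply (c *\<^sub>C x) i = c *\<^sub>C l2_apply x i"
  by (simp add: scaleC_l2_def Abs_l2_scaleC_apply)

lemma l2_apply_scaleR [simp]: "l2_apply (r *\<^sub>R x) i = r *\<^sub>R l2_apply x i"
  by (simp add: scaleR_l2_def scaleR_eq_scaleC Abs_l2_scaleC_apply)

lemma l2_apply_uminus [simp]: "l2_apply (- x) i = - l2_apply x i"
  using Abs_l2_scaleC_apply[of "- 1" x]
  by (simp add: uminus_l2_def flip: uminus_eq_scaleC)

lemma l2_apply_minus [simp]: "l2_apply (x - y) i = l2_apply x i - l2_apply y i"
proof -
  have "x - y = x + (- y)"
    by (simp add: minus_l2_def plus_l2_def)
  then show ?thesis by simp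
qed

instance
  by standard
    (auto intro!: l2_eqI simp: algebra_simps scaleC_add_right scaleC_add_left scaleC_scaleC
      scaleC_of_real)
end

instantiation l2 :: (type, complex_hilbert) complex_normed_vector
begin
definition "norm_l2 x = sqrt (\<Sum>\<^sub>\<infinity>i. (norm (l2_apply x i))\<^sup>2)"
definition "sgn_l2 (x::('a,'b) l2) = x /\<^sub>R norm x"
definition "dist_l2 (x::('a,'b) l2) y = norm (x - y)"
definition [code del]:
  "(uniformity::(('a,'b) l2 \<times> ('a,'b) l2) filter) =
    (INF e\<in>{0 <..}. principal {(x, y). dist x y < e})"
definition [code del]:
  "open (U::('a,'b) l2 set) \<longleftrightarrow> (\<forall>x\<in>U. eventually (\<lambda>(x', y). x' = x \<longrightarrow> y \<in> U) uniformity)"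

lemma L2_set_le_norm_l2:
  "finite F \<Longrightarrow> L2_set (\<lambda>i. norm (l2_apply x i)) F \<le> norm (x::('a,'b) l2)"
  unfolding norm_l2_def by (rule L2_set_le_sqrt_infsum)

lemma norm_l2_le:
  "(\<And>F. finite F \<Longrightarrow> L2_set (\<lambda>i. norm (l2_apply x i)) F \<le> C) \<Longrightarrow> norm (x::('a,'b) l2) \<le> C"
  unfolding norm_l2_def by (rule sqrt_infsum_le)

lemma norm_l2_apply_le: "norm (l2_apply x i) \<le> norm (x::('a,'b) l2)"
  using L2_set_le_norm_l2[of "{i}" x] by simp

instance
proof
  fix x y :: "('a,'b) l2" and r :: real and c :: complex and U :: "('a,'b) l2 set"
  show "dist x y = norm (x - y)" by (rule dist_l2_def)
  show "sgn x = x /\<^sub>R norm x" by (rule sgn_l2_def)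
  show "(uniformity::(('a,'b) l2 \<times> ('a,'b) l2) filter) =
    (INF e\<in>{0 <..}. principal {(x, y). dist x y < e})" by (rule uniformity_l2_def)
  show "open U \<longleftrightarrow> (\<forall>x\<in>U. eventually (\<lambda>(x', y). x' = x \<longrightarrow> y \<in> U) uniformity)"
    by (rule open_l2_def)
  show "norm x = 0 \<longleftrightarrow> x = 0"
  proof
    assume "norm x = 0"
    then show "x = 0"
      using norm_l2_apply_le[of x] by (intro l2_eqI) simp
  next
    assume "x = 0"
    then show "norm x = 0" by (simp add: norm_l2_def)
  qed
  show "norm (x + y) \<le> norm x + norm y"
    by (rule norm_l2_le, simp, rule order_trans[OF L2_set_norm_add])
      (intro add_mono L2_set_le_norm_l2)
  show C: "norm (c *\<^sub>C x) = cmod c * norm x" for c and x :: "('a,'b) l2"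
    by (simp add: norm_l2_def norm_scaleC power_mult_distrib infsum_cmult_right' real_sqrt_mult)
  show "norm (r *\<^sub>R x) = \<bar>r\<bar> * norm x"
    by (simp add: scaleR_eq_scaleC C)
qed
end

lemma cinner_add_right: "cinner x (y + z) = cinner x y + cinner x z"
  by (metis cinner_add_left cinner_commute complex_cnj_add)

lemma cinner_scaleC_right: "cinner x (c *\<^sub>C y) = cnj c * cinner x y"
  by (metis cinner_commute cinner_scaleC_left complex_cnj_mult)

lemma cmod_cinner_le: "2 * cmod (cinner x y) \<le> (norm x)\<^sup>2 + (norm y)\<^sup>2"
proof -
  obtain u where u: "cmod u = 1" "u * cinner x y = complex_of_real (cmod (cinner x y))"
  proof (cases "cinner x y = 0")
    case True
    then show ?thesis using that[of 1] by simp
  next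
    case False
    show ?thesis
    proof (rule that)
      show "cmod (cnj (cinner x y) / complex_of_real (cmod (cinner x y))) = 1"
        using False by (simp add: norm_divide)
      show "cnj (cinner x y) / complex_of_real (cmod (cinner x y)) * cinner x y
          = complex_of_real (cmod (cinner x y))"
        using False complex_norm_square[of "cinner x y"]
        by (simp add: divide_simps power2_eq_square mult.commute)
    qed
  qed
  define z where "z = u *\<^sub>C x"
  have zy: "cinner z y = complex_of_real (cmod (cinner x y))"
    by (simp add: z_def cinner_scaleC_left u)
  have yz: "cinner y z = complex_of_real (cmod (cinner x y))"
    by (subst cinner_commute) (simp add: zy)
  have nz: "norm z = norm x" by (simp add: z_def norm_scaleC u)
  have "complex_of_real ((norm (z - y))\<^sup>2) = cinner (z + (- 1) *\<^sub>C y) (z + (- 1) *\<^sub>C y)"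
    by (simp add: cinner_self flip: uminus_eq_scaleC)
  also have "\<dots> = complex_of_real ((norm x)\<^sup>2 + (norm y)\<^sup>2 - 2 * cmod (cinner x y))"
    unfolding cinner_add_left cinner_add_right cinner_scaleC_left cinner_scaleC_right
      zy yz cinner_self[of z] cinner_self[of y] nz by simp
  finally have "(norm (z - y))\<^sup>2 = (norm x)\<^sup>2 + (norm y)\<^sup>2 - 2 * cmod (cinner x y)"
    by (simp only: of_real_eq_iff)
  then show ?thesis by (metis diff_ge_0_iff_ge zero_le_power2)
qed

lemma l2_cinner_summable: "(\<lambda>i. cinner (l2_apply x i) (l2_apply y i)) summable_on UNIV"
proof (rule abs_summable_summable, rule summable_on_comparison_test)
  show "(\<lambda>i. (norm (l2_apply x i))\<^sup>2 + (norm (l2_apply y i))\<^sup>2) summable_on UNIV"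
    by (intro summable_on_add l2_apply_summable)
  show "norm (cinner (l2_apply x i) (l2_apply y i))
      \<le> (norm (l2_apply x i))\<^sup>2 + (norm (l2_apply y i))\<^sup>2" for i
    using cmod_cinner_le[of "l2_apply x i" "l2_apply y i"]
    by (smt (verit) norm_ge_zero)
qed auto

instantiation l2 :: (type, complex_hilbert) complex_hilbert
begin
definition "cinner_l2 x y = (\<Sum>\<^sub>\<infinity>i. cinner (l2_apply x i) (l2_apply y i))"
instance
proof
  fix x y z :: "('a,'b) l2" and c :: complex and X :: "nat \<Rightarrow> ('a,'b) l2"
  show "cinner x y = cnj (cinner y x)"
    unfolding cinner_l2_def by (subst cinner_commute) simp
  show "cinner (x + y) z = cinner x z + cinner y z"
    by (simp add: cinner_l2_def cinner_add_left infsum_add l2_cinner_summable)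
  show "cinner (c *\<^sub>C x) y = c * cinner x y"
    by (simp add: cinner_l2_def cinner_scaleC_left infsum_cmult_right')
  have "(\<Sum>\<^sub>\<infinity>i. complex_of_real ((norm (l2_apply x i))\<^sup>2))
      = complex_of_real (\<Sum>\<^sub>\<infinity>i. (norm (l2_apply x i))\<^sup>2)"
    by (intro infsumI has_sum_of_real has_sum_infsum l2_apply_summable)
  then show "cinner x x = complex_of_real ((norm x)\<^sup>2)"
    by (simp add: cinner_l2_def cinner_self norm_l2_def infsum_nonneg)
  assume X: "Cauchy X"
  have "Cauchy (\<lambda>n. l2_apply (X n) i)" for i
  proof (rule metric_CauchyI)
    fix e :: real assume "0 < e"
    then obtain N where N: "\<forall>m\<ge>N. \<forall>n\<ge>N. dist (X m) (X n) < e"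
      using X metric_CauchyD by blast
    have "dist (l2_apply (X m) i) (l2_apply (X n) i) \<le> dist (X m) (X n)" for m n
      using norm_l2_apply_le[of "X m - X n" i] by (simp add: dist_norm)
    then show "\<exists>M. \<forall>m\<ge>M. \<forall>n\<ge>M. dist (l2_apply (X m) i) (l2_apply (X n) i) < e"
      using N by (meson le_less_trans)
  qed
  then have "\<forall>i. \<exists>l. (\<lambda>n. l2_apply (X n) i) \<longlonglongrightarrow> l"
    by (metis Cauchy_convergent_iff convergent_def)
  then obtain L where L: "\<And>i. (\<lambda>n. l2_apply (X n) i) \<longlonglongrightarrow> L i" by metis
  have tail: "L2_set (\<lambda>i. norm (l2_apply (X m) i - L i)) F \<le> e"
    if N: "\<forall>m\<ge>N. \<forall>n\<ge>N. dist (X m) (X n) < e" and m: "m \<ge> N" and F: "finite F" for N m e F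
  proof (rule tendsto_upperbound)
    show "(\<lambda>n. L2_set (\<lambda>i. norm (l2_apply (X m) i - l2_apply (X n) i)) F)
        \<longlonglongrightarrow> L2_set (\<lambda>i. norm (l2_apply (X m) i - L i)) F"
      unfolding L2_set_def by (intro tendsto_intros L)
    show "\<forall>\<^sub>F n in sequentially.
        L2_set (\<lambda>i. norm (l2_apply (X m) i - l2_apply (X n) i)) F \<le> e"
    proof (rule eventually_sequentiallyI)
      fix n assume "N \<le> n"
      then have "norm (X m - X n) \<le> e" using N m by (simp add: dist_norm less_imp_le)
      then show "L2_set (\<lambda>i. norm (l2_apply (X m) i - l2_apply (X n) i)) F \<le> e"
        using L2_set_le_norm_l2[OF F, of "X m - X n"] by simp
    qed
  qed simp
  obtain N1 where "\<forall>m\<ge>N1. \<forall>n\<ge>N1. dist (X m) (X n) < 1"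
    using X metric_CauchyD zero_less_one by blast
  from tail[OF this order_refl]
  have "(\<lambda>i. l2_apply (X N1) i - L i) \<in> {f. (\<lambda>i. (norm (f i))\<^sup>2) summable_on UNIV}"
    by (rule l2_memI)
  then have D: "l2_apply (Abs_l2 (\<lambda>i. l2_apply (X N1) i - L i)) = (\<lambda>i. l2_apply (X N1) i - L i)"
    by (rule Abs_l2_inverse)
  define Y where "Y = X N1 - Abs_l2 (\<lambda>i. l2_apply (X N1) i - L i)"
  have Y: "l2_apply Y i = L i" for i by (simp add: Y_def D)
  have "X \<longlonglongrightarrow> Y"
  proof (rule metric_LIMSEQ_I)
    fix e :: real assume "0 < e"
    then obtain N where N: "\<forall>m\<ge>N. \<forall>n\<ge>N. dist (X m) (X n) < e / 2"
      using X metric_CauchyD half_gt_zero by blast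
    have "dist (X m) Y \<le> e / 2" if "m \<ge> N" for m
      unfolding dist_norm using tail[OF N that] by (intro norm_l2_le) (simp add: Y)
    then show "\<exists>N. \<forall>n\<ge>N. dist (X n) Y < e"
      using \<open>0 < e\<close> by (intro exI[of _ N]) (smt (verit) field_sum_of_halves)
  qed
  then show "convergent X" by (rule convergentI)
qed
end

definition l2_single :: "'i \<Rightarrow> 'h::complex_hilbert \<Rightarrow> ('i, 'h) l2"
  where "l2_single i h = Abs_l2 (\<lambda>j. if j = i then h else 0)"

lemma l2_single_apply: "l2_apply (l2_single i h) j = (if j = i then h else 0)"
proof -
  have "(\<lambda>j. (norm (if j = i then h else 0))\<^sup>2) summable_on UNIV"
    by (rule finite_nonzero_values_imp_summable_on)
      (rule finite_subset[of _ "{i}"], auto split: if_splits)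
  then show ?thesis by (simp add: l2_single_def Abs_l2_inverse)
qed


section \<open>Normed \<open>*\<close>-algebras, representations, enveloping \<open>C*\<close>-algebras\<close>

text \<open>
  Since \<open>\<ell>\<^sup>1(G, A, \<alpha>)\<close> and its completions depend on the term \<open>\<alpha>\<close>, these algebras are
  given by explicit carriers and operations.
\<close>

record 'a star_alg =
  carr :: "'a set"
  sadd :: "'a \<Rightarrow> 'a \<Rightarrow> 'a"
  sscale :: "complex \<Rightarrow> 'a \<Rightarrow> 'a"
  smult :: "'a \<Rightarrow> 'a \<Rightarrow> 'a"
  sstar :: "'a \<Rightarrow> 'a"
  snorm :: "'a \<Rightarrow> real"

definition sdist :: "'a star_alg \<Rightarrow> 'a \<Rightarrow> 'a \<Rightarrow> real"
  where "sdist A a b = snorm A (sadd A a (sscale A (- 1) b))"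

definition star_iso :: "'a star_alg \<Rightarrow> 'b star_alg \<Rightarrow> ('a \<Rightarrow> 'b) \<Rightarrow> bool"
  where "star_iso A B \<Phi> \<longleftrightarrow> bij_betw \<Phi> (carr A) (carr B) \<and>
    (\<forall>a\<in>carr A. \<forall>b\<in>carr A. \<Phi> (sadd A a b) = sadd B (\<Phi> a) (\<Phi> b)) \<and>
    (\<forall>c. \<forall>a\<in>carr A. \<Phi> (sscale A c a) = sscale B c (\<Phi> a)) \<and>
    (\<forall>a\<in>carr A. \<forall>b\<in>carr A. \<Phi> (smult A a b) = smult B (\<Phi> a) (\<Phi> b)) \<and>
    (\<forall>a\<in>carr A. \<Phi> (sstar A a) = sstar B (\<Phi> a)) \<and>
    (\<forall>a\<in>carr A. snorm B (\<Phi> a) = snorm A a)"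

definition cstar_alg :: "'a::cstar_algebra star_alg"
  where "cstar_alg = \<lparr>carr = UNIV, sadd = (+), sscale = scaleC, smult = (*), sstar = star,
    snorm = norm\<rparr>"

definition operator_alg :: "('h::complex_hilbert \<Rightarrow>\<^sub>L 'h) set \<Rightarrow> ('h \<Rightarrow>\<^sub>L 'h) star_alg"
  where "operator_alg V = \<lparr>carr = V, sadd = (+), sscale = scaleC, smult = (o\<^sub>L),
    sstar = adjoint_op, snorm = norm\<rparr>"

text \<open>
  The type \<^typ>\<open>'h \<Rightarrow>\<^sub>L 'h\<close> consists of the bounded real-linear operators, so complex linearity is
  required separately.
\<close>

definition star_rep :: "'a star_alg \<Rightarrow> ('a \<Rightarrow> 'h::complex_hilbert \<Rightarrow>\<^sub>L 'h) \<Rightarrow> bool"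
  where "star_rep A \<rho> \<longleftrightarrow>
    (\<forall>a\<in>carr A. clinear_op (\<rho> a)) \<and>
    (\<forall>a\<in>carr A. \<forall>b\<in>carr A. \<rho> (sadd A a b) = \<rho> a + \<rho> b) \<and>
    (\<forall>c. \<forall>a\<in>carr A. \<rho> (sscale A c a) = c *\<^sub>C \<rho> a) \<and>
    (\<forall>a\<in>carr A. \<forall>b\<in>carr A. \<rho> (smult A a b) = \<rho> a o\<^sub>L \<rho> b) \<and>
    (\<forall>a\<in>carr A. is_adjoint (\<rho> a) (\<rho> (sstar A a)))"

definition faithful_rep :: "'a star_alg \<Rightarrow> ('a \<Rightarrow> 'h::complex_hilbert \<Rightarrow>\<^sub>L 'h) \<Rightarrow> bool"
  where "faithful_rep A \<rho> \<longleftrightarrow> star_rep A \<rho> \<and> inj_on \<rho> (carr A)"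

text \<open>
  A nondegenerate representation on a closed subspace \<open>S\<close> of \<open>'h\<close>.  An operator on \<open>S\<close> is
  identified with its extension to \<open>'h\<close> by \<open>0\<close> on the orthogonal complement of \<open>S\<close>, which has
  the same norm.
\<close>

definition nondegenerate_rep_on ::
    "'h::complex_hilbert set \<Rightarrow> 'a star_alg \<Rightarrow> ('a \<Rightarrow> 'h \<Rightarrow>\<^sub>L 'h) \<Rightarrow> bool"
  where "nondegenerate_rep_on S A \<rho> \<longleftrightarrow> csubspace S \<and> closed S \<and> star_rep A \<rho> \<and>
    (\<forall>a\<in>carr A. \<forall>x. blinfun_apply (\<rho> a) x \<in> S) \<and>
    (\<forall>a\<in>carr A. \<forall>x. (\<forall>y\<in>S. cinner x y = 0) \<longrightarrow> blinfun_apply (\<rho> a) x = 0) \<and>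
    closure (cspan {blinfun_apply (\<rho> a) x | a x. a \<in> carr A \<and> x \<in> S}) = S"

text \<open>
  The supremum over all nondegenerate representations.  HOL cannot quantify over the class of
  all Hilbert spaces; it suffices to use the closed subspaces of \<open>\<ell>\<^sup>2('a)\<close>, that is, up to unitary
  equivalence, all Hilbert spaces of dimension at most the cardinality of \<open>'a\<close>: a nondegenerate
  representation is a direct sum of cyclic ones, and a cyclic representation has a dense subspace
  that is the image of \<open>carr A\<close>, hence an orthonormal basis that injects into \<open>carr A\<close>.
\<close>

definition enveloping_norm :: "'a star_alg \<Rightarrow> 'a \<Rightarrow> real"
  where "enveloping_norm A a =
    Sup {norm (\<rho> a) | S (\<rho> :: 'a \<Rightarrow> ('a, complex) l2 \<Rightarrow>\<^sub>L ('a, complex) l2).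
      nondegenerate_rep_on S A \<rho>}"

text \<open>The completion: Cauchy sequences modulo null sequences, with termwise operations.\<close>

definition cauchy_seqs :: "'a star_alg \<Rightarrow> (nat \<Rightarrow> 'a) set"
  where "cauchy_seqs A = {u. (\<forall>n. u n \<in> carr A) \<and>
    (\<forall>e>0. \<exists>N. \<forall>m\<ge>N. \<forall>n\<ge>N. sdist A (u m) (u n) < e)}"

definition null_rel :: "'a star_alg \<Rightarrow> ((nat \<Rightarrow> 'a) \<times> (nat \<Rightarrow> 'a)) set"
  where "null_rel A = {(u, v). u \<in> cauchy_seqs A \<and> v \<in> cauchy_seqs A \<and>
    (\<lambda>n. sdist A (u n) (v n)) \<longlonglongrightarrow> 0}"

definition seq_class :: "'a star_alg \<Rightarrow> (nat \<Rightarrow> 'a) \<Rightarrow> (nat \<Rightarrow> 'a) set"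
  where "seq_class A u = null_rel A `` {u}"

definition completion :: "'a star_alg \<Rightarrow> (nat \<Rightarrow> 'a) set star_alg"
  where "completion A = \<lparr>
    carr = cauchy_seqs A // null_rel A,
    sadd = (\<lambda>a b. \<Union>u\<in>a. \<Union>v\<in>b. seq_class A (\<lambda>n. sadd A (u n) (v n))),
    sscale = (\<lambda>c a. \<Union>u\<in>a. seq_class A (\<lambda>n. sscale A c (u n))),
    smult = (\<lambda>a b. \<Union>u\<in>a. \<Union>v\<in>b. seq_class A (\<lambda>n. smult A (u n) (v n))),
    sstar = (\<lambda>a. \<Union>u\<in>a. seq_class A (\<lambda>n. sstar A (u n))),
    snorm = (\<lambda>a. THE r. \<forall>u\<in>a. (\<lambda>n. snorm A (u n)) \<longlonglongrightarrow> r)\<rparr>"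

section \<open>Crossed products and semicrossed products\<close>

definition l1_alg ::
    "('g::ab_group_add \<Rightarrow> 'a::cstar_algebra \<Rightarrow> 'a) \<Rightarrow> ('g \<Rightarrow> 'a) star_alg"
  where "l1_alg \<alpha> = \<lparr>
    carr = {F. (\<lambda>s. norm (F s)) summable_on UNIV},
    sadd = (\<lambda>F K s. F s + K s),
    sscale = (\<lambda>c F s. c *\<^sub>C F s),
    smult = (\<lambda>F K s. \<Sum>\<^sub>\<infinity>t. F t * \<alpha> t (K (s - t))),
    sstar = (\<lambda>F s. \<alpha> s (star (F (- s)))),
    snorm = (\<lambda>F. \<Sum>\<^sub>\<infinity>s. norm (F s))\<rparr>"

definition delta :: "'g \<Rightarrow> 'a::zero \<Rightarrow> 'g \<Rightarrow> 'a"
  where "delta s f = (\<lambda>t. if t = s then f else 0)"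

lemma l1_alg_mult_delta:
  assumes "\<And>t. \<alpha> t 0 = 0"
  shows "smult (l1_alg \<alpha>) (delta s f) (delta t g) = delta (s + t) (f * \<alpha> s g)"
proof
  fix r
  have "smult (l1_alg \<alpha>) (delta s f) (delta t g) r
      = (\<Sum>\<^sub>\<infinity>q. delta s f q * \<alpha> q (delta t g (r - q)))"
    by (simp add: l1_alg_def)
  also have "\<dots> = (\<Sum>\<^sub>\<infinity>q\<in>{s}. delta s f q * \<alpha> q (delta t g (r - q)))"
    by (rule infsum_cong_neutral) (auto simp: delta_def)
  also have "\<dots> = delta (s + t) (f * \<alpha> s g) r"
    by (auto simp: delta_def assms algebra_simps)
  finally show "smult (l1_alg \<alpha>) (delta s f) (delta t g) r = delta (s + t) (f * \<alpha> s g) r" .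
qed

lemma l1_alg_star_delta:
  assumes "\<And>t. \<alpha> t 0 = 0"
  shows "sstar (l1_alg \<alpha>) (delta s f) = delta (- s) (\<alpha> (- s) (star f))"
proof
  fix r
  have "star (0::'b) = 0"
    by (rule linear_0[OF bounded_linear.linear[OF bounded_linear_star]])
  then show "sstar (l1_alg \<alpha>) (delta s f) r = delta (- s) (\<alpha> (- s) (star f)) r"
    by (auto simp: l1_alg_def delta_def assms)
qed

definition l1_env ::
    "('g::ab_group_add \<Rightarrow> 'a::cstar_algebra \<Rightarrow> 'a) \<Rightarrow> ('g \<Rightarrow> 'a) star_alg"
  where "l1_env \<alpha> = (l1_alg \<alpha>)\<lparr>snorm := enveloping_norm (l1_alg \<alpha>)\<rparr>"

definition crossed_product ::
    "('g::ab_group_add \<Rightarrow> 'a::cstar_algebra \<Rightarrow> 'a) \<Rightarrow> (nat \<Rightarrow> 'g \<Rightarrow> 'a) set star_alg"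
  where "crossed_product \<alpha> = completion (l1_env \<alpha>)"

definition cp_of ::
    "('g::ab_group_add \<Rightarrow> 'a::cstar_algebra \<Rightarrow> 'a) \<Rightarrow> ('g \<Rightarrow> 'a) \<Rightarrow> (nat \<Rightarrow> 'g \<Rightarrow> 'a) set"
  where "cp_of \<alpha> F = seq_class (l1_env \<alpha>) (\<lambda>_. F)"

text \<open>The closure in the crossed product of the functions supported on \<open>P\<close>.\<close>

definition semicrossed_product ::
    "'g set \<Rightarrow> ('g::ab_group_add \<Rightarrow> 'a::cstar_algebra \<Rightarrow> 'a) \<Rightarrow> (nat \<Rightarrow> 'g \<Rightarrow> 'a) set set"
  where "semicrossed_product P \<alpha> = {a \<in> carr (crossed_product \<alpha>).
    \<forall>e>0. \<exists>F \<in> carr (l1_alg \<alpha>). (\<forall>s. s \<notin> P \<longrightarrow> F s = 0) \<and>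
      sdist (crossed_product \<alpha>) a (cp_of \<alpha> F) < e}"

section \<open>Actions induced by homeomorphisms\<close>

definition int_power :: "('a \<Rightarrow> 'a) \<Rightarrow> int \<Rightarrow> 'a \<Rightarrow> 'a"
  where "int_power g m = (if 0 \<le> m then g ^^ nat m else inv g ^^ nat (- m))"

definition comp_aut ::
    "('x \<Rightarrow> 'x) \<Rightarrow> ('x::topological_space \<Rightarrow>\<^sub>C complex) \<Rightarrow> 'x \<Rightarrow>\<^sub>C complex"
  where "comp_aut \<sigma> f = Bcontfun (\<lambda>x. apply_bcontfun f (\<sigma> x))"

definition z_action ::
    "('x \<Rightarrow> 'x) \<Rightarrow> int \<Rightarrow> ('x::topological_space \<Rightarrow>\<^sub>C complex) \<Rightarrow> 'x \<Rightarrow>\<^sub>C complex"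
  where "z_action \<sigma> = int_power (comp_aut \<sigma>)"

definition tensor_fun ::
    "('x::topological_space \<Rightarrow>\<^sub>C complex) \<Rightarrow> ('y::topological_space \<Rightarrow>\<^sub>C complex) \<Rightarrow>
      ('x \<times> 'y) \<Rightarrow>\<^sub>C complex"
  where "tensor_fun f g = Bcontfun (\<lambda>p. apply_bcontfun f (fst p) * apply_bcontfun g (snd p))"

definition z2_action ::
    "('x \<Rightarrow> 'x) \<Rightarrow> ('y \<Rightarrow> 'y) \<Rightarrow> int \<times> int \<Rightarrow>
      (('x::topological_space \<times> 'y::topological_space) \<Rightarrow>\<^sub>C complex) \<Rightarrow> ('x \<times> 'y) \<Rightarrow>\<^sub>C complex"
  where "z2_action \<sigma> \<tau> = (\<lambda>(m, n). comp_aut (map_prod (int_power \<sigma> m) (int_power \<tau> n)))"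

lemma apply_comp_aut:
  assumes "continuous_on UNIV \<sigma>"
  shows "apply_bcontfun (comp_aut \<sigma> f) x = apply_bcontfun f (\<sigma> x)"
proof -
  have "(\<lambda>x. apply_bcontfun f (\<sigma> x)) \<in> bcontfun"
    by (rule bcontfun_normI[where b = "norm f"])
      (auto intro!: continuous_on_compose2[OF continuous_on_apply_bcontfun assms] norm_bounded)
  then show ?thesis by (simp add: comp_aut_def Bcontfun_inverse)
qed

lemma apply_tensor_fun:
  "apply_bcontfun (tensor_fun f g) p = apply_bcontfun f (fst p) * apply_bcontfun g (snd p)"
proof -
  have "(\<lambda>p. apply_bcontfun f (fst p) * apply_bcontfun g (snd p)) \<in> bcontfun"
  proof (rule bcontfun_normI[where b = "norm f * norm g"])
    show "continuous_on UNIV (\<lambda>p. apply_bcontfun f (fst p) * apply_bcontfun g (snd p))"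
      by (intro continuous_on_mult continuous_on_compose2[OF continuous_on_apply_bcontfun]
          continuous_intros) auto
    show "norm (apply_bcontfun f (fst p) * apply_bcontfun g (snd p)) \<le> norm f * norm g" for p
      by (rule order_trans[OF norm_mult_ineq]) (intro mult_mono norm_bounded norm_ge_zero)
  qed
  then show ?thesis by (simp add: tensor_fun_def Bcontfun_inverse)
qed

lemma homeomorphic_map_UNIV:
  assumes "homeomorphic_map euclidean euclidean \<sigma>"
  shows "bij \<sigma>" "continuous_on UNIV \<sigma>" "continuous_on UNIV (inv \<sigma>)"
proof -
  obtain \<tau> where h: "homeomorphic_maps euclidean euclidean \<sigma> \<tau>"
    using assms homeomorphic_map_maps by blast
  then have *: "\<tau> (\<sigma> x) = x" "\<sigma> (\<tau> y) = y" for x y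
    by (auto simp: homeomorphic_maps_def)
  show "bij \<sigma>" by (metis * bijI')
  have "inv \<sigma> = \<tau>" using * by (metis ext inv_equality)
  with h show "continuous_on UNIV \<sigma>" "continuous_on UNIV (inv \<sigma>)"
    by (auto simp: homeomorphic_maps_def)
qed

lemma continuous_funpow:
  "continuous_on UNIV g \<Longrightarrow> continuous_on UNIV ((g :: 'x::topological_space \<Rightarrow> 'x) ^^ n)"
  by (induction n) (auto intro: continuous_on_compose2[of UNIV g])

lemma continuous_int_power:
  "homeomorphic_map euclidean euclidean \<sigma> \<Longrightarrow> continuous_on UNIV (int_power \<sigma> m)"
  by (simp add: int_power_def continuous_funpow homeomorphic_map_UNIV)

lemma apply_z_action:
  assumes h: "homeomorphic_map euclidean euclidean \<sigma>"
  shows "apply_bcontfun (z_action \<sigma> m f) x = apply_bcontfun f (int_power \<sigma> m x)"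
proof -
  note c = homeomorphic_map_UNIV[OF h]
  have pow: "apply_bcontfun ((comp_aut g ^^ n) f) x = apply_bcontfun f ((g ^^ n) x)"
    if "continuous_on UNIV g" for g n and f :: "'a \<Rightarrow>\<^sub>C complex" and x
    by (induction n arbitrary: x) (simp_all add: apply_comp_aut[OF that] funpow_swap1[of g])
  have "inv (comp_aut \<sigma>) = comp_aut (inv \<sigma>)"
    using c by (intro ext inv_equality bcontfun_eqI)
      (simp_all add: apply_comp_aut bij_is_inj bij_is_surj surj_f_inv_f)
  then show ?thesis
    by (simp add: z_action_def int_power_def pow c)
qed

lemma z2_action_tensor_fun:
  assumes "homeomorphic_map euclidean euclidean \<sigma>" "homeomorphic_map euclidean euclidean \<tau>"
  shows "z2_action \<sigma> \<tau> (m, n) (tensor_fun f g) = tensor_fun (z_action \<sigma> m f) (z_action \<tau> n g)"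
proof (rule bcontfun_eqI)
  fix p
  have "continuous_on UNIV (map_prod (int_power \<sigma> m) (int_power \<tau> n))"
    unfolding map_prod_def case_prod_beta
    by (intro continuous_on_Pair continuous_on_compose2[OF continuous_int_power[OF assms(1)]]
        continuous_on_compose2[OF continuous_int_power[OF assms(2)]] continuous_intros) auto
  then show "apply_bcontfun (z2_action \<sigma> \<tau> (m, n) (tensor_fun f g)) p
      = apply_bcontfun (tensor_fun (z_action \<sigma> m f) (z_action \<tau> n g)) p"
    by (simp add: z2_action_def apply_comp_aut apply_tensor_fun apply_z_action assms)
qed

section \<open>The canonical representation and the spatial tensor product\<close>

text \<open>\<open>shift_power n\<close> is \<open>U\<^sup>n\<close>, for \<open>U\<close> the bilateral shift.\<close>

definition shift_power :: "int \<Rightarrow> (int, 'h::complex_hilbert) l2 \<Rightarrow>\<^sub>L (int, 'h) l2"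
  where "shift_power n =
    (THE T. \<forall>m h. blinfun_apply T (l2_single m h) = l2_single (m + n) h)"

definition tilde_rep ::
    "('a \<Rightarrow> 'h::complex_hilbert \<Rightarrow>\<^sub>L 'h) \<Rightarrow> (int \<Rightarrow> 'a \<Rightarrow> 'a) \<Rightarrow>
      'a \<Rightarrow> (int, 'h) l2 \<Rightarrow>\<^sub>L (int, 'h) l2"
  where "tilde_rep \<pi> \<alpha> f =
    (THE T. \<forall>m h. blinfun_apply T (l2_single m h) = l2_single m (blinfun_apply (\<pi> (\<alpha> (- m) f)) h))"

definition l1_rep ::
    "('a \<Rightarrow> 'h::complex_hilbert \<Rightarrow>\<^sub>L 'h) \<Rightarrow> (int \<Rightarrow> 'a \<Rightarrow> 'a) \<Rightarrow>
      (int \<Rightarrow> 'a) \<Rightarrow> (int, 'h) l2 \<Rightarrow>\<^sub>L (int, 'h) l2"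
  where "l1_rep \<pi> \<alpha> F = (\<Sum>\<^sub>\<infinity>m. tilde_rep \<pi> \<alpha> (F m) o\<^sub>L shift_power m)"

text \<open>Extension by continuity to the completion.\<close>

definition canonical_rep ::
    "('a \<Rightarrow> 'h::complex_hilbert \<Rightarrow>\<^sub>L 'h) \<Rightarrow> (int \<Rightarrow> 'a \<Rightarrow> 'a) \<Rightarrow>
      (nat \<Rightarrow> int \<Rightarrow> 'a) set \<Rightarrow> (int, 'h) l2 \<Rightarrow>\<^sub>L (int, 'h) l2"
  where "canonical_rep \<pi> \<alpha> a = (THE T. \<forall>u\<in>a. (\<lambda>n. l1_rep \<pi> \<alpha> (u n)) \<longlonglongrightarrow> T)"

text \<open>
  \<open>hilbert_tensor t\<close>: the Hilbert space \<open>'k\<close> is the Hilbert space tensor product of \<open>'a\<close> and \<open>'b\<close>,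
  with \<open>t x y\<close> as \<open>x \<otimes> y\<close>.  This determines \<open>('k, t)\<close> up to a unique unitary.
\<close>

definition hilbert_tensor ::
    "('a::complex_hilbert \<Rightarrow> 'b::complex_hilbert \<Rightarrow> 'k::complex_hilbert) \<Rightarrow> bool"
  where "hilbert_tensor t \<longleftrightarrow>
    (\<forall>x x' y. t (x + x') y = t x y + t x' y) \<and>
    (\<forall>x y y'. t x (y + y') = t x y + t x y') \<and>
    (\<forall>c x y. t (c *\<^sub>C x) y = c *\<^sub>C t x y \<and> t x (c *\<^sub>C y) = c *\<^sub>C t x y) \<and>
    (\<forall>x x' y y'. cinner (t x y) (t x' y') = cinner x x' * cinner y y') \<and>
    closure (cspan {t x y | x y. True}) = UNIV"

definition op_tensor ::
    "('a::complex_hilbert \<Rightarrow> 'b::complex_hilbert \<Rightarrow> 'k::complex_hilbert) \<Rightarrow>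
      ('a \<Rightarrow>\<^sub>L 'a) \<Rightarrow> ('b \<Rightarrow>\<^sub>L 'b) \<Rightarrow> 'k \<Rightarrow>\<^sub>L 'k"
  where "op_tensor t A B =
    (THE C. \<forall>x y. blinfun_apply C (t x y) = t (blinfun_apply A x) (blinfun_apply B y))"

definition spatial_tensor ::
    "('a::complex_hilbert \<Rightarrow> 'b::complex_hilbert \<Rightarrow> 'k::complex_hilbert) \<Rightarrow>
      ('p \<Rightarrow> 'a \<Rightarrow>\<^sub>L 'a) \<Rightarrow> ('q \<Rightarrow> 'b \<Rightarrow>\<^sub>L 'b) \<Rightarrow> 'p set \<Rightarrow> 'q set \<Rightarrow> ('k \<Rightarrow>\<^sub>L 'k) set"
  where "spatial_tensor t \<rho>\<^sub>1 \<rho>\<^sub>2 P Q =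
    closure (cspan {op_tensor t (\<rho>\<^sub>1 a) (\<rho>\<^sub>2 b) | a b. a \<in> P \<and> b \<in> Q})"

end

theory Submission
  imports Defs
begin

text \<open>
  Let \<open>G\<close> be \<open>\<int>\<close> or \<open>\<int>\<^sup>2\<close>, acting on a compact metric space \<open>Z\<close> by homeomorphisms \<open>\<theta>\<^sub>g\<close>, and let
  \<open>(\<alpha>\<^sub>g f)(z) = f(\<theta>\<^sub>g z)\<close>.  The theorem holds because the enveloping norm on \<open>\<ell>\<^sup>1(G, C(Z), \<alpha>)\<close> is
  attained by every representation that sees all orbits, and the tensor product of the two canonical
  representations is such a representation of \<open>\<ell>\<^sup>1(\<int>\<^sup>2, C(X \<times> Y), \<alpha>)\<close>.

  The evaluation at a point \<open>z\<close> induces the orbit representation on \<open>\<ell>\<^sup>2(G)\<close>, namely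
  \<open>\<delta>\<^sub>s \<otimes> f : \<epsilon>\<^sub>j \<mapsto> f(\<theta>(-j-s) z) \<epsilon>\<^bsub>j+s\<^esub>\<close>.  The enveloping norm is the supremum over \<open>z\<close> of the norms
  in the orbit representations.
  It is at least this supremum since \<open>\<ell>\<^sup>2(G)\<close> embeds into the Hilbert space over which the enveloping
  norm is formed (\<open>induced_nondegenerate\<close>).  It is at most this supremum since \<open>G\<close> is amenable
  (\<open>orbit_bound_dominates\<close>): for any representation \<open>\<rho>\<close>, averaging over a Folner set reduces the
  estimate of \<open>\<rho>(F)\<close> to that of finite matrices over \<open>C(Z)\<close>, and the norm of the image of such a matrix
  under a representation of \<open>C(Z)\<close> is at most the supremum over \<open>z\<close> of the norms of the scalar matrices
  (\<open>pointwise_matrix_bound\<close>).  Representations of \<open>\<ell>\<^sup>1\<close> are not assumed to be continuous; that they are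
  contractive is \<open>star_rep_l1_contractive\<close>.

  If a representation \<open>\<Lambda>\<close> has, for every \<open>z\<close>, orthonormal families on which it acts approximately like the
  orbit representation at \<open>z\<close>, it dominates all orbit representations, so that \<open>\<parallel>\<Lambda>(F)\<parallel>\<close> is the enveloping
  norm (\<open>enveloping_norm_localizing\<close>).  The crossed product is then the closure of the range of \<open>\<Lambda>\<close>
  (\<open>completion_star_iso\<close>), and each semicrossed product is the closure of the image of the functions
  supported on the cone (\<open>completion_closure\<close>).

  A faithful representation of \<open>C(X)\<close> has unit vectors \<open>h\<^sub>n\<close> that are asymptotically eigenvectors with
  eigenvalues \<open>f(x)\<close> (\<open>faithful_rep_approximate_character\<close>), and the vectors \<open>\<delta>\<^sub>j \<otimes> h\<^sub>n\<close> form such families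
  for the canonical representation; tensor products of these vectors serve for \<open>\<int>\<^sup>2\<close>.  To define \<open>\<Lambda>\<close> on
  all of \<open>C(X \<times> Y)\<close> rather than on the algebraic tensor product, \<open>tensor_star_rep\<close> extends
  \<open>f \<otimes> g \<mapsto> \<pi>\<^sub>1(f) \<otimes> \<pi>\<^sub>2(g)\<close> by continuity.  Finally, the spatial tensor product and the closed range of
  \<open>\<Lambda>\<close> are the closed span of the same elementary operators \<open>\<Lambda>(\<delta>\<^bsub>(m,n)\<^esub> \<otimes> (f \<otimes> g))\<close>, for the full group
  as well as for the cone (\<open>spatial_tensor_eq\<close>).
\<close>

section \<open>Inner products and orthonormal families\<close>

lemma cinner_zero_left [simp]: "cinner 0 y = 0"
  using cinner_add_left[of 0 0 y] by simp

lemma cinner_zero_right [simp]: "cinner x 0 = 0"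
  using cinner_add_right[of x 0 0] by simp

lemma cinner_minus_left [simp]: "cinner (- x) y = - cinner x y"
  using cinner_add_left[of x "- x" y] by (simp add: add_eq_0_iff)

lemma cinner_minus_right [simp]: "cinner x (- y) = - cinner x y"
  using cinner_add_right[of x y "- y"] by (simp add: add_eq_0_iff)

lemma cinner_diff_left: "cinner (x - x') y = cinner x y - cinner x' y"
  using cinner_add_left[of x "- x'" y] by simp

lemma cinner_diff_right: "cinner x (y - y') = cinner x y - cinner x y'"
  using cinner_add_right[of x y "- y'"] by simp

lemma cinner_sum_left: "cinner (sum f A) y = (\<Sum>i\<in>A. cinner (f i) y)"
  by (induction A rule: infinite_finite_induct) (simp_all add: cinner_add_left)

lemma cinner_sum_right: "cinner x (sum f A) = (\<Sum>i\<in>A. cinner x (f i))"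
  by (induction A rule: infinite_finite_induct) (simp_all add: cinner_add_right)

lemma norm_sq_cinner: "(norm x)\<^sup>2 = Re (cinner x x)"
  by (simp add: cinner_self)

lemma cauchy_schwarz: "cmod (cinner x y) \<le> norm x * norm y"
proof (cases "x = 0 \<or> y = 0")
  case False
  define x' where "x' = complex_of_real (inverse (norm x)) *\<^sub>C x"
  define y' where "y' = complex_of_real (inverse (norm y)) *\<^sub>C y"
  have "norm x' = 1" "norm y' = 1"
    using False by (simp_all add: x'_def y'_def norm_scaleC norm_inverse norm_of_real)
  then have "cmod (cinner x' y') \<le> 1"
    using cmod_cinner_le[of x' y'] by simp
  moreover have "cmod (cinner x' y') = inverse (norm x) * inverse (norm y) * cmod (cinner x y)"
    by (simp add: x'_def y'_def cinner_scaleC_left cinner_scaleC_right norm_mult norm_inverse norm_of_real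
        del: of_real_inverse)
  ultimately show ?thesis
    using False by (simp add: field_simps)
qed auto

lemma bounded_linear_cinner_left: "bounded_linear (\<lambda>x. cinner x y)"
  by (rule bounded_linear_intro[where K = "norm y"])
    (simp_all add: cinner_add_left scaleR_eq_scaleC cinner_scaleC_left scaleC_complex_def cauchy_schwarz)

lemma bounded_linear_cinner_right: "bounded_linear (\<lambda>y. cinner x y)"
proof (rule bounded_linear_intro[where K = "norm x"])
  show "norm (cinner x y) \<le> norm y * norm x" for y
    using cauchy_schwarz[of x y] by (simp add: mult.commute)
qed (simp_all add: cinner_add_right scaleR_eq_scaleC cinner_scaleC_right scaleC_complex_def)

lemma cinner_ext:
  assumes "\<And>y. cinner x y = cinner x' y"
  shows "x = x'"
proof -
  have "cinner (x - x') (x - x') = 0"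
    using assms by (simp add: cinner_diff_left)
  then have "complex_of_real ((norm (x - x'))\<^sup>2) = 0"
    by (simp only: cinner_self)
  then show ?thesis by (simp del: of_real_power)
qed

lemma pythagoras:
  assumes "finite A" and "\<And>i j. i \<in> A \<Longrightarrow> j \<in> A \<Longrightarrow> i \<noteq> j \<Longrightarrow> cinner (f i) (f j) = 0"
  shows "(norm (sum f A))\<^sup>2 = (\<Sum>i\<in>A. (norm (f i))\<^sup>2)"
proof -
  have "cinner (sum f A) (sum f A) = (\<Sum>i\<in>A. \<Sum>j\<in>A. cinner (f i) (f j))"
    unfolding cinner_sum_left cinner_sum_right by (rule sum.swap)
  also have "\<dots> = (\<Sum>i\<in>A. \<Sum>j\<in>A. if j = i then cinner (f i) (f i) else 0)"
    using assms(2) by (intro sum.cong) auto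
  also have "\<dots> = complex_of_real (\<Sum>i\<in>A. (norm (f i))\<^sup>2)"
    using assms(1) by (simp add: cinner_self)
  finally show ?thesis
    by (simp only: norm_sq_cinner Re_complex_of_real)
qed

definition orthonormal :: "('i \<Rightarrow> 'h::complex_hilbert) \<Rightarrow> 'i set \<Rightarrow> bool"
  where "orthonormal e I \<longleftrightarrow> (\<forall>i\<in>I. \<forall>j\<in>I. cinner (e i) (e j) = (if i = j then 1 else 0))"

lemma orthonormal_norm:
  assumes "orthonormal e I" and "i \<in> I"
  shows "norm (e i) = 1"
proof -
  have "(norm (e i))\<^sup>2 = 1\<^sup>2"
    using assms norm_sq_cinner[of "e i"] by (simp add: orthonormal_def)
  then show ?thesis by (metis norm_ge_zero power2_eq_iff_nonneg zero_le_one)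
qed

lemma norm_orthonormal_sum:
  assumes "finite I" and "orthonormal e I"
  shows "(norm (\<Sum>i\<in>I. c i *\<^sub>C e i))\<^sup>2 = (\<Sum>i\<in>I. (cmod (c i))\<^sup>2)"
proof -
  have "(norm (\<Sum>i\<in>I. c i *\<^sub>C e i))\<^sup>2 = (\<Sum>i\<in>I. (norm (c i *\<^sub>C e i))\<^sup>2)"
    using assms by (intro pythagoras)
      (auto simp: cinner_scaleC_left cinner_scaleC_right orthonormal_def)
  then show ?thesis by (simp add: norm_scaleC orthonormal_norm[OF assms(2)])
qed

text \<open>
  Induction on \<open>Y\<close> by the Gram--Schmidt process: \<open>E\<close> is enlarged by the normalized difference of the new
  vector and its projection to the span of \<open>E\<close>, unless they coincide.
\<close>

lemma finite_orthonormal_expansion: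
  assumes "finite (Y :: 'h::complex_hilbert set)"
  shows "\<exists>E. finite E \<and> orthonormal (\<lambda>e. e) E \<and> (\<forall>y\<in>Y. y = (\<Sum>e\<in>E. cinner y e *\<^sub>C e))"
  using assms
proof (induction Y)
  case empty
  show ?case by (rule exI[of _ "{}"]) (simp add: orthonormal_def)
next
  case (insert x Y)
  then obtain E where E: "finite E" "orthonormal (\<lambda>e. e) E" "\<And>y. y \<in> Y \<Longrightarrow> y = (\<Sum>e\<in>E. cinner y e *\<^sub>C e)"
    by blast
  define r where "r = x - (\<Sum>e\<in>E. cinner x e *\<^sub>C e)"
  have rE: "cinner r e = 0" if "e \<in> E" for e
  proof -
    have "cinner (\<Sum>e'\<in>E. cinner x e' *\<^sub>C e') e = (\<Sum>e'\<in>E. if e' = e then cinner x e else 0)"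
      unfolding cinner_sum_left cinner_scaleC_left
      using E(2) that by (intro sum.cong) (auto simp: orthonormal_def)
    then show ?thesis using E(1) that by (simp add: r_def cinner_diff_left)
  qed
  show ?case
  proof (cases "r = 0")
    case True
    then show ?thesis using E by (intro exI[of _ E]) (auto simp: r_def)
  next
    case False
    define u where "u = complex_of_real (inverse (norm r)) *\<^sub>C r"
    have ru: "r = complex_of_real (norm r) *\<^sub>C u"
      using False by (simp add: u_def scaleC_scaleC flip: of_real_mult)
    have uE: "cinner u e = 0" "cinner e u = 0" if "e \<in> E" for e
      using rE[OF that] cinner_commute[of e u] by (simp_all add: u_def cinner_scaleC_left)
    have "norm u = 1" using False by (simp add: u_def norm_scaleC norm_inverse norm_of_real)
    then have uu: "cinner u u = 1" by (simp add: cinner_self)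
    have uE': "u \<notin> E" using uE(1)[of u] uu by auto
    have on: "orthonormal (\<lambda>e. e) (insert u E)"
      using E(2) uu uE by (auto simp: orthonormal_def)
    have xu: "cinner x u = complex_of_real (norm r)"
    proof -
      have "x = complex_of_real (norm r) *\<^sub>C u + (\<Sum>e\<in>E. cinner x e *\<^sub>C e)"
        using ru by (simp add: r_def)
      then have "cinner x u = cinner (complex_of_real (norm r) *\<^sub>C u + (\<Sum>e\<in>E. cinner x e *\<^sub>C e)) u"
        by (rule arg_cong)
      then show ?thesis
        by (simp add: cinner_add_left cinner_sum_left cinner_scaleC_left uu uE)
    qed
    have "y = (\<Sum>e\<in>insert u E. cinner y e *\<^sub>C e)" if "y \<in> insert x Y" for y
    proof (cases "y = x")
      case True
      then show ?thesis using E(1) uE' ru by (simp add: xu r_def)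
    next
      case False
      then have y: "y = (\<Sum>e\<in>E. cinner y e *\<^sub>C e)" using that E(3) by blast
      have "cinner y u = cinner (\<Sum>e\<in>E. cinner y e *\<^sub>C e) u"
        by (rule arg_cong[OF y])
      then have "cinner y u = 0" by (simp add: cinner_sum_left cinner_scaleC_left uE)
      then show ?thesis using E(1) uE' y by simp
    qed
    then show ?thesis using E(1) on by (intro exI[of _ "insert u E"]) auto
  qed
qed

text \<open>
  A scalar matrix has the same norm on \<open>\<H>\<^sup>n\<close> as on \<open>\<complex>\<^sup>n\<close>: expand the vectors in an orthonormal
  basis of their span and apply the scalar bound to each coordinate.
\<close>

lemma scalar_matrix_amplification:
  fixes x :: "'c \<Rightarrow> 'h::complex_hilbert" and M :: "'r \<Rightarrow> 'c \<Rightarrow> complex"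
  assumes fin: "finite R" "finite J"
    and bound: "\<And>c. (\<Sum>r\<in>R. (cmod (\<Sum>j\<in>J. M r j * c j))\<^sup>2) \<le> K * (\<Sum>j\<in>J. (cmod (c j))\<^sup>2)"
  shows "(\<Sum>r\<in>R. (norm (\<Sum>j\<in>J. M r j *\<^sub>C x j))\<^sup>2) \<le> K * (\<Sum>j\<in>J. (norm (x j))\<^sup>2)"
proof -
  obtain E where E: "finite E" "orthonormal (\<lambda>e. e) E" "\<And>y. y \<in> x ` J \<Longrightarrow> y = (\<Sum>e\<in>E. cinner y e *\<^sub>C e)"
    using finite_orthonormal_expansion[of "x ` J"] fin by auto
  note on = norm_orthonormal_sum[OF E(1,2), simplified]
  have xj: "x j = (\<Sum>e\<in>E. cinner (x j) e *\<^sub>C e)" if "j \<in> J" for j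
    using E(3) that by blast
  have "(\<Sum>j\<in>J. M r j *\<^sub>C x j) = (\<Sum>j\<in>J. \<Sum>e\<in>E. (M r j * cinner (x j) e) *\<^sub>C e)" for r
    by (intro sum.cong refl) (subst xj, auto simp: complex_vector.scale_sum_right scaleC_scaleC)
  also have "\<And>r. \<dots> r = (\<Sum>e\<in>E. (\<Sum>j\<in>J. M r j * cinner (x j) e) *\<^sub>C e)"
    by (subst sum.swap) (simp add: complex_vector.scale_sum_left)
  finally have "(\<Sum>r\<in>R. (norm (\<Sum>j\<in>J. M r j *\<^sub>C x j))\<^sup>2)
      = (\<Sum>r\<in>R. \<Sum>e\<in>E. (cmod (\<Sum>j\<in>J. M r j * cinner (x j) e))\<^sup>2)"
    by (simp add: on)
  also have "\<dots> = (\<Sum>e\<in>E. \<Sum>r\<in>R. (cmod (\<Sum>j\<in>J. M r j * cinner (x j) e))\<^sup>2)"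
    by (rule sum.swap)
  also have "\<dots> \<le> (\<Sum>e\<in>E. K * (\<Sum>j\<in>J. (cmod (cinner (x j) e))\<^sup>2))"
    by (intro sum_mono bound)
  also have "\<dots> = K * (\<Sum>j\<in>J. \<Sum>e\<in>E. (cmod (cinner (x j) e))\<^sup>2)"
    by (subst sum.swap) (simp add: sum_distrib_left)
  also have "\<dots> = K * (\<Sum>j\<in>J. (norm (x j))\<^sup>2)"
  proof -
    have "(norm (x j))\<^sup>2 = (\<Sum>e\<in>E. (cmod (cinner (x j) e))\<^sup>2)" if "j \<in> J" for j
      by (subst xj[OF that]) (rule on)
    then show ?thesis by simp
  qed
  finally show ?thesis .
qed

section \<open>Complex linear operators and adjoints\<close>

lemma clinear_opD: "clinear_op T \<Longrightarrow> T (c *\<^sub>C x) = c *\<^sub>C T x"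
  by (simp add: clinear_op_def)

lemma clinear_op_compose: "clinear_op S \<Longrightarrow> clinear_op T \<Longrightarrow> clinear_op (S o\<^sub>L T)"
  by (simp add: clinear_op_def)

lemma blinfun_compose_assoc: "(A o\<^sub>L B) o\<^sub>L C = A o\<^sub>L (B o\<^sub>L C)"
  by (rule blinfun_eqI) simp

lemma scaleC_compose_left: "(c *\<^sub>C S) o\<^sub>L T = c *\<^sub>C (S o\<^sub>L T)"
  by (rule blinfun_eqI) simp

lemma bounded_linear_compose_left: "bounded_linear (\<lambda>T. T o\<^sub>L V)"
  by (rule bounded_bilinear.bounded_linear_left[OF bounded_bilinear_blinfun_compose])

lemma bounded_linear_compose_right: "bounded_linear (\<lambda>T. V o\<^sub>L T)"
  by (rule bounded_bilinear.bounded_linear_right[OF bounded_bilinear_blinfun_compose])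

lemma bounded_linear_apply: "bounded_linear (\<lambda>T. blinfun_apply T x)"
  by (rule blinfun.bounded_linear_left)

lemma is_adjointD: "is_adjoint T T' \<Longrightarrow> cinner (T x) y = cinner x (T' y)"
  by (simp add: is_adjoint_def)

lemma is_adjoint_sym: "is_adjoint T T' \<Longrightarrow> is_adjoint T' T"
  unfolding is_adjoint_def by (metis cinner_commute)

lemma is_adjoint_compose:
  "is_adjoint S S' \<Longrightarrow> is_adjoint T T' \<Longrightarrow> is_adjoint (S o\<^sub>L T) (T' o\<^sub>L S')"
  by (simp add: is_adjoint_def)

lemma is_adjoint_unique: "is_adjoint T T' \<Longrightarrow> is_adjoint T T'' \<Longrightarrow> T' = T''"
proof (rule blinfun_eqI, rule cinner_ext)
  fix x y assume "is_adjoint T T'" "is_adjoint T T''"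
  then show "cinner (T' x) y = cinner (T'' x) y"
    by (simp add: is_adjointD[OF is_adjoint_sym])
qed

lemma adjoint_op_eq: "is_adjoint T T' \<Longrightarrow> adjoint_op T = T'"
  unfolding adjoint_op_def by (blast intro: is_adjoint_unique)

lemma is_adjoint_tendsto:
  assumes "(\<lambda>n. S n) \<longlonglongrightarrow> T" "(\<lambda>n. S' n) \<longlonglongrightarrow> T'" and "\<And>n. is_adjoint (S n) (S' n)"
  shows "is_adjoint T T'"
  unfolding is_adjoint_def
proof (intro allI)
  fix x y
  have "(\<lambda>n. cinner (S n x) y) \<longlonglongrightarrow> cinner (T x) y"
    by (intro bounded_linear.tendsto[OF bounded_linear_cinner_left]
        bounded_linear.tendsto[OF bounded_linear_apply] assms(1))
  moreover have "(\<lambda>n. cinner x (S' n y)) \<longlonglongrightarrow> cinner x (T' y)"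
    by (intro bounded_linear.tendsto[OF bounded_linear_cinner_right]
        bounded_linear.tendsto[OF bounded_linear_apply] assms(2))
  ultimately show "cinner (T x) y = cinner x (T' y)"
    using assms(3) LIMSEQ_unique by (simp add: is_adjoint_def)
qed

lemma clinear_op_tendsto:
  assumes "(\<lambda>n. S n) \<longlonglongrightarrow> T" and "\<And>n. clinear_op (S n)"
  shows "clinear_op T"
  unfolding clinear_op_def
proof (intro allI)
  fix c x
  have "(\<lambda>n. S n (c *\<^sub>C x)) \<longlonglongrightarrow> T (c *\<^sub>C x)"
    by (intro bounded_linear.tendsto[OF bounded_linear_apply] assms(1))
  moreover have "(\<lambda>n. c *\<^sub>C (S n) x) \<longlonglongrightarrow> c *\<^sub>C T x"
    by (intro bounded_linear.tendsto[OF bounded_linear_scaleC]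
        bounded_linear.tendsto[OF bounded_linear_apply] assms(1))
  ultimately show "T (c *\<^sub>C x) = c *\<^sub>C T x"
    using assms(2) LIMSEQ_unique by (simp add: clinear_op_def)
qed

lemma norm_adjoint_le:
  assumes "is_adjoint T T'"
  shows "norm (T x) ^ 2 \<le> norm ((T' o\<^sub>L T) x) * norm x"
proof -
  have "complex_of_real (norm (T x) ^ 2) = cinner (T x) (T x)"
    by (simp only: cinner_self)
  also have "\<dots> = cinner x ((T' o\<^sub>L T) x)"
    by (simp add: is_adjointD[OF assms])
  finally have "norm (T x) ^ 2 = cmod (cinner x ((T' o\<^sub>L T) x))"
    by (metis abs_of_nonneg norm_of_real zero_le_power2)
  then show ?thesis
    using cauchy_schwarz[of x "(T' o\<^sub>L T) x"] by (simp add: mult.commute)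
qed

lemma selfadjoint_idempotent_contraction:
  assumes "is_adjoint P P" and "P o\<^sub>L P = P"
  shows "norm (P x) \<le> norm x"
  using norm_adjoint_le[OF assms(1), of x] assms(2)
  by (cases "norm (P x) = 0") (auto simp: power2_eq_square)

text \<open>
  The adjoint of the row operator \<open>(x\<^sub>k) \<mapsto> \<Sum> W\<^sub>k x\<^sub>k\<close> is the column operator
  \<open>v \<mapsto> (W\<^sub>k v)\<close>, so that one is a contraction when the other is.
\<close>

lemma row_contraction:
  fixes W :: "'k \<Rightarrow> 'h::complex_hilbert \<Rightarrow>\<^sub>L 'h"
  assumes adj: "\<And>k. k \<in> K \<Longrightarrow> is_adjoint (W k) (W k)"
    and col: "\<And>v. (\<Sum>k\<in>K. (norm (W k v))\<^sup>2) \<le> (norm v)\<^sup>2"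
  shows "(norm (\<Sum>k\<in>K. W k (x k)))\<^sup>2 \<le> (\<Sum>k\<in>K. (norm (x k))\<^sup>2)"
proof -
  define v where "v = (\<Sum>k\<in>K. W k (x k))"
  have "cinner (\<Sum>k\<in>K. W k (x k)) v = (\<Sum>k\<in>K. cinner (x k) (W k v))"
    by (simp add: cinner_sum_left is_adjointD[OF adj])
  then have "complex_of_real ((norm v)\<^sup>2) = (\<Sum>k\<in>K. cinner (x k) (W k v))"
    using cinner_self[of v] by (simp add: v_def)
  then have "(norm v)\<^sup>2 = cmod (\<Sum>k\<in>K. cinner (x k) (W k v))"
    by (metis abs_of_nonneg norm_of_real zero_le_power2)
  also have "\<dots> \<le> (\<Sum>k\<in>K. \<bar>norm (x k)\<bar> * \<bar>norm (W k v)\<bar>)"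
    by (rule order_trans[OF norm_sum]) (auto intro!: sum_mono cauchy_schwarz)
  also have "\<dots> \<le> L2_set (\<lambda>k. norm (x k)) K * L2_set (\<lambda>k. norm (W k v)) K"
    by (rule L2_set_mult_ineq)
  also have "\<dots> \<le> L2_set (\<lambda>k. norm (x k)) K * norm v"
  proof (intro mult_left_mono L2_set_nonneg)
    show "L2_set (\<lambda>k. norm (W k v)) K \<le> norm v"
      unfolding L2_set_def using real_sqrt_le_mono[OF col[of v]] by simp
  qed
  finally have "norm v \<le> L2_set (\<lambda>k. norm (x k)) K"
    by (cases "norm v = 0") (auto simp: power2_eq_square L2_set_nonneg)
  then have "(norm v)\<^sup>2 \<le> (L2_set (\<lambda>k. norm (x k)) K)\<^sup>2"
    by (intro power_mono) auto
  then show ?thesis by (simp add: L2_set_sq v_def)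
qed

section \<open>Extension of operators from a total family\<close>

text \<open>
  The maps are only real-linear, so agreement on \<open>G\<close> extends to the complex span because \<open>G\<close> is closed
  under complex multiples.  Antilinear maps are thereby included.
\<close>

lemma bounded_linear_eq_on_total:
  fixes f g :: "'u::complex_normed_vector \<Rightarrow> 'v::real_normed_vector"
  assumes total: "closure (cspan G) = UNIV"
    and scale: "\<And>c x. x \<in> G \<Longrightarrow> c *\<^sub>C x \<in> G"
    and bl: "bounded_linear f" "bounded_linear g" and eq: "\<And>x. x \<in> G \<Longrightarrow> f x = g x"
  shows "f x = g x"
proof -
  have "cspan G \<subseteq> {x. f x = g x}"
  proof
    fix x assume "x \<in> cspan G"
    then show "x \<in> {x. f x = g x}"
      by (induction rule: complex_vector.span_induct_alt)
        (auto simp: linear_0[OF bounded_linear.linear] linear_add[OF bounded_linear.linear] bl eq scale)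
  qed
  moreover have "closed {x. f x = g x}"
    by (intro closed_Collect_eq linear_continuous_on bl)
  ultimately have "closure (cspan G) \<subseteq> {x. f x = g x}"
    by (rule closure_minimal)
  then show ?thesis using total by auto
qed

lemma add_linear_combinations:
  assumes "finite F" and "finite F'"
  shows "(\<Sum>i\<in>F. c i *\<^sub>C h i) + (\<Sum>i\<in>F'. c' i *\<^sub>C h i) = (\<Sum>i\<in>F \<union> F'.
    ((if i \<in> F then c i else 0) + (if i \<in> F' then c' i else 0)) *\<^sub>C (h i :: 'w::complex_vector))"
proof -
  have "(\<Sum>i\<in>F. c i *\<^sub>C h i) = (\<Sum>i\<in>F \<union> F'. (if i \<in> F then c i else 0) *\<^sub>C h i)"
    "(\<Sum>i\<in>F'. c' i *\<^sub>C h i) = (\<Sum>i\<in>F \<union> F'. (if i \<in> F' then c' i else 0) *\<^sub>C h i)"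
    using assms by (auto intro!: sum.mono_neutral_cong_left)
  then show ?thesis by (simp add: scaleC_add_left sum.distrib)
qed

text \<open>
  The closure of the graph \<open>{(\<Sum> c\<^sub>i a\<^sub>i, \<Sum> c\<^sub>i b\<^sub>i)}\<close> is the graph of the extension: the bound makes
  it single-valued and carries Cauchy sequences in the first component to Cauchy sequences in the
  second.
\<close>

lemma clinear_extension:
  fixes a :: "'i \<Rightarrow> 'u::complex_normed_vector" and b :: "'i \<Rightarrow> 'v::{complex_normed_vector,banach}"
  assumes bound: "\<And>F c. finite F \<Longrightarrow> norm (\<Sum>i\<in>F. c i *\<^sub>C b i) \<le> C * norm (\<Sum>i\<in>F. c i *\<^sub>C a i)"
    and C: "0 \<le> C"
    and total: "closure (cspan (range a)) = UNIV"
  shows "\<exists>T. clinear_op T \<and> (\<forall>i. T (a i) = b i) \<and> norm T \<le> C"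
proof -
  define G where "G x v \<longleftrightarrow> (\<exists>F c. finite F \<and> x = (\<Sum>i\<in>F. c i *\<^sub>C a i) \<and> v = (\<Sum>i\<in>F. c i *\<^sub>C b i))"
    for x v
  have Gadd: "G (x + x') (v + v')" if g: "G x v" "G x' v'" for x v x' v'
  proof -
    obtain F c F' c' where F: "finite F" "x = (\<Sum>i\<in>F. c i *\<^sub>C a i)" "v = (\<Sum>i\<in>F. c i *\<^sub>C b i)"
      and F': "finite F'" "x' = (\<Sum>i\<in>F'. c' i *\<^sub>C a i)" "v' = (\<Sum>i\<in>F'. c' i *\<^sub>C b i)"
      using g unfolding G_def by blast
    define d where "d i = (if i \<in> F then c i else 0) + (if i \<in> F' then c' i else 0)" for i
    show ?thesis unfolding G_def using F F'
      by (intro exI[of _ "F \<union> F'"] exI[of _ d]) (simp add: d_def add_linear_combinations)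
  qed
  have Gscale: "G (k *\<^sub>C x) (k *\<^sub>C v)" if g: "G x v" for k x v
  proof -
    obtain F c where F: "finite F" "x = (\<Sum>i\<in>F. c i *\<^sub>C a i)" "v = (\<Sum>i\<in>F. c i *\<^sub>C b i)"
      using g unfolding G_def by blast
    then show ?thesis unfolding G_def
      by (intro exI[of _ F] exI[of _ "\<lambda>i. k * c i"])
        (simp add: complex_vector.scale_sum_right scaleC_scaleC)
  qed
  have Gbound: "norm v \<le> C * norm x" if "G x v" for x v
    using that bound unfolding G_def by blast
  have Gdiff: "G (x - x') (v - v')" if "G x v" "G x' v'" for x v x' v'
    using Gadd[OF that(1) Gscale[OF that(2), of "- 1"]] by (simp flip: uminus_eq_scaleC)
  have Gtot: "\<exists>v. G x v" if "x \<in> cspan (range a)" for x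
    using that
  proof (induction rule: complex_vector.span_induct_alt)
    case base
    show ?case unfolding G_def by (intro exI[of _ 0] exI[of _ "{}"]) auto
  next
    case (step c x y)
    then obtain i v where "x = a i" "G y v" by blast
    moreover have "G (a i) (b i)"
      unfolding G_def by (intro exI[of _ "{i}"] exI[of _ "\<lambda>_. 1"]) simp
    ultimately show ?case using Gadd Gscale by blast
  qed
  define L where "L x v \<longleftrightarrow> (\<exists>X V. (\<forall>n. G (X n) (V n)) \<and> X \<longlonglongrightarrow> x \<and> V \<longlonglongrightarrow> v)" for x v
  have LG: "L x v" if "G x v" for x v
    unfolding L_def using that by (intro exI[of _ "\<lambda>_. x"] exI[of _ "\<lambda>_. v"]) auto
  have Ladd: "L (x + x') (v + v')" if "L x v" "L x' v'" for x v x' v'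
  proof -
    obtain X V X' V' where "\<And>n. G (X n) (V n)" "X \<longlonglongrightarrow> x" "V \<longlonglongrightarrow> v"
      "\<And>n. G (X' n) (V' n)" "X' \<longlonglongrightarrow> x'" "V' \<longlonglongrightarrow> v'"
      using \<open>L x v\<close> \<open>L x' v'\<close> unfolding L_def by metis
    then show ?thesis unfolding L_def
      by (intro exI[of _ "\<lambda>n. X n + X' n"] exI[of _ "\<lambda>n. V n + V' n"] conjI allI Gadd tendsto_add)
  qed
  have Lscale: "L (k *\<^sub>C x) (k *\<^sub>C v)" if "L x v" for k x v
  proof -
    obtain X V where "\<And>n. G (X n) (V n)" "X \<longlonglongrightarrow> x" "V \<longlonglongrightarrow> v"
      using \<open>L x v\<close> unfolding L_def by metis
    then show ?thesis unfolding L_def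
      by (intro exI[of _ "\<lambda>n. k *\<^sub>C X n"] exI[of _ "\<lambda>n. k *\<^sub>C V n"] conjI allI Gscale
          bounded_linear.tendsto[OF bounded_linear_scaleC])
  qed
  have Lbound: "norm v \<le> C * norm x" if "L x v" for x v
  proof -
    obtain X V where XV: "\<And>n. G (X n) (V n)" "X \<longlonglongrightarrow> x" "V \<longlonglongrightarrow> v"
      using \<open>L x v\<close> unfolding L_def by metis
    show ?thesis
      by (rule LIMSEQ_le[OF tendsto_norm[OF XV(3)] tendsto_mult_left[OF tendsto_norm[OF XV(2)]]])
        (use Gbound[OF XV(1)] in simp)
  qed
  have Luniq: "v = v'" if "L x v" "L x v'" for x v v'
    using Lbound[OF Ladd[OF that(1) Lscale[OF that(2), of "- 1"]]] by (simp flip: uminus_eq_scaleC)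
  have Ltot: "\<exists>v. L x v" for x
  proof -
    have "x \<in> closure (cspan (range a))" using total by simp
    then obtain X where X: "\<And>n. X n \<in> cspan (range a)" "X \<longlonglongrightarrow> x"
      unfolding closure_sequential by blast
    have "\<forall>n. \<exists>v. G (X n) v" using Gtot X(1) by blast
    then obtain V where V: "\<And>n. G (X n) (V n)" by metis
    have "Cauchy V"
    proof (rule metric_CauchyI)
      fix e :: real assume "0 < e"
      then have "0 < e / (C + 1)" using C by simp
      then obtain N where N: "\<forall>m\<ge>N. \<forall>n\<ge>N. dist (X m) (X n) < e / (C + 1)"
        using LIMSEQ_imp_Cauchy[OF X(2)] metric_CauchyD by blast
      have "dist (V m) (V n) < e" if "m \<ge> N" "n \<ge> N" for m n
      proof -
        have "dist (V m) (V n) \<le> C * dist (X m) (X n)"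
          unfolding dist_norm by (rule Gbound[OF Gdiff[OF V V]])
        also have "\<dots> \<le> (C + 1) * dist (X m) (X n)"
          by (intro mult_right_mono) auto
        also have "\<dots> < (C + 1) * (e / (C + 1))"
          using N that C by (intro mult_strict_left_mono) auto
        finally show ?thesis using C by simp
      qed
      then show "\<exists>M. \<forall>m\<ge>M. \<forall>n\<ge>M. dist (V m) (V n) < e" by blast
    qed
    then obtain v where "V \<longlonglongrightarrow> v" unfolding Cauchy_convergent_iff convergent_def by (rule exE)
    with X(2) V show ?thesis unfolding L_def by (intro exI conjI allI)
  qed
  define T where "T x = (THE v. L x v)" for x
  have T: "T x = v \<longleftrightarrow> L x v" for x v
    unfolding T_def using Ltot Luniq by (metis the_equality)
  have bl: "bounded_linear T"
  proof (rule bounded_linear_intro[where K = C])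
    show "T (x + y) = T x + T y" for x y using Ladd T by metis
    show "T (r *\<^sub>R x) = r *\<^sub>R T x" for r x
      unfolding scaleR_eq_scaleC using Lscale T by metis
    show "norm (T x) \<le> norm x * C" for x using Lbound T by (metis mult.commute)
  qed
  have "G (a i) (b i)" for i
    unfolding G_def by (intro exI[of _ "{i}"] exI[of _ "\<lambda>_. 1"]) simp
  then have "\<forall>i. T (a i) = b i" using T LG by blast
  moreover have "\<forall>c x. T (c *\<^sub>C x) = c *\<^sub>C T x" using Lscale T by metis
  moreover have "norm (T x) \<le> C * norm x" for x using Lbound T by metis
  ultimately show ?thesis
    using bl C by (intro exI[of _ "Blinfun T"])
      (auto simp: clinear_op_def bounded_linear_Blinfun_apply intro: norm_blinfun_bound)
qed

section \<open>Operators on \<open>\<ell>\<^sup>2\<close>\<close>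

lemma l2_single_add: "l2_single i (h + h') = l2_single i h + l2_single i h'"
  by (rule l2_eqI) (simp add: l2_single_apply)

lemma l2_single_scaleC: "l2_single i (c *\<^sub>C h) = c *\<^sub>C l2_single i h"
  by (rule l2_eqI) (simp add: l2_single_apply)

lemma l2_single_zero: "l2_single i 0 = 0"
  by (rule l2_eqI) (simp add: l2_single_apply)

lemma cinner_l2_single: "cinner (l2_single i h) x = cinner h (l2_apply x i)"
proof -
  have "cinner (l2_single i h) x = (\<Sum>\<^sub>\<infinity>j\<in>{i}. cinner (l2_apply (l2_single i h) j) (l2_apply x j))"
    unfolding cinner_l2_def by (rule infsum_cong_neutral) (auto simp: l2_single_apply)
  then show ?thesis by (simp add: l2_single_apply)
qed

lemma norm_l2_single: "norm (l2_single i h) = norm h"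
proof -
  have "(norm (l2_single i h))\<^sup>2 = (norm h)\<^sup>2"
    by (simp add: norm_sq_cinner cinner_l2_single l2_single_apply)
  then show ?thesis by (simp add: power2_eq_iff_nonneg)
qed

lemma bounded_linear_l2_single: "bounded_linear (l2_single i)"
  by (rule bounded_linear_intro[where K = 1])
    (simp_all add: l2_single_add scaleR_eq_scaleC l2_single_scaleC norm_l2_single)

lemma l2_sum_apply: "l2_apply (sum x F) i = (\<Sum>k\<in>F. l2_apply (x k) i)"
  by (induction F rule: infinite_finite_induct) auto

lemma l2_singles_total: "closure (cspan {l2_single i h | i h. True}) = (UNIV :: ('i, 'h::complex_hilbert) l2 set)"
proof (intro set_eqI iffI UNIV_I)
  fix x :: "('i, 'h) l2"
  show "x \<in> closure (cspan {l2_single i h | i h. True})"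
    unfolding closure_approachable
  proof (intro allI impI)
    fix e :: real assume "0 < e"
    then have "0 < (e / 2)\<^sup>2" by simp
    from infsum_finite_approximation[OF l2_apply_summable[of x] this]
    obtain F where F: "finite F" "dist (\<Sum>i\<in>F. (norm (l2_apply x i))\<^sup>2) (\<Sum>\<^sub>\<infinity>i. (norm (l2_apply x i))\<^sup>2) \<le> (e / 2)\<^sup>2"
      by blast
    define y where "y = (\<Sum>i\<in>F. l2_single i (l2_apply x i))"
    have y: "l2_apply (x - y) i = (if i \<in> F then 0 else l2_apply x i)" for i
      using F(1) by (simp add: y_def l2_sum_apply l2_single_apply)
    have "norm (x - y) \<le> e / 2"
    proof (rule norm_l2_le)
      fix F' :: "'i set" assume F': "finite F'"
      have "(\<Sum>i\<in>F'. (norm (l2_apply (x - y) i))\<^sup>2) = (\<Sum>i\<in>F' - F. (norm (l2_apply x i))\<^sup>2)"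
        using F' by (intro sum.mono_neutral_cong_right) (auto simp: y simp del: l2_apply_minus)
      also have "\<dots> = (\<Sum>i\<in>F' \<union> F. (norm (l2_apply x i))\<^sup>2) - (\<Sum>i\<in>F. (norm (l2_apply x i))\<^sup>2)"
        using F F' by (subst sum_diff[symmetric]) (auto intro!: sum.cong)
      also have "\<dots> \<le> (\<Sum>\<^sub>\<infinity>i. (norm (l2_apply x i))\<^sup>2) - (\<Sum>i\<in>F. (norm (l2_apply x i))\<^sup>2)"
        using F F' by (intro diff_right_mono finite_sum_le_infsum l2_apply_summable) auto
      also have "\<dots> \<le> (e / 2)\<^sup>2" using F(2) by (simp add: dist_real_def)
      finally show "L2_set (\<lambda>i. norm (l2_apply (x - y) i)) F' \<le> e / 2"
        unfolding L2_set_def using \<open>0 < e\<close> by (intro real_le_lsqrt) auto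
    qed
    then have "dist y x < e" using \<open>0 < e\<close> by (simp add: dist_norm norm_minus_commute)
    moreover have "y \<in> cspan {l2_single i h | i h. True}"
      unfolding y_def by (intro complex_vector.span_sum complex_vector.span_base) blast
    ultimately show "\<exists>y\<in>cspan {l2_single i h | i h. True}. dist y x < e" by blast
  qed
qed

lemma l2_op_eqI:
  fixes S T :: "('i, 'h::complex_hilbert) l2 \<Rightarrow>\<^sub>L 'v::real_normed_vector"
  assumes "\<And>i h. S (l2_single i h) = T (l2_single i h)"
  shows "S = T"
proof (rule blinfun_eqI, rule bounded_linear_eq_on_total[OF l2_singles_total])
  fix c and g :: "('i, 'h) l2" assume "g \<in> {l2_single i h | i h. True}"
  then obtain i h where "g = l2_single i h" by blast
  then have "c *\<^sub>C g = l2_single i (c *\<^sub>C h)" by (simp add: l2_single_scaleC)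
  then show "c *\<^sub>C g \<in> {l2_single i h | i h. True}" by blast
qed (use assms in \<open>auto intro: blinfun.bounded_linear_right\<close>)

text \<open>
  The shifts and the diagonal operators of induced representations are all of this form.
\<close>

definition weighted_comp :: "('i \<Rightarrow> 'i) \<Rightarrow> ('i \<Rightarrow> 'h \<Rightarrow>\<^sub>L 'h) \<Rightarrow> ('i, 'h::complex_hilbert) l2 \<Rightarrow>\<^sub>L ('i, 'h) l2"
  where "weighted_comp \<kappa> w = Blinfun (\<lambda>x. Abs_l2 (\<lambda>j. w j (l2_apply x (\<kappa> j))))"

lemma weighted_comp_apply:
  fixes w :: "'i \<Rightarrow> 'h::complex_hilbert \<Rightarrow>\<^sub>L 'h"
  assumes inj: "inj \<kappa>" and w: "\<And>j. norm (w j) \<le> C"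
  shows "l2_apply (blinfun_apply (weighted_comp \<kappa> w) x) j = blinfun_apply (w j) (l2_apply x (\<kappa> j))"
proof -
  have C: "0 \<le> C" using w norm_ge_zero order_trans by blast
  have L2: "L2_set (\<lambda>j. norm (blinfun_apply (w j) (l2_apply x (\<kappa> j)))) F \<le> C * norm x"
    if "finite F" for F and x :: "('i, 'h) l2"
  proof -
    have "L2_set (\<lambda>j. norm (blinfun_apply (w j) (l2_apply x (\<kappa> j)))) F
        \<le> L2_set (\<lambda>j. C * norm (l2_apply x (\<kappa> j))) F"
      by (intro L2_set_mono order_trans[OF norm_blinfun] mult_right_mono w) auto
    also have "\<dots> = C * L2_set (\<lambda>j. norm (l2_apply x (\<kappa> j))) F"
      by (rule L2_set_right_distrib[symmetric, OF C])
    also have "L2_set (\<lambda>j. norm (l2_apply x (\<kappa> j))) F = L2_set (\<lambda>j. norm (l2_apply x j)) (\<kappa> ` F)"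
      unfolding L2_set_def using inj by (simp add: sum.reindex inj_on_def)
    also have "\<dots> \<le> norm x" using that by (intro L2_set_le_norm_l2) auto
    finally show ?thesis using C by (simp add: mult_left_mono)
  qed
  define f where "f x = Abs_l2 (\<lambda>j. blinfun_apply (w j) (l2_apply x (\<kappa> j)))" for x :: "('i, 'h) l2"
  have f: "l2_apply (f x) j = blinfun_apply (w j) (l2_apply x (\<kappa> j))" for x j
    unfolding f_def by (subst Abs_l2_inverse) (rule l2_memI[OF L2], auto)
  have nf: "norm (f x) \<le> C * norm x" for x
    by (rule norm_l2_le) (simp add: f L2)
  have "bounded_linear f"
    by (rule bounded_linear_intro[where K = C])
      (auto intro!: l2_eqI simp: f blinfun.add_right blinfun.scaleR_right nf mult.commute)
  then have *: "blinfun_apply (weighted_comp \<kappa> w) = f"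
    unfolding weighted_comp_def f_def by (rule bounded_linear_Blinfun_apply)
  show "l2_apply (blinfun_apply (weighted_comp \<kappa> w) x) j = blinfun_apply (w j) (l2_apply x (\<kappa> j))"
    by (simp add: * f)
qed

section \<open>Tensor products of operators\<close>

lemma hilbert_tensorD:
  assumes "hilbert_tensor t"
  shows "t (x + x') y = t x y + t x' y" "t x (y + y') = t x y + t x y'"
    and "t (c *\<^sub>C x) y = c *\<^sub>C t x y" "t x (c *\<^sub>C y) = c *\<^sub>C t x y"
    and "cinner (t x y) (t x' y') = cinner x x' * cinner y y'"
    and "closure (cspan {t x y | x y. True}) = UNIV"
  using assms unfolding hilbert_tensor_def by blast+

lemma hilbert_tensor_swap: "hilbert_tensor t \<Longrightarrow> hilbert_tensor (\<lambda>y x. t x y)"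
proof -
  assume t: "hilbert_tensor t"
  have "{t x y | y x. True} = {t x y | x y. True}" by blast
  then show ?thesis
    using t unfolding hilbert_tensor_def by (simp add: mult.commute)
qed

lemma tensor_zero [simp]: "hilbert_tensor t \<Longrightarrow> t 0 y = 0" "hilbert_tensor t \<Longrightarrow> t x 0 = 0"
  using hilbert_tensorD(1)[of t 0 0 y] hilbert_tensorD(2)[of t x 0 0] by simp_all

lemma tensor_sum_left: "hilbert_tensor t \<Longrightarrow> t (sum f A) y = (\<Sum>i\<in>A. t (f i) y)"
  by (induction A rule: infinite_finite_induct) (simp_all add: hilbert_tensorD)

lemma tensor_sum_right: "hilbert_tensor t \<Longrightarrow> t x (sum f A) = (\<Sum>i\<in>A. t x (f i))"
  by (induction A rule: infinite_finite_induct) (simp_all add: hilbert_tensorD)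

lemma norm_tensor:
  assumes "hilbert_tensor t"
  shows "norm (t x y) = norm x * norm y"
proof -
  have "complex_of_real ((norm (t x y))\<^sup>2) = complex_of_real ((norm x * norm y)\<^sup>2)"
    unfolding cinner_self[symmetric] hilbert_tensorD(5)[OF assms]
    by (simp add: cinner_self power_mult_distrib)
  then have "(norm (t x y))\<^sup>2 = (norm x * norm y)\<^sup>2"
    by (simp only: of_real_eq_iff)
  then show ?thesis by (simp add: power2_eq_iff_nonneg)
qed

lemma tensor_eqI:
  assumes t: "hilbert_tensor t" and bl: "bounded_linear f" "bounded_linear g"
    and eq: "\<And>x y. f (t x y) = g (t x y)"
  shows "f u = g u"
proof (rule bounded_linear_eq_on_total[OF hilbert_tensorD(6)[OF t] _ bl])
  fix c v assume "v \<in> {t x y | x y. True}"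
  then show "c *\<^sub>C v \<in> {t x y | x y. True}" using hilbert_tensorD(3)[OF t, symmetric] by blast
qed (use eq in blast)

lemma tensor_op_eqI:
  assumes "hilbert_tensor t" and "\<And>x y. blinfun_apply S (t x y) = blinfun_apply T (t x y)"
  shows "S = T"
  by (rule blinfun_eqI, rule tensor_eqI[OF assms(1)]) (auto intro: blinfun.bounded_linear_right assms(2))

lemma norm_tensor_map_left_le:
  assumes t: "hilbert_tensor t" and A: "clinear_op A" and fin: "finite F"
  shows "norm (\<Sum>k\<in>F. t (A (x k)) (y k)) \<le> norm A * norm (\<Sum>k\<in>F. t (x k) (y k))"
proof -
  obtain E where E: "finite E" "orthonormal (\<lambda>e. e) E" "\<And>v. v \<in> y ` F \<Longrightarrow> v = (\<Sum>e\<in>E. cinner v e *\<^sub>C e)"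
    using finite_orthonormal_expansion[of "y ` F"] fin by auto
  have y: "y k = (\<Sum>e\<in>E. cinner (y k) e *\<^sub>C e)" if "k \<in> F" for k
    using E(3) that by blast
  define u where "u e = (\<Sum>k\<in>F. cinner (y k) e *\<^sub>C x k)" for e
  \<comment> \<open>Regrouped along an orthonormal basis of the span of the second factors, the sums become orthogonal.\<close>
  have regroup: "(\<Sum>k\<in>F. t (z k) (y k)) = (\<Sum>e\<in>E. t (\<Sum>k\<in>F. cinner (y k) e *\<^sub>C z k) e)" for z
  proof -
    have "(\<Sum>k\<in>F. t (z k) (y k)) = (\<Sum>k\<in>F. \<Sum>e\<in>E. cinner (y k) e *\<^sub>C t (z k) e)"
      by (intro sum.cong refl) (subst y, auto simp: tensor_sum_right[OF t] hilbert_tensorD[OF t])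
    also have "\<dots> = (\<Sum>e\<in>E. \<Sum>k\<in>F. cinner (y k) e *\<^sub>C t (z k) e)" by (rule sum.swap)
    finally show ?thesis by (simp add: tensor_sum_left[OF t] hilbert_tensorD[OF t])
  qed
  have Au: "(\<Sum>k\<in>F. cinner (y k) e *\<^sub>C A (x k)) = A (u e)" for e
    by (simp add: u_def blinfun.sum_right clinear_opD[OF A])
  note ne = orthonormal_norm[OF E(2)]
  have sq: "(norm (\<Sum>e\<in>E. t (v e) e))\<^sup>2 = (\<Sum>e\<in>E. (norm (v e))\<^sup>2)" for v
  proof -
    have "(norm (\<Sum>e\<in>E. t (v e) e))\<^sup>2 = (\<Sum>e\<in>E. (norm (t (v e) e))\<^sup>2)"
      using E by (intro pythagoras) (auto simp: hilbert_tensorD(5)[OF t] orthonormal_def)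
    then show ?thesis using ne by (simp add: norm_tensor[OF t])
  qed
  have "(norm (\<Sum>k\<in>F. t (A (x k)) (y k)))\<^sup>2 = (\<Sum>e\<in>E. (norm (A (u e)))\<^sup>2)"
    unfolding regroup sq Au ..
  also have "\<dots> \<le> (\<Sum>e\<in>E. (norm A)\<^sup>2 * (norm (u e))\<^sup>2)"
    unfolding power_mult_distrib[symmetric] by (intro sum_mono power_mono norm_blinfun) auto
  also have "\<dots> = (norm A * norm (\<Sum>k\<in>F. t (x k) (y k)))\<^sup>2"
    unfolding regroup power_mult_distrib sq by (simp add: u_def sum_distrib_left)
  finally show ?thesis by (rule power2_le_imp_le) simp
qed

text \<open>
  \<open>A \<otimes> B\<close> is the composition of \<open>1 \<otimes> B\<close> and \<open>A \<otimes> 1\<close>, so the bound needed for the extension from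
  elementary tensors follows by applying the bound for one factor twice.
\<close>

lemma
  fixes t :: "'a::complex_hilbert \<Rightarrow> 'b::complex_hilbert \<Rightarrow> 'k::complex_hilbert"
  assumes t: "hilbert_tensor t" and A: "clinear_op A" and B: "clinear_op B"
  shows op_tensor_apply: "op_tensor t A B (t x y) = t (blinfun_apply A x) (blinfun_apply B y)"
    and clinear_op_tensor: "clinear_op (op_tensor t A B)"
    and norm_op_tensor_le: "norm (op_tensor t A B) \<le> norm A * norm B"
proof -
  have r: "range (\<lambda>(x, y). t x y) = {t x y | x y. True}" by auto
  have total: "closure (cspan (range (\<lambda>(x, y). t x y))) = UNIV"
    unfolding r by (rule hilbert_tensorD(6)[OF t])
  have "norm (\<Sum>p\<in>F. c p *\<^sub>C (case p of (x, y) \<Rightarrow> t (blinfun_apply A x) (blinfun_apply B y)))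
      \<le> norm A * norm B * norm (\<Sum>p\<in>F. c p *\<^sub>C (case p of (x, y) \<Rightarrow> t x y))"
    if F: "finite F" for F and c :: "'a \<times> 'b \<Rightarrow> complex"
  proof -
    have eq: "c p *\<^sub>C (case p of (x, y) \<Rightarrow> t (S x) (R y)) = t (S (fst p)) (c p *\<^sub>C R (snd p))"
      for p S R by (simp add: hilbert_tensorD[OF t] split: prod.split)
    have "norm (\<Sum>p\<in>F. t (blinfun_apply A (fst p)) (c p *\<^sub>C blinfun_apply B (snd p)))
        \<le> norm A * norm (\<Sum>p\<in>F. t (fst p) (blinfun_apply B (c p *\<^sub>C snd p)))"
      unfolding clinear_opD[OF B] by (rule norm_tensor_map_left_le[OF t A F])
    also have "\<dots> \<le> norm A * (norm B * norm (\<Sum>p\<in>F. t (fst p) (c p *\<^sub>C snd p)))"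
      by (intro mult_left_mono norm_tensor_map_left_le[OF hilbert_tensor_swap[OF t] B F]) auto
    finally show ?thesis
      by (simp add: eq eq[where S = "\<lambda>x. x" and R = "\<lambda>x. x"] mult.assoc)
  qed
  from clinear_extension[OF this _ total]
  obtain C where C: "clinear_op C" "\<And>x y. blinfun_apply C (t x y) = t (blinfun_apply A x) (blinfun_apply B y)"
    "norm C \<le> norm A * norm B"
    by auto
  have "op_tensor t A B = C"
    unfolding op_tensor_def
  proof (rule the_equality)
    fix D assume D: "\<forall>x y. blinfun_apply D (t x y) = t (blinfun_apply A x) (blinfun_apply B y)"
    then show "D = C" by (intro tensor_op_eqI[OF t]) (simp add: C(2))
  qed (use C in blast)
  with C show "op_tensor t A B (t x y) = t (blinfun_apply A x) (blinfun_apply B y)"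
    "clinear_op (op_tensor t A B)" "norm (op_tensor t A B) \<le> norm A * norm B" by auto
qed

lemma op_tensor_add_left:
  assumes "hilbert_tensor t" "clinear_op A" "clinear_op A'" "clinear_op B"
  shows "op_tensor t (A + A') B = op_tensor t A B + op_tensor t A' B"
proof -
  have "clinear_op (A + A')" using assms by (simp add: clinear_op_def blinfun.add_left scaleC_add_right)
  then show ?thesis using assms
    by (intro tensor_op_eqI[OF assms(1)]) (simp add: op_tensor_apply blinfun.add_left hilbert_tensorD)
qed

lemma op_tensor_add_right:
  assumes "hilbert_tensor t" "clinear_op A" "clinear_op B" "clinear_op B'"
  shows "op_tensor t A (B + B') = op_tensor t A B + op_tensor t A B'"
proof -
  have "clinear_op (B + B')" using assms by (simp add: clinear_op_def blinfun.add_left scaleC_add_right)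
  then show ?thesis using assms
    by (intro tensor_op_eqI[OF assms(1)]) (simp add: op_tensor_apply blinfun.add_left hilbert_tensorD)
qed

lemma clinear_op_scaleC: "clinear_op A \<Longrightarrow> clinear_op (c *\<^sub>C A)"
  by (simp add: clinear_op_def scaleC_scaleC mult.commute)

lemma op_tensor_scaleC:
  assumes "hilbert_tensor t" "clinear_op A" "clinear_op B"
  shows "op_tensor t (c *\<^sub>C A) B = c *\<^sub>C op_tensor t A B" "op_tensor t A (c *\<^sub>C B) = c *\<^sub>C op_tensor t A B"
  using assms by (auto intro!: tensor_op_eqI[OF assms(1)] simp: op_tensor_apply clinear_op_scaleC hilbert_tensorD)

lemma op_tensor_compose:
  assumes "hilbert_tensor t" "clinear_op A" "clinear_op A'" "clinear_op B" "clinear_op B'"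
  shows "op_tensor t A B o\<^sub>L op_tensor t A' B' = op_tensor t (A o\<^sub>L A') (B o\<^sub>L B')"
  using assms by (intro tensor_op_eqI[OF assms(1)]) (simp add: op_tensor_apply clinear_op_compose)

lemma is_adjoint_op_tensor:
  assumes t: "hilbert_tensor t" and c: "clinear_op A" "clinear_op A'" "clinear_op B" "clinear_op B'"
    and adj: "is_adjoint A A'" "is_adjoint B B'"
  shows "is_adjoint (op_tensor t A B) (op_tensor t A' B')"
  unfolding is_adjoint_def
proof (intro allI)
  fix u v
  let ?S = "op_tensor t A B" and ?S' = "op_tensor t A' B'"
  note left = bounded_linear_cinner_left bounded_linear_compose[OF bounded_linear_cinner_left blinfun.bounded_linear_right]
  note right = bounded_linear_cinner_right bounded_linear_compose[OF bounded_linear_cinner_right blinfun.bounded_linear_right]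
  have "cinner (?S (t x y)) v = cinner (t x y) (?S' v)" for x y
    by (rule tensor_eqI[OF t right])
      (simp add: op_tensor_apply[OF t] c hilbert_tensorD(5)[OF t] is_adjointD[OF adj(1)] is_adjointD[OF adj(2)])
  then show "cinner (?S u) v = cinner u (?S' v)"
    by (rule tensor_eqI[OF t left(2) left(1)])
qed

section \<open>Representations of algebras of continuous functions\<close>

lemma star_rep_cstarD:
  assumes "star_rep cstar_alg \<pi>"
  shows "clinear_op (\<pi> f)" "\<pi> (f + g) = \<pi> f + \<pi> g" "\<pi> (c *\<^sub>C f) = c *\<^sub>C \<pi> f"
    and "\<pi> (f * g) = \<pi> f o\<^sub>L \<pi> g" "is_adjoint (\<pi> f) (\<pi> (star f))"
  using assms by (simp_all add: star_rep_def cstar_alg_def)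

lemma star_rep_zero: "star_rep cstar_alg \<pi> \<Longrightarrow> \<pi> 0 = 0"
  using star_rep_cstarD(2)[of \<pi> 0 0] by simp

lemma star_rep_uminus: "star_rep cstar_alg \<pi> \<Longrightarrow> \<pi> (- f) = - \<pi> f"
  using star_rep_cstarD(3)[of \<pi> "- 1" f] by (simp flip: uminus_eq_scaleC)

lemma star_rep_diff: "star_rep cstar_alg \<pi> \<Longrightarrow> \<pi> (f - g) = \<pi> f - \<pi> g"
  using star_rep_cstarD(2)[of \<pi> f "- g"] by (simp add: star_rep_uminus)

lemma star_rep_sum: "star_rep cstar_alg \<pi> \<Longrightarrow> \<pi> (sum f A) = (\<Sum>i\<in>A. \<pi> (f i))"
  by (induction A rule: infinite_finite_induct) (simp_all add: star_rep_zero star_rep_cstarD(2))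

abbreviation unit_fun :: "'z::topological_space \<Rightarrow>\<^sub>C complex"
  where "unit_fun \<equiv> const_bcontfun 1"

lemma unit_fun_mult [simp]: "unit_fun * f = f" "f * unit_fun = f"
  by (auto intro!: bcontfun_eqI)

lemma star_const_bcontfun [simp]: "star (const_bcontfun c) = const_bcontfun (cnj c)"
  by (rule bcontfun_eqI) (simp add: star_complex_def)

lemma apply_sum_bcontfun: "apply_bcontfun (sum f A) z = (\<Sum>i\<in>A. apply_bcontfun (f i) z)"
  by (induction A rule: infinite_finite_induct) auto

lemma apply_bcontfun_diff [simp]: "(f - g) z = f z - g z"
  by (simp add: minus_bcontfun.rep_eq)

lemma apply_Bcontfun:
  fixes f :: "'z::metric_space \<Rightarrow> 'v::real_normed_vector"
  assumes "continuous_on UNIV f" and "\<And>z. norm (f z) \<le> b"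
  shows "apply_bcontfun (Bcontfun f) = f"
  by (rule Bcontfun_inverse, rule bcontfun_normI) fact+

lemma apply_Bcontfun_compact:
  fixes f :: "'z::metric_space \<Rightarrow> 'v::real_normed_vector"
  assumes "compact (UNIV :: 'z set)" and "continuous_on UNIV f"
  shows "apply_bcontfun (Bcontfun f) = f"
proof -
  have "bounded (range f)"
    using assms compact_continuous_image compact_imp_bounded by blast
  then obtain b where "\<And>z. norm (f z) \<le> b" unfolding bounded_iff by blast
  with assms(2) show ?thesis by (rule apply_Bcontfun)
qed

lemma star_rep_unit_adjoint: "star_rep cstar_alg \<pi> \<Longrightarrow> is_adjoint (\<pi> unit_fun) (\<pi> unit_fun)"
  using star_rep_cstarD(5)[of \<pi> unit_fun] by simp

lemma star_rep_unit_contraction: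
  assumes "star_rep cstar_alg \<pi>"
  shows "norm (\<pi> unit_fun x) \<le> norm x"
  using selfadjoint_idempotent_contraction[OF star_rep_unit_adjoint[OF assms]] star_rep_cstarD(4)[OF assms]
  by (metis unit_fun_mult(1))

lemma norm_sq_star_rep:
  assumes "star_rep cstar_alg \<pi>"
  shows "(norm (\<pi> f x))\<^sup>2 = Re (cinner x ((\<pi> (star f * f)) x))"
  by (simp add: norm_sq_cinner is_adjointD[OF star_rep_cstarD(5)[OF assms]] star_rep_cstarD(4)[OF assms])

lemma norm_sq_star_rep_unit:
  assumes "star_rep cstar_alg \<pi>"
  shows "Re (cinner x (\<pi> unit_fun x)) \<le> (norm x)\<^sup>2"
  using norm_sq_star_rep[OF assms, of unit_fun x] power_mono[OF star_rep_unit_contraction[OF assms] norm_ge_zero, of x 2]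
  by simp

text \<open>
  With \<open>g = (\<parallel>f\<parallel>\<^sup>2 - |f|\<^sup>2)\<^bsup>1/2\<^esup>\<close>, the operator \<open>\<parallel>f\<parallel>\<^sup>2 \<pi>(1) - \<pi>(f)\<^sup>* \<pi>(f) = \<pi>(g)\<^sup>* \<pi>(g)\<close> is positive.
\<close>

lemma star_rep_contractive:
  fixes \<pi> :: "('z::metric_space \<Rightarrow>\<^sub>C complex) \<Rightarrow> 'h::complex_hilbert \<Rightarrow>\<^sub>L 'h"
  assumes "star_rep cstar_alg \<pi>"
  shows "norm (\<pi> f) \<le> norm f"
proof (rule norm_blinfun_bound)
  fix x
  define g where "g = Bcontfun (\<lambda>z. complex_of_real (sqrt ((norm f)\<^sup>2 - (cmod (apply_bcontfun f z))\<^sup>2)))"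
  have le: "(cmod (apply_bcontfun f z))\<^sup>2 \<le> (norm f)\<^sup>2" for z
    by (intro power_mono norm_bounded) auto
  have g: "apply_bcontfun g = (\<lambda>z. complex_of_real (sqrt ((norm f)\<^sup>2 - (cmod (apply_bcontfun f z))\<^sup>2)))"
    unfolding g_def
  proof (rule apply_Bcontfun)
    show "continuous_on UNIV (\<lambda>z. complex_of_real (sqrt ((norm f)\<^sup>2 - (cmod (apply_bcontfun f z))\<^sup>2)))"
      by (intro continuous_intros continuous_on_apply_bcontfun)
    show "norm (complex_of_real (sqrt ((norm f)\<^sup>2 - (cmod (apply_bcontfun f z))\<^sup>2))) \<le> norm f" for z
      using le[of z] by (auto intro!: real_le_lsqrt)
  qed
  have "star f * f + star g * g = complex_of_real ((norm f)\<^sup>2) *\<^sub>C unit_fun"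
  proof (rule bcontfun_eqI)
    fix z
    have "apply_bcontfun (star f * f) z = complex_of_real ((cmod (apply_bcontfun f z))\<^sup>2)"
      by (simp add: star_complex_def complex_norm_square mult.commute del: of_real_power)
    moreover have "apply_bcontfun (star g * g) z = complex_of_real ((norm f)\<^sup>2 - (cmod (apply_bcontfun f z))\<^sup>2)"
      using le[of z] by (simp add: g star_complex_def flip: of_real_mult)
    ultimately show "apply_bcontfun (star f * f + star g * g) z
        = apply_bcontfun (complex_of_real ((norm f)\<^sup>2) *\<^sub>C unit_fun) z"
      by (simp add: scaleC_complex_def)
  qed
  then have "\<pi> (star f * f) + \<pi> (star g * g) = complex_of_real ((norm f)\<^sup>2) *\<^sub>C \<pi> unit_fun"
    by (metis star_rep_cstarD(2,3)[OF assms])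
  then have "cinner x ((\<pi> (star f * f) + \<pi> (star g * g)) x)
      = cinner x (complex_of_real ((norm f)\<^sup>2) *\<^sub>C (\<pi> unit_fun) x)"
    by (simp only: scaleC_blinfun_apply)
  then have sum: "(norm (\<pi> f x))\<^sup>2 + (norm (\<pi> g x))\<^sup>2
      = (norm f)\<^sup>2 * Re (cinner x (\<pi> unit_fun x))"
    unfolding norm_sq_star_rep[OF assms]
    by (simp add: blinfun.add_left cinner_add_right cinner_scaleC_right flip: plus_complex.sel of_real_power)
  have "(norm (\<pi> f x))\<^sup>2 \<le> (norm (\<pi> f x))\<^sup>2 + (norm (\<pi> g x))\<^sup>2"
    by simp
  also have "\<dots> \<le> (norm f)\<^sup>2 * (norm x)\<^sup>2"
    unfolding sum by (intro mult_left_mono norm_sq_star_rep_unit[OF assms]) auto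
  finally have "(norm (\<pi> f x))\<^sup>2 \<le> (norm f * norm x)\<^sup>2"
    by (simp add: power_mult_distrib)
  then show "norm (\<pi> f x) \<le> norm f * norm x"
    by (rule power2_le_imp_le) simp
qed simp

lemma star_rep_bounded_linear:
  fixes \<pi> :: "('z::metric_space \<Rightarrow>\<^sub>C complex) \<Rightarrow> 'h::complex_hilbert \<Rightarrow>\<^sub>L 'h"
  assumes "star_rep cstar_alg \<pi>"
  shows "bounded_linear \<pi>"
proof (rule bounded_linear_intro[where K = 1])
  show "norm (\<pi> f) \<le> norm f * 1" for f using star_rep_contractive[OF assms, of f] by simp
qed (simp_all add: star_rep_cstarD[OF assms] scaleR_eq_scaleC)

subsection \<open>Partitions of unity by squares\<close>

text \<open>
  Writing a partition of unity as a sum of squares \<open>\<Sum> a\<^sub>k\<^sup>2 = 1\<close> turns the approximation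
  \<open>f \<approx> \<Sum> f(k) a\<^sub>k\<^sup>2\<close> into an approximation of \<open>\<pi>(f)\<close> by \<open>\<Sum> f(k) \<pi>(a\<^sub>k)\<^sup>*\<pi>(a\<^sub>k)\<close>, the compression of a
  diagonal operator.
\<close>

definition square_partition :: "real \<Rightarrow> 'z::metric_space set \<Rightarrow> ('z \<Rightarrow> 'z \<Rightarrow>\<^sub>C complex) \<Rightarrow> bool"
  where "square_partition \<delta> K a \<longleftrightarrow> finite K \<and> (\<forall>k. star (a k) = a k) \<and>
    (\<Sum>k\<in>K. a k * a k) = unit_fun \<and>
    (\<forall>k\<in>K. \<forall>z. a k z \<noteq> 0 \<longrightarrow> dist z k < \<delta>)"

lemma square_partition_exists:
  assumes comp: "compact (UNIV :: 'z::metric_space set)" and "0 < \<delta>"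
  shows "\<exists>K a. square_partition \<delta> K (a :: 'z \<Rightarrow> 'z \<Rightarrow>\<^sub>C complex)"
proof -
  have "UNIV \<subseteq> (\<Union>k\<in>(UNIV::'z set). ball k \<delta>)" using \<open>0 < \<delta>\<close> by auto
  then obtain K where K: "finite K" "UNIV \<subseteq> (\<Union>k\<in>K. ball (k::'z) \<delta>)"
    using compactE_image[OF comp, of UNIV "\<lambda>k. ball k \<delta>"] by auto
  define b where "b k z = max 0 (\<delta> - dist z k)" for k z :: 'z
  define s where "s z = (\<Sum>k\<in>K. (b k z)\<^sup>2)" for z
  have s: "0 < s z" for z
  proof -
    obtain k where k: "k \<in> K" "dist k z < \<delta>" using K(2) by force
    then have "0 < (b k z)\<^sup>2" by (simp add: b_def dist_commute)
    also have "\<dots> \<le> s z" unfolding s_def using K(1) k(1) by (intro member_le_sum) auto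
    finally show ?thesis .
  qed
  define a where "a k = Bcontfun (\<lambda>z. complex_of_real (b k z / sqrt (s z)))" for k
  have a: "apply_bcontfun (a k) = (\<lambda>z. complex_of_real (b k z / sqrt (s z)))" for k
    unfolding a_def
  proof (rule apply_Bcontfun_compact[OF comp])
    have "sqrt (s z) \<noteq> 0" for z using s[of z] by simp
    then show "continuous_on UNIV (\<lambda>z. complex_of_real (b k z / sqrt (s z)))"
      unfolding b_def s_def by (intro continuous_intros) auto
  qed
  have "(\<Sum>k\<in>K. a k * a k) = unit_fun"
  proof (rule bcontfun_eqI)
    fix z
    have "apply_bcontfun (\<Sum>k\<in>K. a k * a k) z = complex_of_real (\<Sum>k\<in>K. (b k z / sqrt (s z))\<^sup>2)"
      by (simp only: apply_sum_bcontfun times_bcontfun_apply a of_real_sum of_real_mult power2_eq_square)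
    also have "(\<Sum>k\<in>K. (b k z / sqrt (s z))\<^sup>2) = (\<Sum>k\<in>K. (b k z)\<^sup>2) / s z"
      using s[of z] by (simp add: power_divide sum_divide_distrib)
    also have "\<dots> = 1" using s[of z] by (simp add: s_def)
    finally show "apply_bcontfun (\<Sum>k\<in>K. a k * a k) z = apply_bcontfun unit_fun z" by simp
  qed
  moreover have "star (a k) = a k" for k
    by (rule bcontfun_eqI) (simp add: a star_complex_def)
  moreover have "dist z k < \<delta>" if "apply_bcontfun (a k) z \<noteq> 0" for k z
    using that by (auto simp: a b_def max_def split: if_splits)
  ultimately show ?thesis using K(1) unfolding square_partition_def by blast
qed

text \<open>
  The values \<open>f(p k)\<close> are averaged with weights that vanish at \<open>z\<close> unless \<open>f(p k)\<close> is within \<open>e\<close> of \<open>f(z)\<close>.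
\<close>

lemma local_average_close:
  fixes f :: "'z::metric_space \<Rightarrow>\<^sub>C complex"
  assumes w: "\<And>k z. k \<in> K \<Longrightarrow> apply_bcontfun (w k) z = complex_of_real (r k z) \<and> 0 \<le> r k z"
    and one: "(\<Sum>k\<in>K. w k) = unit_fun"
    and loc: "\<And>k z. k \<in> K \<Longrightarrow> apply_bcontfun (w k) z \<noteq> 0 \<Longrightarrow> cmod (apply_bcontfun f (p k) - apply_bcontfun f z) \<le> e"
  shows "norm ((\<Sum>k\<in>K. apply_bcontfun f (p k) *\<^sub>C w k) - f) \<le> e"
proof (rule norm_bound)
  fix z
  have "(\<Sum>k\<in>K. apply_bcontfun (w k) z) = 1"
    using arg_cong[OF one, of "\<lambda>g. apply_bcontfun g z"] by (simp add: apply_sum_bcontfun)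
  then have one': "(\<Sum>k\<in>K. complex_of_real (r k z)) = 1" using w by simp
  then have r1: "(\<Sum>k\<in>K. r k z) = 1" by (metis of_real_eq_1_iff of_real_sum)
  have "apply_bcontfun ((\<Sum>k\<in>K. apply_bcontfun f (p k) *\<^sub>C w k) - f) z
      = (\<Sum>k\<in>K. apply_bcontfun f (p k) * complex_of_real (r k z)) - apply_bcontfun f z * (\<Sum>k\<in>K. complex_of_real (r k z))"
    using w by (simp add: apply_sum_bcontfun scaleC_complex_def one')
  also have "\<dots> = (\<Sum>k\<in>K. (apply_bcontfun f (p k) - apply_bcontfun f z) * complex_of_real (r k z))"
    by (simp add: sum_distrib_left sum_subtractf left_diff_distrib)
  also have "cmod \<dots> \<le> (\<Sum>k\<in>K. e * r k z)"
  proof (rule order_trans[OF norm_sum], rule sum_mono)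
    fix k assume k: "k \<in> K"
    show "cmod ((apply_bcontfun f (p k) - apply_bcontfun f z) * complex_of_real (r k z)) \<le> e * r k z"
      using w[OF k, of z] loc[OF k, of z] by (cases "r k z = 0") (auto simp: norm_mult intro: mult_right_mono)
  qed
  also have "\<dots> = e" by (simp add: r1 flip: sum_distrib_left)
  finally show "norm (apply_bcontfun ((\<Sum>k\<in>K. apply_bcontfun f (p k) *\<^sub>C w k) - f) z) \<le> e" .
qed

lemma selfadjoint_square:
  assumes "star (a :: 'z::metric_space \<Rightarrow>\<^sub>C complex) = a"
  shows "(a * a) z = complex_of_real ((cmod (a z))\<^sup>2)"
proof -
  have "cnj (a z) = a z"
    using arg_cong[OF assms, of "\<lambda>g. apply_bcontfun g z"] by (simp add: star_complex_def)
  then show ?thesis by (simp add: complex_norm_square del: of_real_power)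
qed

lemma uniformly_continuous_bcontfun:
  fixes f :: "'z::metric_space \<Rightarrow>\<^sub>C complex"
  assumes "compact (UNIV :: 'z set)" and "0 < e"
  shows "\<exists>d>0. \<forall>z z'. dist z z' < d \<longrightarrow> cmod (f z - f z') < e"
  using compact_uniformly_continuous[OF continuous_on_apply_bcontfun[of UNIV f] assms(1)] assms(2)
  unfolding uniformly_continuous_on_def dist_norm[symmetric] by (metis UNIV_I dist_commute)

lemma square_partition_sequence:
  assumes comp: "compact (UNIV :: 'z::metric_space set)"
  shows "\<exists>K a. \<forall>n. square_partition (inverse (real (Suc n))) (K n) (a n :: 'z \<Rightarrow> 'z \<Rightarrow>\<^sub>C complex)"
proof -
  have "\<forall>n. \<exists>Ka. square_partition (inverse (real (Suc n))) (fst Ka) (snd Ka :: 'z \<Rightarrow> 'z \<Rightarrow>\<^sub>C complex)"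
    using square_partition_exists[OF comp, of "inverse (real (Suc n))" for n] by fastforce
  from choice[OF this] obtain Ka where
    "\<forall>n. square_partition (inverse (real (Suc n))) (fst (Ka n)) (snd (Ka n) :: 'z \<Rightarrow> 'z \<Rightarrow>\<^sub>C complex)"
    by blast
  then show ?thesis by (intro exI[of _ "\<lambda>n. fst (Ka n)"] exI[of _ "\<lambda>n. snd (Ka n)"])
qed

lemma square_partition_approx:
  fixes f :: "'z::metric_space \<Rightarrow>\<^sub>C complex"
  assumes comp: "compact (UNIV :: 'z set)"
    and part: "\<And>n. square_partition (inverse (real (Suc n))) (K n) (a n)"
  shows "(\<lambda>n. \<Sum>k\<in>K n. apply_bcontfun f k *\<^sub>C (a n k * a n k)) \<longlonglongrightarrow> f"
proof (rule LIMSEQ_I)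
  fix e :: real assume "0 < e"
  then obtain d where d: "0 < d" "\<And>z z'. dist z z' < d \<Longrightarrow> cmod (apply_bcontfun f z - apply_bcontfun f z') < e / 2"
    using uniformly_continuous_bcontfun[OF comp, of "e / 2" f] by auto
  obtain N where N: "inverse (real (Suc N)) < d" using reals_Archimedean[OF d(1)] by blast
  have "norm ((\<Sum>k\<in>K n. apply_bcontfun f k *\<^sub>C (a n k * a n k)) - f) \<le> e / 2" if "N \<le> n" for n
  proof (rule local_average_close[where r = "\<lambda>k z. (cmod (apply_bcontfun (a n k) z))\<^sup>2"])
    have "inverse (real (Suc n)) < d"
      using that by (intro le_less_trans[OF _ N]) (simp add: le_imp_inverse_le)
    then show "cmod (apply_bcontfun f k - apply_bcontfun f z) \<le> e / 2"
      if "k \<in> K n" "apply_bcontfun (a n k * a n k) z \<noteq> 0" for k z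
      using part[of n] that d(2)[of z k] unfolding square_partition_def
      by (auto simp: norm_minus_commute intro!: less_imp_le)
        (metis dist_commute less_trans norm_minus_commute)
  qed (use part[of n] in \<open>auto simp: square_partition_def selfadjoint_square simp del: times_bcontfun_apply\<close>)
  then show "\<exists>no. \<forall>n\<ge>no. norm ((\<Sum>k\<in>K n. apply_bcontfun f k *\<^sub>C (a n k * a n k)) - f) < e"
    using \<open>0 < e\<close> by (intro exI[of _ N]) force
qed

lemma square_partition_column:
  fixes \<pi> :: "('z::metric_space \<Rightarrow>\<^sub>C complex) \<Rightarrow> 'h::complex_hilbert \<Rightarrow>\<^sub>L 'h"
  assumes rep: "star_rep cstar_alg \<pi>" and part: "square_partition \<delta> K a"
  shows "(\<Sum>k\<in>K. (norm ((\<pi> (a k)) v))\<^sup>2) \<le> (norm v)\<^sup>2"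
proof -
  have "(\<Sum>k\<in>K. (norm ((\<pi> (a k)) v))\<^sup>2)
      = Re (cinner v ((\<Sum>k\<in>K. \<pi> (a k * a k)) v))"
    using part by (simp add: norm_sq_star_rep[OF rep] square_partition_def blinfun.sum_left cinner_sum_right)
  also have "(\<Sum>k\<in>K. \<pi> (a k * a k)) = \<pi> unit_fun"
    using part by (simp add: square_partition_def flip: star_rep_sum[OF rep])
  finally show ?thesis using norm_sq_star_rep_unit[OF rep] by simp
qed

text \<open>
  A matrix \<open>(A\<^sub>r\<^sub>j)\<close> over \<open>C(Z)\<close> whose norm is at most \<open>C\<close> at every point of \<open>Z\<close> has norm at most \<open>C\<close> under
  every representation.  By a partition of unity, it suffices to consider
  \<open>\<Sum>\<^sub>k \<pi>(a\<^sub>k) A(k) \<pi>(a\<^sub>k)\<close>: a column contraction, the direct sum of the scalar matrices \<open>A(k)\<close>, and a row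
  contraction.
\<close>

lemma pointwise_matrix_bound:
  fixes \<pi> :: "('z::metric_space \<Rightarrow>\<^sub>C complex) \<Rightarrow> 'h::complex_hilbert \<Rightarrow>\<^sub>L 'h"
  assumes comp: "compact (UNIV :: 'z set)" and rep: "star_rep cstar_alg \<pi>"
    and fin: "finite R" "finite J" and C: "0 \<le> C"
    and bound: "\<And>z c. (\<Sum>r\<in>R. (cmod (\<Sum>j\<in>J. apply_bcontfun (A r j) z * c j))\<^sup>2) \<le> C * (\<Sum>j\<in>J. (cmod (c j))\<^sup>2)"
  shows "(\<Sum>r\<in>R. (norm (\<Sum>j\<in>J. (\<pi> (A r j)) (x j)))\<^sup>2) \<le> C * (\<Sum>j\<in>J. (norm (x j))\<^sup>2)"
proof -
  obtain K and a :: "nat \<Rightarrow> 'z \<Rightarrow> 'z \<Rightarrow>\<^sub>C complex"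
    where part: "\<And>n. square_partition (inverse (real (Suc n))) (K n) (a n)"
    using square_partition_sequence[OF comp] by blast
  define y where "y n r = (\<Sum>j\<in>J. (\<pi> (\<Sum>k\<in>K n. apply_bcontfun (A r j) k *\<^sub>C (a n k * a n k))) (x j))" for n r
  have "(\<lambda>n. \<Sum>r\<in>R. (norm (y n r))\<^sup>2) \<longlonglongrightarrow> (\<Sum>r\<in>R. (norm (\<Sum>j\<in>J. (\<pi> (A r j)) (x j)))\<^sup>2)"
    unfolding y_def
    by (intro tendsto_intros bounded_linear.tendsto[OF bounded_linear_apply]
        bounded_linear.tendsto[OF star_rep_bounded_linear[OF rep]] square_partition_approx[OF comp part])
  moreover have "(\<Sum>r\<in>R. (norm (y n r))\<^sup>2) \<le> C * (\<Sum>j\<in>J. (norm (x j))\<^sup>2)" for n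
  proof -
    note p = part[of n, unfolded square_partition_def]
    define u where "u k j = (\<pi> (a n k)) (x j)" for k j
    define w where "w r k = (\<Sum>j\<in>J. apply_bcontfun (A r j) k *\<^sub>C u k j)" for r k
    have "y n r = (\<Sum>j\<in>J. \<Sum>k\<in>K n. (\<pi> (a n k)) (apply_bcontfun (A r j) k *\<^sub>C u k j))" for r
      unfolding y_def u_def
      by (simp add: star_rep_sum[OF rep] star_rep_cstarD[OF rep] blinfun.sum_left clinear_opD[OF star_rep_cstarD(1)[OF rep]])
    then have y: "y n r = (\<Sum>k\<in>K n. (\<pi> (a n k)) (w r k))" for r
      by (simp add: w_def blinfun.sum_right sum.swap[of _ J])
    have "(\<Sum>r\<in>R. (norm (y n r))\<^sup>2) \<le> (\<Sum>r\<in>R. \<Sum>k\<in>K n. (norm (w r k))\<^sup>2)"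
      unfolding y
    proof (intro sum_mono row_contraction)
      show "is_adjoint (\<pi> (a n k)) (\<pi> (a n k))" for k
        using star_rep_cstarD(5)[OF rep, of "a n k"] p by simp
    qed (rule square_partition_column[OF rep part])
    also have "\<dots> = (\<Sum>k\<in>K n. \<Sum>r\<in>R. (norm (w r k))\<^sup>2)" by (rule sum.swap)
    also have "\<dots> \<le> (\<Sum>k\<in>K n. C * (\<Sum>j\<in>J. (norm (u k j))\<^sup>2))"
      unfolding w_def by (intro sum_mono scalar_matrix_amplification fin bound)
    also have "\<dots> = C * (\<Sum>j\<in>J. \<Sum>k\<in>K n. (norm (u k j))\<^sup>2)"
      by (subst sum.swap) (simp add: sum_distrib_left)
    also have "\<dots> \<le> C * (\<Sum>j\<in>J. (norm (x j))\<^sup>2)"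
      unfolding u_def by (intro mult_left_mono sum_mono square_partition_column[OF rep part] C)
    finally show ?thesis .
  qed
  ultimately show ?thesis by (intro LIMSEQ_le_const2) auto
qed

subsection \<open>Approximate characters\<close>

text \<open>
  For a bump function \<open>\<phi>\<close> at \<open>x\<close>, injectivity provides a vector \<open>h = \<pi>(\<phi>) \<xi> \<noteq> 0\<close>; since a function \<open>f\<close> is
  nearly constant on the support of \<open>\<phi>\<close>, this vector is nearly an eigenvector of \<open>\<pi>(f)\<close> for \<open>f(x)\<close>.
\<close>

lemma faithful_rep_approximate_character:
  fixes \<pi> :: "('z::metric_space \<Rightarrow>\<^sub>C complex) \<Rightarrow> 'h::complex_hilbert \<Rightarrow>\<^sub>L 'h"
  assumes "faithful_rep cstar_alg \<pi>"
  shows "\<exists>h. (\<forall>n. norm (h n) = 1) \<and>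
    (\<forall>f. (\<lambda>n. \<pi> f (h n) - apply_bcontfun f x *\<^sub>C h n) \<longlonglongrightarrow> 0)"
proof -
  have rep: "star_rep cstar_alg \<pi>" and inj: "inj \<pi>"
    using assms by (auto simp: faithful_rep_def cstar_alg_def)
  define \<phi> where "\<phi> n = Bcontfun (\<lambda>z. complex_of_real (max 0 (1 - real (Suc n) * dist z x)))" for n
  define \<psi> where "\<psi> n = Bcontfun (\<lambda>z. complex_of_real (min 1 (max 0 (2 - real (Suc n) * dist z x))))" for n
  have \<phi>: "apply_bcontfun (\<phi> n) = (\<lambda>z. complex_of_real (max 0 (1 - real (Suc n) * dist z x)))" for n
    unfolding \<phi>_def by (rule apply_Bcontfun[where b = 1]) (auto intro!: continuous_intros)
  have \<psi>: "apply_bcontfun (\<psi> n) = (\<lambda>z. complex_of_real (min 1 (max 0 (2 - real (Suc n) * dist z x))))" for n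
    unfolding \<psi>_def by (rule apply_Bcontfun[where b = 1]) (auto intro!: continuous_intros)
  have \<psi>\<phi>: "\<psi> n * \<phi> n = \<phi> n" for n
    by (rule bcontfun_eqI) (auto simp: \<phi> \<psi> max_def min_def)
  have "\<exists>\<xi>. (\<pi> (\<phi> n)) \<xi> \<noteq> 0" for n
  proof (rule ccontr)
    assume "\<not> ?thesis"
    then have "\<pi> (\<phi> n) = \<pi> 0" by (intro blinfun_eqI) (simp add: star_rep_zero[OF rep])
    then have "\<phi> n = 0" using inj by (simp add: inj_eq)
    then have "apply_bcontfun (\<phi> n) x = 0" by simp
    then show False by (simp add: \<phi>)
  qed
  then obtain \<xi> where \<xi>: "\<And>n. (\<pi> (\<phi> n)) (\<xi> n) \<noteq> 0" by metis
  define h where "h n = inverse (norm ((\<pi> (\<phi> n)) (\<xi> n))) *\<^sub>R (\<pi> (\<phi> n)) (\<xi> n)" for n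
  have nh: "norm (h n) = 1" for n using \<xi>[of n] by (simp add: h_def)
  have mult: "(\<pi> (f * \<phi> n)) (\<xi> n) = \<pi> f ((\<pi> (\<phi> n)) (\<xi> n))" for f n
    by (simp add: star_rep_cstarD[OF rep])
  have \<psi>h: "\<pi> f (h n) = (\<pi> (f * \<psi> n)) (h n)" for f n
  proof -
    have "f * \<phi> n = (f * \<psi> n) * \<phi> n" using \<psi>\<phi>[of n] by (simp add: mult.assoc)
    then show ?thesis unfolding h_def blinfun.scaleR_right mult[symmetric] by simp
  qed
  have unit: "\<pi> unit_fun (h n) = h n" for n
    unfolding h_def blinfun.scaleR_right mult[symmetric] by simp
  have "(\<lambda>n. \<pi> f (h n) - apply_bcontfun f x *\<^sub>C h n) \<longlonglongrightarrow> 0" for f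
  proof (rule LIMSEQ_I)
    fix e :: real assume "0 < e"
    define g where "g = f - apply_bcontfun f x *\<^sub>C unit_fun"
    have "continuous_on UNIV (apply_bcontfun f)" by (rule continuous_on_apply_bcontfun)
    then obtain d where d: "0 < d" "\<And>z. dist z x < d \<Longrightarrow> cmod (apply_bcontfun f z - apply_bcontfun f x) < e / 2"
      using \<open>0 < e\<close> unfolding continuous_on_iff dist_norm[symmetric] by (metis UNIV_I half_gt_zero)
    obtain N where N: "inverse (real (Suc N)) < d / 2" using reals_Archimedean[of "d / 2"] d(1) by auto
    have "norm (\<pi> f (h n) - apply_bcontfun f x *\<^sub>C h n) \<le> e / 2" if "N \<le> n" for n
    proof -
      have eq: "\<pi> f (h n) - apply_bcontfun f x *\<^sub>C h n = (\<pi> (g * \<psi> n)) (h n)"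
        unfolding \<psi>h[symmetric]
        by (simp add: g_def star_rep_diff[OF rep] star_rep_cstarD[OF rep] blinfun.diff_left unit)
      have "norm (g * \<psi> n) \<le> e / 2"
      proof (rule norm_bound)
        fix z
        show "norm (apply_bcontfun (g * \<psi> n) z) \<le> e / 2"
        proof (cases "dist z x < d")
          case True
          have "norm (apply_bcontfun (g * \<psi> n) z) \<le> cmod (apply_bcontfun g z) * 1"
            unfolding times_bcontfun_apply norm_mult by (intro mult_left_mono) (auto simp: \<psi>)
          then show ?thesis using d(2)[OF True] by (simp add: g_def scaleC_complex_def)
        next
          case False
          have "2 < real (Suc N) * d" using N by (simp add: field_simps)
          also have "\<dots> \<le> real (Suc n) * dist z x"
            using False that d(1) by (intro mult_mono) auto
          finally show ?thesis using \<open>0 < e\<close> by (simp add: \<psi>)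
        qed
      qed
      then have "norm (\<pi> (g * \<psi> n)) \<le> e / 2" using star_rep_contractive[OF rep] order_trans by blast
      then show ?thesis using norm_blinfun[of "\<pi> (g * \<psi> n)" "h n"] by (simp add: eq nh)
    qed
    then show "\<exists>no. \<forall>n\<ge>no. norm (\<pi> f (h n) - apply_bcontfun f x *\<^sub>C h n - 0) < e"
      using \<open>0 < e\<close> by (intro exI[of _ N]) force
  qed
  with nh show ?thesis by blast
qed

subsection \<open>Tensor products of representations\<close>

text \<open>
  Products of partitions of unity on the factors are partitions of unity on \<open>X \<times> Y\<close> that consist of
  elementary tensors, so local averages of \<open>f\<close> lie in the algebraic tensor product.
\<close>

lemma tensor_funs_approx:
  fixes f :: "('x::metric_space \<times> 'y::metric_space) \<Rightarrow>\<^sub>C complex"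
  assumes comp: "compact (UNIV :: 'x set)" "compact (UNIV :: 'y set)"
    and "0 < e"
  shows "\<exists>g\<in>cspan (range (\<lambda>(f, g). tensor_fun f g)). norm (g - f) \<le> e"
proof -
  have comp2: "compact (UNIV :: ('x \<times> 'y) set)"
    using compact_Times[OF comp] by simp
  obtain d where d: "0 < d" "\<And>z z'. dist z z' < d \<Longrightarrow> cmod (apply_bcontfun f z - apply_bcontfun f z') < e"
    using uniformly_continuous_bcontfun[OF comp2 \<open>0 < e\<close>, of f] by auto
  obtain K and a :: "'x \<Rightarrow> 'x \<Rightarrow>\<^sub>C complex" where a: "square_partition (d / 2) K a"
    using square_partition_exists[OF comp(1), of "d / 2"] d(1) by auto
  obtain L and b :: "'y \<Rightarrow> 'y \<Rightarrow>\<^sub>C complex" where b: "square_partition (d / 2) L b"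
    using square_partition_exists[OF comp(2), of "d / 2"] d(1) by auto
  note a' = a[unfolded square_partition_def] and b' = b[unfolded square_partition_def]
  define w where "w p = tensor_fun (a (fst p) * a (fst p)) (b (snd p) * b (snd p))" for p
  have w: "apply_bcontfun (w p) z = complex_of_real ((cmod (apply_bcontfun (a (fst p)) (fst z)))\<^sup>2 *
      (cmod (apply_bcontfun (b (snd p)) (snd z)))\<^sup>2)" for p z
    using a' b' by (simp add: w_def apply_tensor_fun selfadjoint_square del: times_bcontfun_apply)
  have "norm ((\<Sum>p\<in>K \<times> L. apply_bcontfun f p *\<^sub>C w p) - f) \<le> e"
  proof (rule local_average_close[where r = "\<lambda>p z. (cmod (apply_bcontfun (a (fst p)) (fst z)))\<^sup>2 *
      (cmod (apply_bcontfun (b (snd p)) (snd z)))\<^sup>2"])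
    show "(\<Sum>p\<in>K \<times> L. w p) = unit_fun"
    proof (rule bcontfun_eqI)
      fix z
      have "apply_bcontfun (\<Sum>p\<in>K \<times> L. w p) z
          = apply_bcontfun (\<Sum>k\<in>K. a k * a k) (fst z) * apply_bcontfun (\<Sum>l\<in>L. b l * b l) (snd z)"
        by (simp add: apply_sum_bcontfun w_def apply_tensor_fun sum_product sum.cartesian_product case_prod_beta)
      then show "apply_bcontfun (\<Sum>p\<in>K \<times> L. w p) z = apply_bcontfun unit_fun z" using a' b' by simp
    qed
    show "cmod (apply_bcontfun f p - apply_bcontfun f z) \<le> e"
      if "p \<in> K \<times> L" "apply_bcontfun (w p) z \<noteq> 0" for p z
    proof -
      have "dist (fst z) (fst p) < d / 2" "dist (snd z) (snd p) < d / 2"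
        using that a' b' by (auto simp: w)
      then have "dist z p < d"
        unfolding dist_prod_def using sqrt_sum_squares_le_sum[of "dist (fst z) (fst p)" "dist (snd z) (snd p)"] by auto
      then show ?thesis using d(2)[of z p] by (simp add: norm_minus_commute)
    qed
  qed (simp add: w)
  moreover have "(\<Sum>p\<in>K \<times> L. apply_bcontfun f p *\<^sub>C w p) \<in> cspan (range (\<lambda>(f, g). tensor_fun f g))"
    unfolding w_def
    by (intro complex_vector.span_sum complex_vector.span_scale complex_vector.span_base) auto
  ultimately show ?thesis by blast
qed

lemma tensor_funs_total:
  assumes "compact (UNIV :: 'x::metric_space set)" "compact (UNIV :: 'y::metric_space set)"
  shows "closure (cspan (range (\<lambda>(f, g). tensor_fun f g))) = (UNIV :: (('x \<times> 'y) \<Rightarrow>\<^sub>C complex) set)"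
proof -
  have "\<exists>g\<in>cspan (range (\<lambda>(f, g). tensor_fun f g)). dist g f < e" if "0 < e" for e and f :: "('x \<times> 'y) \<Rightarrow>\<^sub>C complex"
  proof -
    obtain g where "g \<in> cspan (range (\<lambda>(f, g). tensor_fun f g))" "norm (g - f) \<le> e / 2"
      using tensor_funs_approx[OF assms, of "e / 2" f] \<open>0 < e\<close> by auto
    then show ?thesis using \<open>0 < e\<close> by (intro bexI[of _ g]) (auto simp: dist_norm)
  qed
  then show ?thesis by (auto simp: closure_approachable)
qed

lemma tensor_fun_scaleC: "c *\<^sub>C tensor_fun f g = tensor_fun (c *\<^sub>C f) g"
  by (rule bcontfun_eqI) (simp add: apply_tensor_fun scaleC_complex_def)

lemma tensor_fun_eqI:
  fixes F K :: "(('x::metric_space \<times> 'y::metric_space) \<Rightarrow>\<^sub>C complex) \<Rightarrow> 'v::real_normed_vector"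
  assumes comp: "compact (UNIV :: 'x set)" "compact (UNIV :: 'y set)"
    and bl: "bounded_linear F" "bounded_linear K"
    and eq: "\<And>f g. F (tensor_fun f g) = K (tensor_fun f g)"
  shows "F h = K h"
proof (rule bounded_linear_eq_on_total[OF tensor_funs_total[OF comp] _ bl])
  fix c and k :: "('x \<times> 'y) \<Rightarrow>\<^sub>C complex" assume "k \<in> range (\<lambda>(f, g). tensor_fun f g)"
  then obtain f g where "k = tensor_fun f g" by auto
  then have "c *\<^sub>C k = (\<lambda>(f, g). tensor_fun f g) (c *\<^sub>C f, g)" by (simp add: tensor_fun_scaleC)
  then show "c *\<^sub>C k \<in> range (\<lambda>(f, g). tensor_fun f g)" by (rule range_eqI)
qed (auto simp: eq)

lemma op_tensor_sum:
  assumes t: "hilbert_tensor t" and "\<And>i. clinear_op (A i)" "\<And>j. clinear_op (B j)"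
  shows "op_tensor t (\<Sum>i\<in>I. A i) (\<Sum>j\<in>J. B j) = (\<Sum>i\<in>I. \<Sum>j\<in>J. op_tensor t (A i) (B j))"
proof (rule tensor_op_eqI[OF t])
  have c: "clinear_op (\<Sum>i\<in>I. A i)" "clinear_op (\<Sum>j\<in>J. B j)"
    using assms by (auto simp: clinear_op_def blinfun.sum_left complex_vector.scale_sum_right)
  show "(op_tensor t (\<Sum>i\<in>I. A i) (\<Sum>j\<in>J. B j)) (t x y)
      = (\<Sum>i\<in>I. \<Sum>j\<in>J. op_tensor t (A i) (B j)) (t x y)" for x y
    by (simp add: op_tensor_apply[OF t] c assms(2,3) blinfun.sum_left tensor_sum_left[OF t] tensor_sum_right[OF t])
      (rule sum.swap)
qed

lemma op_tensor_tendsto: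
  assumes t: "hilbert_tensor t" and c: "\<And>n. clinear_op (A n)" "\<And>n. clinear_op (B n)"
    and lim: "A \<longlonglongrightarrow> A'" "B \<longlonglongrightarrow> B'"
  shows "(\<lambda>n. op_tensor t (A n) (B n)) \<longlonglongrightarrow> op_tensor t A' B'"
proof -
  have c': "clinear_op A'" "clinear_op B'"
    using clinear_op_tendsto[OF lim(1) c(1)] clinear_op_tendsto[OF lim(2) c(2)] by auto
  have cd: "clinear_op (A n - A')" "clinear_op (B n - B')" for n
    using c c' by (simp_all add: clinear_op_def blinfun.diff_left complex_vector.scale_right_diff_distrib)
  have eq: "op_tensor t (A n) (B n) - op_tensor t A' B'
      = op_tensor t (A n - A') (B n) + op_tensor t A' (B n - B')" for n
  proof -
    have "op_tensor t (A n) (B n) = op_tensor t ((A n - A') + A') (B n)" by simp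
    also have "\<dots> = op_tensor t (A n - A') (B n) + op_tensor t A' (B n)"
      by (rule op_tensor_add_left[OF t cd(1) c'(1) c(2)])
    also have "op_tensor t A' (B n) = op_tensor t A' ((B n - B') + B')" by simp
    also have "\<dots> = op_tensor t A' (B n - B') + op_tensor t A' B'"
      by (rule op_tensor_add_right[OF t c'(1) cd(2) c'(2)])
    finally show ?thesis by simp
  qed
  have "(\<lambda>n. op_tensor t (A n) (B n) - op_tensor t A' B') \<longlonglongrightarrow> 0"
  proof (rule Lim_null_comparison)
    show "\<forall>\<^sub>F n in sequentially. norm (op_tensor t (A n) (B n) - op_tensor t A' B')
        \<le> norm (A n - A') * norm (B n) + norm A' * norm (B n - B')"
      unfolding eq
      by (intro always_eventually allI order_trans[OF norm_triangle_ineq] add_mono norm_op_tensor_le t cd c c')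
    have "(\<lambda>n. norm (A n - A') * norm (B n) + norm A' * norm (B n - B'))
        \<longlonglongrightarrow> norm (A' - A') * norm B' + norm A' * norm (B' - B')"
      by (intro tendsto_intros lim)
    then show "(\<lambda>n. norm (A n - A') * norm (B n) + norm A' * norm (B n - B')) \<longlonglongrightarrow> 0" by simp
  qed
  then show ?thesis by (simp add: LIM_zero_iff)
qed

lemma tensor_fun_mult: "tensor_fun f g * tensor_fun f' g' = tensor_fun (f * f') (g * g')"
  by (rule bcontfun_eqI) (simp add: apply_tensor_fun)

lemma tensor_fun_star:
  "star (tensor_fun f g) = tensor_fun (star f) (star (g :: 'y::metric_space \<Rightarrow>\<^sub>C complex))"
  for f :: "'x::metric_space \<Rightarrow>\<^sub>C complex"
  by (rule bcontfun_eqI) (simp add: apply_tensor_fun star_complex_def)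

text \<open>
  The extension from the algebraic tensor product exists because \<open>\<Sum> \<pi>\<^sub>1(f\<^sub>i) \<otimes> \<pi>\<^sub>2(g\<^sub>i)\<close> is a limit of the
  operators \<open>\<Sum>\<^sub>k\<^sub>l h(k, l) W\<^sub>k\<^sub>l\<^sup>2\<close> with \<open>h = \<Sum> f\<^sub>i \<otimes> g\<^sub>i\<close> and \<open>W\<^sub>k\<^sub>l = \<pi>\<^sub>1(a\<^sub>k) \<otimes> \<pi>\<^sub>2(b\<^sub>l)\<close>, whose norms are at most
  the supremum norm of \<open>h\<close>.
\<close>

lemma tensor_star_rep:
  fixes \<pi>\<^sub>1 :: "('x::metric_space \<Rightarrow>\<^sub>C complex) \<Rightarrow> 'a::complex_hilbert \<Rightarrow>\<^sub>L 'a"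
    and \<pi>\<^sub>2 :: "('y::metric_space \<Rightarrow>\<^sub>C complex) \<Rightarrow> 'b::complex_hilbert \<Rightarrow>\<^sub>L 'b"
    and t :: "'a \<Rightarrow> 'b \<Rightarrow> 'k::complex_hilbert"
  assumes comp: "compact (UNIV :: 'x set)" "compact (UNIV :: 'y set)"
    and t: "hilbert_tensor t"
    and rep: "star_rep cstar_alg \<pi>\<^sub>1" "star_rep cstar_alg \<pi>\<^sub>2"
  shows "\<exists>\<pi>. star_rep cstar_alg \<pi> \<and> (\<forall>f g. \<pi> (tensor_fun f g) = op_tensor t (\<pi>\<^sub>1 f) (\<pi>\<^sub>2 g))"
proof -
  note r1 = star_rep_cstarD[OF rep(1)] and r2 = star_rep_cstarD[OF rep(2)]
  obtain K and a :: "nat \<Rightarrow> 'x \<Rightarrow> 'x \<Rightarrow>\<^sub>C complex"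
    where a: "\<And>n. square_partition (inverse (real (Suc n))) (K n) (a n)"
    using square_partition_sequence[OF comp(1)] by blast
  obtain L and b :: "nat \<Rightarrow> 'y \<Rightarrow> 'y \<Rightarrow>\<^sub>C complex"
    where b: "\<And>n. square_partition (inverse (real (Suc n))) (L n) (b n)"
    using square_partition_sequence[OF comp(2)] by blast
  note a' = a[unfolded square_partition_def] and b' = b[unfolded square_partition_def]
  define W where "W n p = op_tensor t (\<pi>\<^sub>1 (a n (fst p))) (\<pi>\<^sub>2 (b n (snd p)))" for n p
  have Wadj: "is_adjoint (W n p) (W n p)" for n p
    unfolding W_def using r1(5)[of "a n (fst p)"] r2(5)[of "b n (snd p)"] a' b'
    by (intro is_adjoint_op_tensor t r1 r2) auto
  have WW: "W n p o\<^sub>L W n p = op_tensor t (\<pi>\<^sub>1 (a n (fst p) * a n (fst p))) (\<pi>\<^sub>2 (b n (snd p) * b n (snd p)))" for n p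
    unfolding W_def by (simp add: op_tensor_compose[OF t] r1 r2)
  define P where "P = op_tensor t (\<pi>\<^sub>1 unit_fun) (\<pi>\<^sub>2 unit_fun)"
  have "is_adjoint P P" unfolding P_def
    by (intro is_adjoint_op_tensor t r1 r2 star_rep_unit_adjoint rep)
  moreover have PP: "P o\<^sub>L P = P" unfolding P_def by (simp add: op_tensor_compose[OF t] r1 r2 flip: r1(4) r2(4))
  ultimately have Pc: "norm (P v) \<le> norm v" for v by (rule selfadjoint_idempotent_contraction)
  have sumWW: "(\<Sum>p\<in>K n \<times> L n. W n p o\<^sub>L W n p) = P" for n
  proof -
    have "(\<Sum>p\<in>K n \<times> L n. W n p o\<^sub>L W n p)
        = op_tensor t (\<Sum>k\<in>K n. \<pi>\<^sub>1 (a n k * a n k)) (\<Sum>l\<in>L n. \<pi>\<^sub>2 (b n l * b n l))"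
      by (simp add: WW op_tensor_sum[OF t r1(1) r2(1)] sum.cartesian_product case_prod_beta)
    then show ?thesis using a' b' by (simp add: P_def flip: star_rep_sum[OF rep(1)] star_rep_sum[OF rep(2)])
  qed
  have col: "(\<Sum>p\<in>K n \<times> L n. (norm (W n p v))\<^sup>2) \<le> (norm v)\<^sup>2" for n v
  proof -
    have "(\<Sum>p\<in>K n \<times> L n. (norm (W n p v))\<^sup>2) = Re (cinner v ((\<Sum>p\<in>K n \<times> L n. W n p o\<^sub>L W n p) v))"
      by (simp add: norm_sq_cinner is_adjointD[OF Wadj] blinfun.sum_left cinner_sum_right)
    also have "\<dots> \<le> cmod (cinner v (P v))" unfolding sumWW by (rule complex_Re_le_cmod)
    also have "\<dots> \<le> norm v * norm v"
      by (rule order_trans[OF cauchy_schwarz]) (intro mult_left_mono Pc norm_ge_zero)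
    finally show ?thesis by (simp add: power2_eq_square)
  qed
  have diag: "norm (\<Sum>p\<in>K n \<times> L n. apply_bcontfun h p *\<^sub>C (W n p o\<^sub>L W n p)) \<le> norm h" for n h
  proof (rule norm_blinfun_bound)
    fix v
    have cW: "clinear_op (W n p)" for p unfolding W_def by (intro clinear_op_tensor t r1 r2)
    have "(norm (\<Sum>p\<in>K n \<times> L n. W n p (apply_bcontfun h p *\<^sub>C (W n p) v)))\<^sup>2
        \<le> (\<Sum>p\<in>K n \<times> L n. (norm (apply_bcontfun h p *\<^sub>C (W n p) v))\<^sup>2)"
      by (rule row_contraction[OF Wadj col])
    also have "\<dots> \<le> (\<Sum>p\<in>K n \<times> L n. (norm h)\<^sup>2 * (norm (W n p v))\<^sup>2)"
      unfolding norm_scaleC power_mult_distrib by (intro sum_mono mult_right_mono power_mono norm_bounded) auto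
    also have "\<dots> \<le> (norm h)\<^sup>2 * (norm v)\<^sup>2"
      unfolding sum_distrib_left[symmetric] by (intro mult_left_mono col) auto
    finally have "norm (\<Sum>p\<in>K n \<times> L n. W n p (apply_bcontfun h p *\<^sub>C (W n p) v)) \<le> norm h * norm v"
      unfolding power_mult_distrib[symmetric] by (rule power2_le_imp_le) simp
    then show "norm ((\<Sum>p\<in>K n \<times> L n. apply_bcontfun h p *\<^sub>C (W n p o\<^sub>L W n p)) v) \<le> norm h * norm v"
      by (simp add: blinfun.sum_left clinear_opD[OF cW])
  qed simp
  have lim: "(\<lambda>n. \<Sum>p\<in>K n \<times> L n. apply_bcontfun (tensor_fun f g) p *\<^sub>C (W n p o\<^sub>L W n p)) \<longlonglongrightarrow> op_tensor t (\<pi>\<^sub>1 f) (\<pi>\<^sub>2 g)" for f g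
  proof -
    have "(\<lambda>n. op_tensor t (\<pi>\<^sub>1 (\<Sum>k\<in>K n. apply_bcontfun f k *\<^sub>C (a n k * a n k))) (\<pi>\<^sub>2 (\<Sum>l\<in>L n. apply_bcontfun g l *\<^sub>C (b n l * b n l))))
        \<longlonglongrightarrow> op_tensor t (\<pi>\<^sub>1 f) (\<pi>\<^sub>2 g)"
      by (intro op_tensor_tendsto t r1 r2 bounded_linear.tendsto[OF star_rep_bounded_linear[OF rep(1)]]
          bounded_linear.tendsto[OF star_rep_bounded_linear[OF rep(2)]]
          square_partition_approx[OF comp(1) a] square_partition_approx[OF comp(2) b])
    moreover have "op_tensor t (\<pi>\<^sub>1 (\<Sum>k\<in>K n. apply_bcontfun f k *\<^sub>C (a n k * a n k))) (\<pi>\<^sub>2 (\<Sum>l\<in>L n. apply_bcontfun g l *\<^sub>C (b n l * b n l)))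
        = (\<Sum>p\<in>K n \<times> L n. apply_bcontfun (tensor_fun f g) p *\<^sub>C (W n p o\<^sub>L W n p))" for n
    proof -
      have cl: "clinear_op (c *\<^sub>C \<pi>\<^sub>1 h)" "clinear_op (d *\<^sub>C \<pi>\<^sub>2 k)" for c d h k
        by (auto intro: clinear_op_scaleC r1 r2)
      show ?thesis unfolding star_rep_sum[OF rep(1)] star_rep_sum[OF rep(2)] r1(3) r2(3)
        by (subst op_tensor_sum[OF t cl])
          (simp add: op_tensor_scaleC[OF t] cl r1(1) r2(1) WW apply_tensor_fun scaleC_scaleC sum.cartesian_product case_prod_beta mult.commute)
    qed
    ultimately show ?thesis by simp
  qed
  have "norm (\<Sum>p\<in>F. c p *\<^sub>C (case p of (f, g) \<Rightarrow> op_tensor t (\<pi>\<^sub>1 f) (\<pi>\<^sub>2 g)))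
      \<le> 1 * norm (\<Sum>p\<in>F. c p *\<^sub>C (case p of (f, g) \<Rightarrow> tensor_fun f g))"
    if "finite F" for F and c :: "('x \<Rightarrow>\<^sub>C complex) \<times> ('y \<Rightarrow>\<^sub>C complex) \<Rightarrow> complex"
  proof -
    define h where "h = (\<Sum>p\<in>F. c p *\<^sub>C (case p of (f, g) \<Rightarrow> tensor_fun f g))"
    have "(\<lambda>n. \<Sum>q\<in>F. c q *\<^sub>C (\<Sum>p\<in>K n \<times> L n. apply_bcontfun (tensor_fun (fst q) (snd q)) p *\<^sub>C (W n p o\<^sub>L W n p)))
        \<longlonglongrightarrow> (\<Sum>q\<in>F. c q *\<^sub>C op_tensor t (\<pi>\<^sub>1 (fst q)) (\<pi>\<^sub>2 (snd q)))"
      by (intro tendsto_sum bounded_linear.tendsto[OF bounded_linear_scaleC] lim)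
    moreover have "(\<Sum>q\<in>F. c q *\<^sub>C (\<Sum>p\<in>K n \<times> L n. apply_bcontfun (tensor_fun (fst q) (snd q)) p *\<^sub>C (W n p o\<^sub>L W n p)))
        = (\<Sum>p\<in>K n \<times> L n. apply_bcontfun h p *\<^sub>C (W n p o\<^sub>L W n p))" for n
      unfolding h_def apply_sum_bcontfun complex_vector.scale_sum_right complex_vector.scale_sum_left
      by (subst sum.swap) (simp add: case_prod_beta scaleC_scaleC scaleC_complex_def)
    ultimately have "(\<lambda>n. \<Sum>p\<in>K n \<times> L n. apply_bcontfun h p *\<^sub>C (W n p o\<^sub>L W n p))
        \<longlonglongrightarrow> (\<Sum>q\<in>F. c q *\<^sub>C op_tensor t (\<pi>\<^sub>1 (fst q)) (\<pi>\<^sub>2 (snd q)))" by simp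
    from LIMSEQ_le_const2[OF tendsto_norm[OF this]] diag
    have "norm (\<Sum>q\<in>F. c q *\<^sub>C op_tensor t (\<pi>\<^sub>1 (fst q)) (\<pi>\<^sub>2 (snd q))) \<le> norm h" by blast
    then show ?thesis by (simp add: h_def case_prod_beta)
  qed
  from clinear_extension[OF this _ tensor_funs_total[OF comp]]
  obtain T where T: "clinear_op T" "\<And>f g. T (tensor_fun f g) = op_tensor t (\<pi>\<^sub>1 f) (\<pi>\<^sub>2 g)"
    by auto
  note eqI = tensor_fun_eqI[OF comp]
  have blT: "bounded_linear (blinfun_apply T)" by (rule blinfun.bounded_linear_right)
  have app: "bounded_linear (\<lambda>f. T f x)" for x by (rule bounded_linear_compose[OF bounded_linear_apply blT])
  have cT: "clinear_op (T (tensor_fun f g))" for f g by (simp add: T(2) clinear_op_tensor t r1 r2)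
  have clin: "clinear_op (T f)" for f
    unfolding clinear_op_def
    by (intro allI, rule eqI[OF app bounded_linear_compose[OF bounded_linear_scaleC app]])
      (rule clinear_opD[OF cT])
  have mult1: "T (tensor_fun f g * k) = T (tensor_fun f g) o\<^sub>L T k" for f g k
    by (rule eqI[OF bounded_linear_compose[OF blT bounded_linear_mult_right]
          bounded_linear_compose[OF bounded_linear_compose_right blT]])
      (simp add: tensor_fun_mult T(2) op_tensor_compose[OF t] r1 r2)
  have mult: "T (f * k) = T f o\<^sub>L T k" for f k
    by (rule eqI[OF bounded_linear_compose[OF blT bounded_linear_mult_left]
          bounded_linear_compose[OF bounded_linear_compose_left blT]]) (rule mult1)
  have adj: "is_adjoint (T f) (T (star f))" for f
    unfolding is_adjoint_def
  proof (intro allI, rule eqI[OF bounded_linear_compose[OF bounded_linear_cinner_left app]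
        bounded_linear_compose[OF bounded_linear_cinner_right bounded_linear_compose[OF app bounded_linear_star]]])
    fix x y f g
    have "is_adjoint (T (tensor_fun f g)) (T (star (tensor_fun f g)))"
      by (auto simp: tensor_fun_star T(2) intro!: is_adjoint_op_tensor t r1 r2)
    then show "cinner (T (tensor_fun f g) x) y = cinner x (T (star (tensor_fun f g)) y)" by (rule is_adjointD)
  qed
  have "star_rep cstar_alg T"
    unfolding star_rep_def by (simp add: cstar_alg_def clin mult adj blinfun.add_right clinear_opD[OF T(1)])
  then show ?thesis using T(2) by blast
qed

section \<open>The Banach algebra \<open>\<ell>\<^sup>1(G, C(Z), \<alpha>)\<close>\<close>

lemma infsum_bounded_linear:
  assumes "bounded_linear h" and "f summable_on A"
  shows "(\<Sum>\<^sub>\<infinity>x\<in>A. h (f x)) = h (infsum f A)"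
  by (rule infsumI[OF has_sum_bounded_linear[OF assms(1) has_sum_infsum[OF assms(2)]]])

definition l1 :: "('g \<Rightarrow> 'a::real_normed_vector) set"
  where "l1 = {F. (\<lambda>s. norm (F s)) summable_on UNIV}"

definition l1norm :: "('g \<Rightarrow> 'a::real_normed_vector) \<Rightarrow> real"
  where "l1norm F = (\<Sum>\<^sub>\<infinity>s. norm (F s))"

lemma l1_summable: "F \<in> l1 \<Longrightarrow> (\<lambda>s. norm (F s)) summable_on UNIV"
  by (simp add: l1_def)

lemma l1_has_sum: "F \<in> l1 \<Longrightarrow> ((\<lambda>s. norm (F s)) has_sum l1norm F) UNIV"
  by (simp add: l1_def l1norm_def)

lemma l1norm_nonneg: "0 \<le> l1norm F"
  unfolding l1norm_def by (rule infsum_nonneg) simp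

lemma l1_bound:
  assumes "\<And>s. norm (F s) \<le> g s" and "g summable_on UNIV"
  shows "F \<in> l1" "l1norm F \<le> (\<Sum>\<^sub>\<infinity>s. g s)"
proof -
  have *: "(\<lambda>s. norm (F s)) summable_on UNIV"
    by (rule summable_on_comparison_test[OF assms(2)]) (auto simp: assms(1))
  then show "F \<in> l1" by (simp add: l1_def)
  show "l1norm F \<le> (\<Sum>\<^sub>\<infinity>s. g s)"
    unfolding l1norm_def by (intro infsum_mono * assms)
qed

lemma l1_add: "F \<in> l1 \<Longrightarrow> K \<in> l1 \<Longrightarrow> (\<lambda>s. F s + K s) \<in> l1"
  by (rule l1_bound(1)[where g = "\<lambda>s. norm (F s) + norm (K s)"])
    (auto intro: norm_triangle_ineq summable_on_add l1_summable)

lemma l1_scaleC: "F \<in> l1 \<Longrightarrow> (\<lambda>s. c *\<^sub>C (F s :: 'a::complex_normed_vector)) \<in> l1"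
  by (rule l1_bound(1)[where g = "\<lambda>s. cmod c * norm (F s)"])
    (auto simp: norm_scaleC intro: summable_on_cmult_right l1_summable)

lemma l1_diff: "F \<in> l1 \<Longrightarrow> K \<in> l1 \<Longrightarrow> (\<lambda>s. F s - K s) \<in> l1"
  by (rule l1_bound(1)[where g = "\<lambda>s. norm (F s) + norm (K s)"])
    (auto intro: norm_triangle_ineq4 summable_on_add l1_summable)

lemma l1norm_scaleC: "l1norm (\<lambda>s. c *\<^sub>C (F s :: 'a::complex_normed_vector)) = cmod c * l1norm F"
  by (simp add: l1norm_def norm_scaleC infsum_cmult_right')

lemma delta_apply: "delta s f t = (if t = s then f else 0)"
  by (simp add: delta_def)

lemma
  fixes F :: "'g \<Rightarrow> 'a::real_normed_vector"
  assumes "finite S" and "\<And>s. s \<notin> S \<Longrightarrow> F s = 0"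
  shows l1_finite: "F \<in> l1" and l1norm_finite: "l1norm F = (\<Sum>s\<in>S. norm (F s))"
proof -
  have "((\<lambda>s. norm (F s)) has_sum (\<Sum>s\<in>S. norm (F s))) UNIV"
    using assms by (intro has_sum_finite_neutralI) auto
  then show "F \<in> l1" "l1norm F = (\<Sum>s\<in>S. norm (F s))"
    by (auto simp: l1_def l1norm_def intro: has_sum_imp_summable infsumI)
qed

lemma zero_l1: "(\<lambda>_. 0) \<in> l1"
  by (rule l1_finite[of "{}"]) auto

lemma delta_l1: "delta s f \<in> l1" and l1norm_delta: "l1norm (delta s f) = norm f"
  using l1_finite[of "{s}" "delta s f"] l1norm_finite[of "{s}" "delta s f"]
  by (auto simp: delta_apply)

lemma l1_finite_approx:
  fixes F :: "'g \<Rightarrow> 'a::real_normed_vector"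
  assumes "F \<in> l1" and "0 < e"
  obtains S K where "finite S" "\<And>s. K s = (if s \<in> S then F s else 0)" "K \<in> l1"
    "l1norm (\<lambda>s. F s - K s) \<le> e"
proof -
  obtain S where S: "finite S" "dist (\<Sum>s\<in>S. norm (F s)) (l1norm F) \<le> e"
    using infsum_finite_approximation[OF l1_summable[OF assms(1)] assms(2)] unfolding l1norm_def by blast
  define K where "K s = (if s \<in> S then F s else 0)" for s
  have K: "K \<in> l1" "l1norm K = (\<Sum>s\<in>S. norm (F s))"
    using l1_finite[OF S(1), of K] l1norm_finite[OF S(1), of K] by (auto simp: K_def)
  have "norm (F s) = norm (F s - K s) + norm (K s)" for s by (simp add: K_def)
  then have "l1norm F = l1norm (\<lambda>s. F s - K s) + l1norm K"
    unfolding l1norm_def using l1_summable[OF l1_diff[OF assms(1) K(1)]] l1_summable[OF K(1)]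
    by (subst infsum_add[symmetric]) auto
  with S K that[of S K] show ?thesis by (auto simp: K_def dist_real_def)
qed

lemma bij_diff_right: "bij (\<lambda>r. r - (t::'g::ab_group_add))"
  by (rule bij_betw_byWitness[where f' = "\<lambda>r. r + t"]) auto

text \<open>
  All rearrangements of double series below are justified by the absolute convergence of the
  convolution of two summable families.
\<close>

lemma convolution_has_sum:
  fixes f g :: "'g::ab_group_add \<Rightarrow> real"
  assumes f: "(f has_sum a) UNIV" "\<And>t. 0 \<le> f t" and g: "(g has_sum b) UNIV" "\<And>t. 0 \<le> g t"
  shows "((\<lambda>(t, r). f t * g (r - t)) has_sum (a * b)) (UNIV \<times> UNIV)"
proof -
  have inner: "((\<lambda>r. f t * g (r - t)) has_sum (f t * b)) UNIV" for t
    by (intro has_sum_cmult_right) (subst has_sum_reindex_bij_betw[OF bij_diff_right], rule g)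
  have outer: "((\<lambda>t. f t * b) has_sum (a * b)) UNIV" by (rule has_sum_cmult_left[OF f(1)])
  show ?thesis
  proof (rule has_sum_SigmaI)
    show "(\<lambda>(t, r). f t * g (r - t)) summable_on UNIV \<times> UNIV"
      by (rule summable_on_SigmaI[where g = "\<lambda>t. f t * b"])
        (auto intro: inner has_sum_imp_summable[OF outer] intro!: mult_nonneg_nonneg f g)
  qed (auto intro: inner outer)
qed

locale point_action =
  fixes \<theta> :: "'g::ab_group_add \<Rightarrow> 'z::metric_space \<Rightarrow> 'z"
    and \<alpha> :: "'g \<Rightarrow> ('z \<Rightarrow>\<^sub>C complex) \<Rightarrow> 'z \<Rightarrow>\<^sub>C complex"
  assumes compact: "compact (UNIV :: 'z set)"
    and \<theta>_zero: "\<theta> 0 z = z"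
    and \<theta>_add: "\<theta> (g + h) z = \<theta> g (\<theta> h z)"
    and \<alpha>_apply [simp]: "\<alpha> g f z = f (\<theta> g z)"
begin

lemma \<alpha>_simps [simp]:
  "\<alpha> g 0 = 0" "\<alpha> g (f + k) = \<alpha> g f + \<alpha> g k" "\<alpha> g (c *\<^sub>C f) = c *\<^sub>C \<alpha> g f" "\<alpha> g (r *\<^sub>R f) = r *\<^sub>R \<alpha> g f"
  "\<alpha> g (f * k) = \<alpha> g f * \<alpha> g k" "\<alpha> g (star f) = star (\<alpha> g f)" "\<alpha> 0 f = f" "\<alpha> g unit_fun = unit_fun"
  by (auto intro!: bcontfun_eqI simp: \<theta>_zero)

lemma \<alpha>_add: "\<alpha> (g + h) f = \<alpha> g (\<alpha> h f)"
  by (rule bcontfun_eqI) (simp add: \<theta>_add[symmetric] add.commute)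

lemma norm_\<alpha>_le: "norm (\<alpha> g f) \<le> norm f"
  by (rule norm_bound) (simp add: norm_bounded)

lemma bounded_linear_\<alpha>: "bounded_linear (\<alpha> g)"
  by (rule bounded_linear_intro[where K = 1]) (simp_all add: norm_\<alpha>_le)

lemma \<alpha>_cancel [simp]: "\<alpha> g (\<alpha> (- g) f) = f" "\<alpha> (- g) (\<alpha> g f) = f"
  using \<alpha>_add[of g "- g" f] \<alpha>_add[of "- g" g f] by simp_all

lemma l1_alg_simps [simp]:
  "carr (l1_alg \<alpha>) = l1" "sadd (l1_alg \<alpha>) F K = (\<lambda>s. F s + K s)"
  "sscale (l1_alg \<alpha>) c F = (\<lambda>s. c *\<^sub>C F s)" "sstar (l1_alg \<alpha>) F = (\<lambda>s. \<alpha> s (star (F (- s))))"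
  by (simp_all add: l1_alg_def l1_def)

lemma smult_l1_alg: "smult (l1_alg \<alpha>) F K r = (\<Sum>\<^sub>\<infinity>t. F t * \<alpha> t (K (r - t)))"
  by (simp add: l1_alg_def)

lemma norm_convolution_term: "norm (F t * \<alpha> t (K (r - t))) \<le> norm (F t) * norm (K (r - t))"
  by (rule order_trans[OF norm_mult_ineq]) (intro mult_left_mono norm_\<alpha>_le norm_ge_zero)

lemma
  assumes F: "F \<in> l1" and K: "K \<in> l1"
  shows convolution_abs_summable:
      "(\<lambda>(t, r). norm (F t * \<alpha> t (K (r - t)))) summable_on UNIV \<times> UNIV"
    and convolution_fibre_summable: "(\<lambda>t. F t * \<alpha> t (K (r - t))) summable_on UNIV"
    and smult_l1: "smult (l1_alg \<alpha>) F K \<in> l1"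
    and l1norm_smult: "l1norm (smult (l1_alg \<alpha>) F K) \<le> l1norm F * l1norm K"
proof -
  define q where "q = (\<lambda>(t, r). norm (F t) * norm (K (r - t)))"
  have hs: "(q has_sum (l1norm F * l1norm K)) (UNIV \<times> UNIV)"
    unfolding q_def by (rule convolution_has_sum) (auto intro: l1_has_sum F K)
  show *: "(\<lambda>(t, r). norm (F t * \<alpha> t (K (r - t)))) summable_on UNIV \<times> UNIV"
    by (rule summable_on_comparison_test[OF has_sum_imp_summable[OF hs]])
      (auto simp: q_def norm_convolution_term)
  have qs: "((\<lambda>(r, t). q (t, r)) has_sum (l1norm F * l1norm K)) (UNIV \<times> UNIV)"
    using has_sum_swap[of q] hs by blast
  then have qf: "(\<lambda>t. q (t, r)) summable_on UNIV" for r
    using summable_on_SigmaD1[of "\<lambda>r t. q (t, r)" UNIV "\<lambda>_. UNIV" r] has_sum_imp_summable by force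
  have nf: "(\<lambda>t. norm (F t * \<alpha> t (K (r - t)))) summable_on UNIV" for r
    by (rule summable_on_comparison_test[OF qf[of r]]) (auto simp: q_def norm_convolution_term)
  then show fs: "(\<lambda>t. F t * \<alpha> t (K (r - t))) summable_on UNIV" for r
    by (rule abs_summable_summable)
  have "((\<lambda>r. \<Sum>\<^sub>\<infinity>t. q (t, r)) has_sum (l1norm F * l1norm K)) UNIV"
    by (rule has_sum_SigmaD[OF qs]) (simp add: qf)
  moreover have "norm (smult (l1_alg \<alpha>) F K r) \<le> (\<Sum>\<^sub>\<infinity>t. q (t, r))" for r
    unfolding smult_l1_alg
    by (rule norm_infsum_le[OF has_sum_infsum[OF fs] has_sum_infsum[OF qf]])
      (simp add: q_def norm_convolution_term)
  ultimately show "smult (l1_alg \<alpha>) F K \<in> l1" "l1norm (smult (l1_alg \<alpha>) F K) \<le> l1norm F * l1norm K"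
    using l1_bound[of "smult (l1_alg \<alpha>) F K" "\<lambda>r. \<Sum>\<^sub>\<infinity>t. q (t, r)"]
    by (auto simp: has_sum_imp_summable infsumI)
qed

lemma
  assumes F: "F \<in> l1"
  shows sstar_l1: "(\<lambda>s. \<alpha> s (star (F (- s)))) \<in> l1"
    and l1norm_sstar: "l1norm (\<lambda>s. \<alpha> s (star (F (- s)))) \<le> l1norm F"
proof -
  have b: "bij (\<lambda>s::'g. - s)" by (rule bij_betw_byWitness[where f' = uminus]) auto
  have hs: "((\<lambda>s. norm (F (- s))) has_sum l1norm F) UNIV"
    by (subst has_sum_reindex_bij_betw[OF b, of "\<lambda>s. norm (F s)"]) (rule l1_has_sum[OF F])
  have le: "norm (\<alpha> s (star (F (- s)))) \<le> norm (F (- s))" for s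
    using norm_\<alpha>_le[of s "star (F (- s))"] by simp
  from l1_bound[of "\<lambda>s. \<alpha> s (star (F (- s)))", OF le has_sum_imp_summable[OF hs]] infsumI[OF hs]
  show "(\<lambda>s. \<alpha> s (star (F (- s)))) \<in> l1" "l1norm (\<lambda>s. \<alpha> s (star (F (- s)))) \<le> l1norm F"
    by auto
qed

lemma smult_delta: "smult (l1_alg \<alpha>) (delta s f) (delta t g) = delta (s + t) (f * \<alpha> s g)"
  by (rule l1_alg_mult_delta) simp

lemma sstar_delta: "sstar (l1_alg \<alpha>) (delta s f) = delta (- s) (star (\<alpha> (- s) f))"
  by (subst l1_alg_star_delta) simp_all

lemma smult_unit: "smult (l1_alg \<alpha>) F (delta 0 unit_fun) = F"
proof
  fix r
  have "(\<Sum>\<^sub>\<infinity>t. F t * \<alpha> t (delta 0 unit_fun (r - t))) = (\<Sum>\<^sub>\<infinity>t\<in>{r}. F t * \<alpha> t (delta 0 unit_fun (r - t)))"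
    by (rule infsum_cong_neutral) (auto simp: delta_apply)
  then show "smult (l1_alg \<alpha>) F (delta 0 unit_fun) r = F r"
    by (simp add: smult_l1_alg delta_apply)
qed

subsection \<open>Automatic continuity\<close>

text \<open>
  The geometric series \<open>k = \<Sum> h\<^sup>n\<close> converges in \<open>\<ell>\<^sup>1\<close>.  The equation \<open>k = 1 + hk\<close> states that \<open>k\<close> is a right
  inverse of \<open>1 - h\<close>.
\<close>

lemma neumann_series:
  assumes h: "h \<in> l1" and "l1norm h < 1"
  shows "\<exists>k\<in>l1. k = (\<lambda>s. delta 0 unit_fun s + smult (l1_alg \<alpha>) h k s)"
proof -
  define p where "p n = (smult (l1_alg \<alpha>) h ^^ n) (delta 0 unit_fun)" for n
  have pSuc: "p (Suc n) = smult (l1_alg \<alpha>) h (p n)" for n by (simp add: p_def)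
  have p: "p n \<in> l1 \<and> l1norm (p n) \<le> l1norm h ^ n" for n
  proof (induction n)
    case 0
    have "norm (unit_fun :: 'z \<Rightarrow>\<^sub>C complex) \<le> 1" by (rule norm_bound) simp
    then show ?case by (simp add: p_def delta_l1 l1norm_delta)
  next
    case (Suc n)
    then show ?case unfolding pSuc
      by (auto intro!: smult_l1 h order_trans[OF l1norm_smult] mult_left_mono l1norm_nonneg)
  qed
  have geo: "(\<lambda>n. l1norm h ^ n) summable_on UNIV"
    using assms(2) l1norm_nonneg[of h] by (subst summable_on_UNIV_nonneg_real_iff) (auto simp: summable_geometric)
  have pn: "norm (p n s) \<le> l1norm h ^ n" for n s
  proof -
    have "norm (p n s) = (\<Sum>\<^sub>\<infinity>s\<in>{s}. norm (p n s))" by simp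
    also have "\<dots> \<le> l1norm (p n)" unfolding l1norm_def
      using p[of n] by (intro infsum_mono_neutral) (auto simp: l1_summable)
    finally show ?thesis using p[of n] by linarith
  qed
  have pabs: "(\<lambda>n. norm (p n s)) summable_on UNIV" for s
    by (rule summable_on_comparison_test[OF geo]) (auto simp: pn)
  have ps: "(\<lambda>n. p n s) summable_on UNIV" for s by (rule abs_summable_summable[OF pabs])
  define k where "k s = (\<Sum>\<^sub>\<infinity>n. p n s)" for s
  have prod: "(\<lambda>(n, s). norm (p n s)) summable_on UNIV \<times> UNIV"
  proof (rule summable_on_SigmaI[where g = "\<lambda>n. l1norm (p n)"])
    show "((\<lambda>s. case (n, s) of (n, s) \<Rightarrow> norm (p n s)) has_sum l1norm (p n)) UNIV" for n
      using l1_has_sum p by auto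
    show "(\<lambda>n. l1norm (p n)) summable_on UNIV"
      by (rule summable_on_comparison_test[OF geo]) (use p l1norm_nonneg in auto)
  qed auto
  then have prod': "(\<lambda>(s, n). norm (p n s)) summable_on UNIV \<times> UNIV"
    by (subst (asm) summable_on_swap) simp
  have kl: "k \<in> l1"
  proof (rule l1_bound(1))
    show "norm (k s) \<le> (\<Sum>\<^sub>\<infinity>n. norm (p n s))" for s unfolding k_def by (rule norm_infsum_bound[OF pabs])
    show "(\<lambda>s. \<Sum>\<^sub>\<infinity>n. norm (p n s)) summable_on UNIV"
      by (rule summable_on_Sigma_banach[OF prod'])
  qed
  have "k r = delta 0 unit_fun r + smult (l1_alg \<alpha>) h k r" for r
  proof -
    have "(\<lambda>(t, n). norm (h t * \<alpha> t (p n (r - t)))) summable_on UNIV \<times> UNIV"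
    proof (rule summable_on_comparison_test)
      have "(\<lambda>(t, n). norm (h t) * l1norm h ^ n) summable_on UNIV \<times> UNIV"
        by (rule summable_on_SigmaI[where g = "\<lambda>t. norm (h t) * (\<Sum>\<^sub>\<infinity>n. l1norm h ^ n)"])
          (auto intro!: has_sum_cmult_right has_sum_infsum geo summable_on_cmult_left l1_summable h l1norm_nonneg
            mult_nonneg_nonneg zero_le_power)
      then show "(\<lambda>(t, n). norm (h t) * l1norm h ^ n) summable_on UNIV \<times> UNIV" .
    qed (auto intro!: order_trans[OF norm_convolution_term] mult_left_mono pn)
    then have sw: "(\<lambda>(t, n). h t * \<alpha> t (p n (r - t))) summable_on UNIV \<times> UNIV"
      by (rule abs_summable_summable[OF summable_on_cong[THEN iffD1, rotated]]) auto
    have "(\<Sum>\<^sub>\<infinity>n. h t * \<alpha> t (p n (r - t))) = h t * \<alpha> t (k (r - t))" for t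
      unfolding k_def
      by (rule infsum_bounded_linear[OF bounded_linear_compose[OF bounded_linear_mult_right bounded_linear_\<alpha>] ps])
    then have "smult (l1_alg \<alpha>) h k r = (\<Sum>\<^sub>\<infinity>t. \<Sum>\<^sub>\<infinity>n. h t * \<alpha> t (p n (r - t)))"
      unfolding smult_l1_alg by simp
    also have "\<dots> = (\<Sum>\<^sub>\<infinity>n. \<Sum>\<^sub>\<infinity>t. h t * \<alpha> t (p n (r - t)))" by (rule infsum_swap_banach[OF sw])
    also have "\<dots> = (\<Sum>\<^sub>\<infinity>n. p (Suc n) r)" by (simp add: pSuc smult_l1_alg)
    also have "\<dots> = (\<Sum>\<^sub>\<infinity>n\<in>range Suc. p n r)" by (subst infsum_reindex) (auto simp: o_def)
    finally have "p 0 r + smult (l1_alg \<alpha>) h k r = (\<Sum>\<^sub>\<infinity>n\<in>insert 0 (range Suc). p n r)"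
      by (subst infsum_insert) (auto intro: summable_on_subset_banach[OF ps])
    also have "insert 0 (range Suc) = UNIV" using UNIV_nat_eq by simp
    finally have "p 0 r + smult (l1_alg \<alpha>) h k r = (\<Sum>\<^sub>\<infinity>n. p n r)" .
    moreover have "k r = (\<Sum>\<^sub>\<infinity>n. p n r)" by (rule k_def)
    moreover have "p 0 = delta 0 unit_fun" by (simp add: p_def)
    ultimately show ?thesis by simp
  qed
  with kl show ?thesis by (intro bexI[of _ k]) auto
qed

lemma star_rep_l1D:
  assumes "star_rep (l1_alg \<alpha>) \<rho>" and "F \<in> l1" "K \<in> l1"
  shows "clinear_op (\<rho> F)" "\<rho> (\<lambda>s. F s + K s) = \<rho> F + \<rho> K" "\<rho> (\<lambda>s. c *\<^sub>C F s) = c *\<^sub>C \<rho> F"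
    and "\<rho> (smult (l1_alg \<alpha>) F K) = \<rho> F o\<^sub>L \<rho> K" "is_adjoint (\<rho> F) (\<rho> (\<lambda>s. \<alpha> s (star (F (- s)))))"
  using assms by (simp_all add: star_rep_def)

text \<open>
  If \<open>\<mu> = \<parallel>\<rho>(F)\<parallel>\<^sup>2 > \<parallel>F\<parallel>\<^sub>1\<^sup>2\<close>, then \<open>1 - \<mu>\<^sup>-\<^sup>1F\<^sup>*F\<close> is invertible in \<open>\<ell>\<^sup>1\<close>, whereas
  \<open>\<rho>(1 - \<mu>\<^sup>-\<^sup>1F\<^sup>*F)\<close> is not bounded below on vectors on which \<open>\<rho>(F)\<close> nearly attains its norm.
\<close>

theorem star_rep_l1_contractive:
  assumes rep: "star_rep (l1_alg \<alpha>) \<rho>" and F: "F \<in> l1"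
  shows "norm (\<rho> F) \<le> l1norm F"
proof (rule ccontr)
  assume "\<not> ?thesis"
  then have gt: "l1norm F < norm (\<rho> F)" by simp
  note D = star_rep_l1D[OF rep]
  define F' where "F' = (\<lambda>s. \<alpha> s (star (F (- s))))"
  have F': "F' \<in> l1" "l1norm F' \<le> l1norm F" unfolding F'_def using sstar_l1 l1norm_sstar F by auto
  define A where "A = \<rho> F"
  define A' where "A' = \<rho> F'"
  have adj: "is_adjoint A A'" unfolding A_def A'_def F'_def by (rule D(5)[OF F F])
  define \<mu> where "\<mu> = (norm A)\<^sup>2"
  have A0: "0 < norm A" using gt l1norm_nonneg[of F] unfolding A_def by linarith
  then have \<mu>0: "0 < \<mu>" by (simp add: \<mu>_def)
  define h where "h = (\<lambda>s. complex_of_real (inverse \<mu>) *\<^sub>C smult (l1_alg \<alpha>) F' F s)"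
  have h: "h \<in> l1" unfolding h_def by (intro l1_scaleC smult_l1 F F')
  have "l1norm h = inverse \<mu> * l1norm (smult (l1_alg \<alpha>) F' F)"
    unfolding h_def l1norm_scaleC using \<mu>0 by (simp add: norm_inverse)
  also have "\<dots> \<le> inverse \<mu> * (l1norm F * l1norm F)"
    using \<mu>0 by (intro mult_left_mono order_trans[OF l1norm_smult[OF F'(1) F]] mult_right_mono F' l1norm_nonneg) auto
  also have "\<dots> < inverse \<mu> * \<mu>"
    unfolding \<mu>_def power2_eq_square using gt l1norm_nonneg[of F] A0
    by (intro mult_strict_left_mono mult_strict_mono) (auto simp: A_def)
  finally have "l1norm h < 1" using \<mu>0 by simp
  then obtain k where k: "k \<in> l1" "k = (\<lambda>s. delta 0 unit_fun s + smult (l1_alg \<alpha>) h k s)"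
    using neumann_series[OF h] by blast
  define T where "T = \<rho> h"
  define P where "P = \<rho> (delta 0 unit_fun)"
  define M where "M = norm (\<rho> k)"
  have T: "T = complex_of_real (inverse \<mu>) *\<^sub>C (A' o\<^sub>L A)"
    unfolding T_def h_def A_def A'_def by (simp only: D(3)[OF smult_l1[OF F'(1) F] F] D(4)[OF F'(1) F])
  have rk: "\<rho> k = P + (T o\<^sub>L \<rho> k)"
    unfolding P_def T_def by (subst k(2)) (simp add: D(2) D(4) h k(1) delta_l1 smult_l1)
  have AP: "A o\<^sub>L P = A"
    unfolding A_def P_def using D(4)[OF F delta_l1, of 0 unit_fun] by (simp add: smult_unit)
  have Padj: "is_adjoint P P"
    using D(5)[OF delta_l1 F, of 0 unit_fun] sstar_delta[of 0 unit_fun] by (simp add: P_def)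
  have PP: "P o\<^sub>L P = P"
    unfolding P_def using D(4)[OF delta_l1[of 0 unit_fun] delta_l1[of 0 unit_fun]] by (simp add: smult_unit)
  have Tadj: "cinner (T x) y = cinner x (T y)" for x y
    by (simp add: T cinner_scaleC_left cinner_scaleC_right is_adjointD[OF adj] is_adjointD[OF is_adjoint_sym[OF adj]])
  have A'n: "norm (A' y) \<le> norm A * norm y" for y
  proof -
    have "norm (A' y) ^ 2 \<le> norm (A (A' y)) * norm y"
      using norm_adjoint_le[OF is_adjoint_sym[OF adj], of y] by simp
    also have "\<dots> \<le> norm A * norm (A' y) * norm y"
      by (intro mult_right_mono norm_blinfun) auto
    finally show ?thesis by (cases "norm (A' y) = 0") (auto simp: power2_eq_square algebra_simps)
  qed
  have Tn: "norm (T x) \<le> norm x" for x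
  proof -
    have "norm (A' (A x)) \<le> norm A * (norm A * norm x)"
      by (rule order_trans[OF A'n]) (intro mult_left_mono norm_blinfun norm_ge_zero)
    moreover have "norm (T x) = inverse \<mu> * norm (A' (A x))"
      using \<mu>0 by (simp add: T norm_scaleC del: of_real_inverse)
    ultimately show ?thesis using \<mu>0 by (simp add: \<mu>_def power2_eq_square field_simps)
  qed
  have Tq: "cinner (T x) x = complex_of_real (inverse \<mu> * (norm (A x))\<^sup>2)" for x
    by (simp add: T cinner_scaleC_left is_adjointD[OF is_adjoint_sym[OF adj]] cinner_self)
  have key: "1 - \<epsilon> \<le> M * sqrt (2 * \<epsilon>)" if \<epsilon>: "0 < \<epsilon>" "\<epsilon> < 1" for \<epsilon>
  proof -
    have "\<exists>x. norm A * sqrt (1 - \<epsilon>) * norm x < norm (A x)"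
    proof (rule ccontr)
      assume "\<not> ?thesis"
      then have "norm A \<le> norm A * sqrt (1 - \<epsilon>)"
        using \<epsilon> by (intro norm_blinfun_bound) (auto simp: not_less)
      then show False using A0 \<epsilon> by simp
    qed
    then obtain x where x: "norm A * sqrt (1 - \<epsilon>) * norm x < norm (A x)" by blast
    have x0: "0 < norm x" using x by (cases "x = 0") auto
    have "(norm A * sqrt (1 - \<epsilon>) * norm x)\<^sup>2 \<le> (norm (A x))\<^sup>2"
      using x \<epsilon> by (intro power_mono) auto
    then have big: "(1 - \<epsilon>) * (norm x)\<^sup>2 \<le> inverse \<mu> * (norm (A x))\<^sup>2"
      using \<mu>0 \<epsilon> by (simp add: power_mult_distrib \<mu>_def field_simps)
    have "(norm (x - T x))\<^sup>2 = Re (cinner (x - T x) (x - T x))"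
      by (rule norm_sq_cinner)
    also have "\<dots> = (norm x)\<^sup>2 - 2 * (inverse \<mu> * (norm (A x))\<^sup>2) + (norm (T x))\<^sup>2"
    proof -
      define q where "q = inverse \<mu> * (norm (A x))\<^sup>2"
      have "cinner (T x) x = complex_of_real q" "cinner x (T x) = complex_of_real q"
        using Tadj[of x x] Tq[of x] unfolding q_def by simp_all
      then have "Re (cinner (x - T x) (x - T x))
          = (norm x)\<^sup>2 - 2 * q + (norm (T x))\<^sup>2"
        by (simp add: cinner_diff_left cinner_diff_right flip: norm_sq_cinner)
      then show ?thesis unfolding q_def .
    qed
    also have "\<dots> \<le> (norm x)\<^sup>2 - 2 * ((1 - \<epsilon>) * (norm x)\<^sup>2) + (norm x)\<^sup>2"
      using big power_mono[OF Tn norm_ge_zero, of x 2] by linarith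
    finally have "(norm (x - T x))\<^sup>2 \<le> (sqrt (2 * \<epsilon>) * norm x)\<^sup>2"
      using \<epsilon> by (simp add: power_mult_distrib algebra_simps)
    then have small: "norm (x - T x) \<le> sqrt (2 * \<epsilon>) * norm x"
      by (rule power2_le_imp_le) (use \<epsilon> in simp)
    have "(norm (A x))\<^sup>2 = (norm (A (P x)))\<^sup>2"
      using arg_cong[OF AP, of "\<lambda>S. blinfun_apply S x"] by simp
    also have "\<dots> \<le> (norm A * norm (P x))\<^sup>2"
      by (intro power_mono norm_blinfun) auto
    finally have "inverse \<mu> * (norm (A x))\<^sup>2 \<le> (norm (P x))\<^sup>2"
      using \<mu>0 by (simp add: power_mult_distrib \<mu>_def field_simps)
    also have "\<dots> = Re (cinner (P x) x)"
      using arg_cong[OF PP, of "\<lambda>S. blinfun_apply S x"]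
      by (simp add: norm_sq_cinner is_adjointD[OF Padj])
    also have "\<dots> = Re (cinner (\<rho> k x) (x - T x))"
    proof -
      have "\<rho> k x = P x + T (\<rho> k x)"
        using arg_cong[OF rk, of "\<lambda>S. blinfun_apply S x"] by (simp add: blinfun.add_left)
      then have "cinner (P x) x = cinner (\<rho> k x) x - cinner (T (\<rho> k x)) x"
        by (metis add_diff_cancel cinner_diff_left)
      then show ?thesis by (simp add: cinner_diff_right Tadj)
    qed
    also have "\<dots> \<le> norm (\<rho> k x) * norm (x - T x)"
      by (rule order_trans[OF complex_Re_le_cmod cauchy_schwarz])
    also have "\<dots> \<le> (M * norm x) * (sqrt (2 * \<epsilon>) * norm x)"
      unfolding M_def by (intro mult_mono norm_blinfun small) auto
    finally have "(1 - \<epsilon>) * (norm x)\<^sup>2 \<le> (M * sqrt (2 * \<epsilon>)) * (norm x)\<^sup>2"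
      using big by (simp add: power2_eq_square algebra_simps)
    then show ?thesis using x0 by simp
  qed
  have M0: "0 \<le> M" by (simp add: M_def)
  define m where "m = M + 1"
  have m: "1 \<le> m" using M0 by (simp add: m_def)
  define \<epsilon> where "\<epsilon> = inverse (8 * m\<^sup>2)"
  have "1 \<le> m\<^sup>2" using m by (rule one_le_power)
  then have e: "0 < \<epsilon>" "\<epsilon> \<le> 1 / 8"
    using le_imp_inverse_le[of 8 "8 * m\<^sup>2"] m by (auto simp: \<epsilon>_def)
  have "sqrt (2 * \<epsilon>) = 1 / (2 * m)"
  proof (rule real_sqrt_unique)
    show "(1 / (2 * m))\<^sup>2 = 2 * \<epsilon>" by (simp add: \<epsilon>_def power_divide power_mult_distrib divide_simps)
  qed (use m in auto)
  then have "1 - \<epsilon> \<le> M / (2 * m)" using key[of \<epsilon>] e by simp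
  also have "\<dots> \<le> 1 / 2" using m by (simp add: m_def divide_simps)
  finally show False using e by simp
qed

subsection \<open>Covariant pairs and their integrated forms\<close>

text \<open>
  \<open>V\<close> is a unitary representation of \<open>G\<close>, but \<open>\<pi>(1)\<close> may be a proper projection.
\<close>

definition covariant_pair :: "(('z \<Rightarrow>\<^sub>C complex) \<Rightarrow> 'h::complex_hilbert \<Rightarrow>\<^sub>L 'h) \<Rightarrow> ('g \<Rightarrow> 'h \<Rightarrow>\<^sub>L 'h) \<Rightarrow> bool"
  where "covariant_pair \<pi> V \<longleftrightarrow> star_rep cstar_alg \<pi> \<and> V 0 = id_blinfun \<and>
    (\<forall>s. clinear_op (V s) \<and> is_adjoint (V s) (V (- s))) \<and>
    (\<forall>s t. V s o\<^sub>L V t = V (s + t)) \<and> (\<forall>s f. V s o\<^sub>L \<pi> f = \<pi> (\<alpha> s f) o\<^sub>L V s)"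

definition integrated_form ::
    "(('z \<Rightarrow>\<^sub>C complex) \<Rightarrow> 'h::complex_hilbert \<Rightarrow>\<^sub>L 'h) \<Rightarrow> ('g \<Rightarrow> 'h \<Rightarrow>\<^sub>L 'h) \<Rightarrow> ('g \<Rightarrow> 'z \<Rightarrow>\<^sub>C complex) \<Rightarrow> 'h \<Rightarrow>\<^sub>L 'h"
  where "integrated_form \<pi> V F = (\<Sum>\<^sub>\<infinity>s. \<pi> (F s) o\<^sub>L V s)"

context
  fixes \<pi> :: "('z \<Rightarrow>\<^sub>C complex) \<Rightarrow> 'h::complex_hilbert \<Rightarrow>\<^sub>L 'h" and V :: "'g \<Rightarrow> 'h \<Rightarrow>\<^sub>L 'h"
  assumes cov: "covariant_pair \<pi> V"
begin

lemma covariant_pairD: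
  "star_rep cstar_alg \<pi>" "V 0 = id_blinfun" "clinear_op (V s)" "is_adjoint (V s) (V (- s))"
  "V s o\<^sub>L V t = V (s + t)" "V s o\<^sub>L \<pi> f = \<pi> (\<alpha> s f) o\<^sub>L V s"
  using cov by (auto simp: covariant_pair_def)

lemma norm_covariant_unitary: "norm (V s x) \<le> norm x"
  using norm_adjoint_le[OF covariant_pairD(4), of s x]
  by (cases "norm (V s x) = 0")
    (auto simp: covariant_pairD(5) covariant_pairD(2) power2_eq_square intro: abs_le_square_iff[THEN iffD2, of "norm (V s x)" "norm x", simplified])

lemma norm_integrated_term: "norm (\<pi> f o\<^sub>L V s) \<le> norm f"
proof (rule norm_blinfun_bound)
  fix x
  have "norm (\<pi> f (V s x)) \<le> norm (\<pi> f) * norm (V s x)"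
    by (rule norm_blinfun)
  also have "\<dots> \<le> norm f * norm x"
    by (intro mult_mono star_rep_contractive covariant_pairD(1) norm_covariant_unitary) auto
  finally show "norm ((\<pi> f o\<^sub>L V s) x) \<le> norm f * norm x" by simp
qed simp

lemma integrated_term_bounded_linear: "bounded_linear (\<lambda>f. \<pi> f o\<^sub>L V s)"
  by (rule bounded_linear_compose[OF bounded_linear_compose_left star_rep_bounded_linear[OF covariant_pairD(1)]])

lemma integrated_abs_summable: "F \<in> l1 \<Longrightarrow> (\<lambda>s. norm (\<pi> (F s) o\<^sub>L V s)) summable_on UNIV"
  by (rule summable_on_comparison_test[OF l1_summable]) (auto simp: norm_integrated_term)

lemma integrated_summable: "F \<in> l1 \<Longrightarrow> (\<lambda>s. \<pi> (F s) o\<^sub>L V s) summable_on UNIV"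
  by (rule abs_summable_summable[OF integrated_abs_summable])

lemma integrated_apply:
  "F \<in> l1 \<Longrightarrow> (integrated_form \<pi> V F) x = (\<Sum>\<^sub>\<infinity>s. (\<pi> (F s) o\<^sub>L V s) x)"
  unfolding integrated_form_def by (rule infsum_bounded_linear[OF bounded_linear_apply integrated_summable, symmetric])

lemma integrated_apply_summable:
  "F \<in> l1 \<Longrightarrow> (\<lambda>s. (\<pi> (F s) o\<^sub>L V s) x) summable_on UNIV"
  by (rule summable_on_bounded_linear[OF bounded_linear_apply integrated_summable])

lemma integrated_delta: "integrated_form \<pi> V (delta s f) = \<pi> f o\<^sub>L V s"
proof -
  have "integrated_form \<pi> V (delta s f) = (\<Sum>\<^sub>\<infinity>t\<in>{s}. \<pi> (delta s f t) o\<^sub>L V t)"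
    unfolding integrated_form_def
    by (rule infsum_cong_neutral)
      (auto simp: delta_apply star_rep_zero[OF covariant_pairD(1)] bounded_bilinear.zero_left[OF bounded_bilinear_blinfun_compose])
  then show ?thesis by (simp add: delta_apply)
qed

text \<open>
  Covariance gives \<open>\<pi>(F\<^sub>t) V\<^sub>t \<pi>(K\<^sub>s) V\<^sub>s = \<pi>(F\<^sub>t \<alpha>\<^sub>t(K\<^sub>s)) V\<^bsub>t+s\<^esub>\<close>; summing along \<open>t + s = r\<close> first yields the
  convolution.
\<close>

lemma integrated_mult:
  assumes F: "F \<in> l1" and K: "K \<in> l1"
  shows "integrated_form \<pi> V (smult (l1_alg \<alpha>) F K) = integrated_form \<pi> V F o\<^sub>L integrated_form \<pi> V K"
proof -
  define T where "T t r = \<pi> (F t * \<alpha> t (K (r - t))) o\<^sub>L V r" for t r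
  have sw: "(\<lambda>(t, r). T t r) summable_on UNIV \<times> UNIV"
    by (rule abs_summable_summable, rule summable_on_comparison_test[OF convolution_abs_summable[OF F K]])
      (auto simp: T_def norm_integrated_term)
  have tm: "(\<pi> (F t) o\<^sub>L V t) o\<^sub>L (\<pi> (K s) o\<^sub>L V s) = T t (s + t)" for t s
  proof -
    have "(\<pi> (F t) o\<^sub>L V t) o\<^sub>L (\<pi> (K s) o\<^sub>L V s) = \<pi> (F t) o\<^sub>L ((V t o\<^sub>L \<pi> (K s)) o\<^sub>L V s)"
      by (simp add: blinfun_compose_assoc)
    also have "\<dots> = (\<pi> (F t) o\<^sub>L \<pi> (\<alpha> t (K s))) o\<^sub>L (V t o\<^sub>L V s)"
      unfolding covariant_pairD(6) by (simp add: blinfun_compose_assoc)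
    finally show ?thesis
      by (simp add: T_def covariant_pairD(5) star_rep_cstarD(4)[OF covariant_pairD(1)] add.commute)
  qed
  have "integrated_form \<pi> V F o\<^sub>L integrated_form \<pi> V K = (\<Sum>\<^sub>\<infinity>t. (\<pi> (F t) o\<^sub>L V t) o\<^sub>L integrated_form \<pi> V K)"
    unfolding integrated_form_def[of \<pi> V F]
    by (rule infsum_bounded_linear[OF bounded_linear_compose_left integrated_summable[OF F], symmetric])
  also have "\<dots> = (\<Sum>\<^sub>\<infinity>t. \<Sum>\<^sub>\<infinity>s. T t (s + t))"
    unfolding integrated_form_def tm[symmetric]
    by (rule infsum_cong, rule infsum_bounded_linear[OF bounded_linear_compose_right integrated_summable[OF K], symmetric])
  also have "\<dots> = (\<Sum>\<^sub>\<infinity>t. \<Sum>\<^sub>\<infinity>r. T t r)"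
  proof (rule infsum_cong)
    fix t :: 'g
    have "bij (\<lambda>s. s + t)" by (rule bij_betw_byWitness[where f' = "\<lambda>r. r - t"]) auto
    then show "(\<Sum>\<^sub>\<infinity>s. T t (s + t)) = (\<Sum>\<^sub>\<infinity>r. T t r)" by (rule infsum_reindex_bij_betw)
  qed
  also have "\<dots> = (\<Sum>\<^sub>\<infinity>r. \<Sum>\<^sub>\<infinity>t. T t r)" by (rule infsum_swap_banach[OF sw])
  also have "\<dots> = integrated_form \<pi> V (smult (l1_alg \<alpha>) F K)"
    unfolding integrated_form_def T_def smult_l1_alg
    by (rule infsum_cong, rule infsum_bounded_linear[OF integrated_term_bounded_linear convolution_fibre_summable[OF F K]])
  finally show ?thesis ..
qed

lemma integrated_adjoint:
  assumes F: "F \<in> l1"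
  shows "is_adjoint (integrated_form \<pi> V F) (integrated_form \<pi> V (\<lambda>s. \<alpha> s (star (F (- s)))))"
  unfolding is_adjoint_def
proof (intro allI)
  fix x y
  have b: "bij (\<lambda>s::'g. - s)" by (rule bij_betw_byWitness[where f' = uminus]) auto
  have tm: "is_adjoint (\<pi> (F s) o\<^sub>L V s) (\<pi> (\<alpha> (- s) (star (F s))) o\<^sub>L V (- s))" for s
    using is_adjoint_compose[OF star_rep_cstarD(5)[OF covariant_pairD(1)] covariant_pairD(4), of "F s" s]
    by (simp only: covariant_pairD(6))
  have "cinner (integrated_form \<pi> V F x) y = (\<Sum>\<^sub>\<infinity>s. cinner ((\<pi> (F s) o\<^sub>L V s) x) y)"
    unfolding integrated_apply[OF F]
    by (rule infsum_bounded_linear[OF bounded_linear_cinner_left integrated_apply_summable[OF F], symmetric])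
  also have "\<dots> = (\<Sum>\<^sub>\<infinity>s. cinner x ((\<pi> (\<alpha> (- s) (star (F (- (- s))))) o\<^sub>L V (- s)) y))"
    using is_adjointD[OF tm] by simp
  also have "\<dots> = (\<Sum>\<^sub>\<infinity>s. cinner x ((\<pi> (\<alpha> s (star (F (- s)))) o\<^sub>L V s) y))"
    by (rule infsum_reindex_bij_betw[OF b])
  also have "\<dots> = cinner x ((integrated_form \<pi> V (\<lambda>s. \<alpha> s (star (F (- s))))) y)"
    unfolding integrated_apply[OF sstar_l1[OF F]]
    by (rule infsum_bounded_linear[OF bounded_linear_cinner_right integrated_apply_summable[OF sstar_l1[OF F]]])
  finally show "cinner (integrated_form \<pi> V F x) y
      = cinner x ((integrated_form \<pi> V (\<lambda>s. \<alpha> s (star (F (- s))))) y)" .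
qed

theorem integrated_star_rep: "star_rep (l1_alg \<alpha>) (integrated_form \<pi> V)"
proof -
  note r = star_rep_cstarD[OF covariant_pairD(1)]
  have "clinear_op (integrated_form \<pi> V F)" if F: "F \<in> l1" for F
    unfolding clinear_op_def
  proof (intro allI)
    fix c x
    show "integrated_form \<pi> V F (c *\<^sub>C x) = c *\<^sub>C (integrated_form \<pi> V F) x"
      unfolding integrated_apply[OF F] infsum_bounded_linear[OF bounded_linear_scaleC integrated_apply_summable[OF F], symmetric]
      by (simp add: clinear_opD[OF r(1)] clinear_opD[OF covariant_pairD(3)])
  qed
  moreover have "integrated_form \<pi> V (\<lambda>s. F s + K s) = integrated_form \<pi> V F + integrated_form \<pi> V K"
    if "F \<in> l1" "K \<in> l1" for F K
    unfolding integrated_form_def r(2) bounded_bilinear.add_left[OF bounded_bilinear_blinfun_compose]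
    by (intro infsum_add integrated_summable that)
  moreover have "integrated_form \<pi> V (\<lambda>s. c *\<^sub>C F s) = c *\<^sub>C integrated_form \<pi> V F" if "F \<in> l1" for c F
    unfolding integrated_form_def r(3) scaleC_compose_left
    by (rule infsum_bounded_linear[OF bounded_linear_scaleC integrated_summable[OF that]])
  ultimately show ?thesis
    using integrated_adjoint unfolding star_rep_def by (simp add: integrated_mult)
qed

end

end

section \<open>Amenability and the enveloping norm\<close>

context point_action
begin

lemma star_rep_l1_zero:
  assumes "star_rep (l1_alg \<alpha>) \<rho>"
  shows "\<rho> (\<lambda>_. 0) = 0"
  using star_rep_l1D(3)[OF assms zero_l1 zero_l1, of 0] by simp

lemma star_rep_l1_diff:
  assumes "star_rep (l1_alg \<alpha>) \<rho>" "F \<in> l1" "K \<in> l1"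
  shows "\<rho> (\<lambda>s. F s - K s) = \<rho> F - \<rho> K"
  using star_rep_l1D(2)[OF assms(1,2) l1_scaleC[OF assms(3), of "- 1"]] star_rep_l1D(3)[OF assms(1,3,3), of "- 1"]
  by (simp flip: uminus_eq_scaleC)

lemma star_rep_l1_dist:
  assumes "star_rep (l1_alg \<alpha>) \<rho>" "F \<in> l1" "K \<in> l1"
  shows "norm (\<rho> F - \<rho> K) \<le> l1norm (\<lambda>s. F s - K s)"
  using star_rep_l1_contractive[OF assms(1) l1_diff[OF assms(2,3)]]
  by (simp only: star_rep_l1_diff[OF assms])

lemma star_rep_finite_support:
  assumes rep: "star_rep (l1_alg \<alpha>) \<rho>" and "finite S" and supp: "\<And>s. s \<notin> S \<Longrightarrow> F s = 0"
  shows "\<rho> F = (\<Sum>s\<in>S. \<rho> (delta s (F s)))"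
proof -
  have *: "(\<lambda>t. \<Sum>s\<in>S. delta s (F s) t) \<in> l1 \<and> \<rho> (\<lambda>t. \<Sum>s\<in>S. delta s (F s) t) = (\<Sum>s\<in>S. \<rho> (delta s (F s)))"
    using \<open>finite S\<close>
  proof (induction S)
    case empty
    then show ?case by (simp add: zero_l1 star_rep_l1_zero[OF rep])
  next
    case (insert s S)
    then show ?case
      using l1_add[OF delta_l1, of _ s "F s"] star_rep_l1D(2)[OF rep delta_l1, of _ s "F s"] by simp
  qed
  moreover have "(\<lambda>t. \<Sum>s\<in>S. delta s (F s) t) = F"
    using \<open>finite S\<close> supp by (auto simp: delta_apply)
  ultimately show ?thesis by simp
qed

text \<open>
  Near the vectors \<open>e n j\<close>, the representation \<open>\<rho>\<close> acts like the orbit representation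
  \<open>\<delta>\<^sub>s \<otimes> f : \<epsilon>\<^sub>j \<mapsto> f(\<theta>(-j-s)z) \<epsilon>\<^bsub>j+s\<^esub>\<close> on \<open>\<ell>\<^sup>2(G)\<close>.
\<close>

definition localizes :: "(('g \<Rightarrow> 'z \<Rightarrow>\<^sub>C complex) \<Rightarrow> 'h::complex_hilbert \<Rightarrow>\<^sub>L 'h) \<Rightarrow> 'z \<Rightarrow> bool"
  where "localizes \<rho> z \<longleftrightarrow> (\<exists>e. (\<forall>n. orthonormal (e n) UNIV) \<and>
    (\<forall>s f j. (\<lambda>n::nat. (\<rho> (delta s f)) (e n j)
      - f (\<theta> (- (j + s)) z) *\<^sub>C e n (j + s)) \<longlonglongrightarrow> 0))"

text \<open>
  The linear map \<open>\<epsilon>\<^sub>j \<mapsto> e n j\<close> is isometric and intertwines the orbit representation at \<open>z\<close> with \<open>\<rho>\<close> up to an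
  error that tends to \<open>0\<close>.  Hence the matrix of \<open>F\<close> in the orbit representation is bounded by \<open>\<parallel>\<rho>(F)\<parallel>\<close>.
\<close>

lemma localized_matrix_bound:
  fixes \<rho> :: "('g \<Rightarrow> 'z \<Rightarrow>\<^sub>C complex) \<Rightarrow> 'h::complex_hilbert \<Rightarrow>\<^sub>L 'h"
  assumes rep: "star_rep (l1_alg \<alpha>) \<rho>" and loc: "localizes \<rho> z"
    and S: "finite S" "\<And>s. s \<notin> S \<Longrightarrow> F s = 0" and fin: "finite B" "finite J"
  shows "(\<Sum>g\<in>B. (cmod (\<Sum>j\<in>J. apply_bcontfun (F (g - j)) (\<theta> (- g) z) * c j))\<^sup>2)
    \<le> (norm (\<rho> F))\<^sup>2 * (\<Sum>j\<in>J. (cmod (c j))\<^sup>2)"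
proof -
  obtain e :: "nat \<Rightarrow> 'g \<Rightarrow> 'h" where on: "\<And>n. orthonormal (e n) UNIV"
    and lim: "\<And>s f j. (\<lambda>n. (\<rho> (delta s f)) (e n j)
      - apply_bcontfun f (\<theta> (- (j + s)) z) *\<^sub>C e n (j + s)) \<longlonglongrightarrow> 0"
    using loc unfolding localizes_def by blast
  have on': "orthonormal (e n) A" for n A using on[of n] by (simp add: orthonormal_def)
  define m where "m g = (\<Sum>j\<in>J. apply_bcontfun (F (g - j)) (\<theta> (- g) z) * c j)" for g
  define G where "G = B \<union> (\<lambda>(j, s). j + s) ` (J \<times> S)"
  have G: "finite G" using fin S by (simp add: G_def)
  define u where "u n = (\<Sum>j\<in>J. c j *\<^sub>C e n j)" for n
  define v where "v n = (\<Sum>g\<in>G. m g *\<^sub>C e n g)" for n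
  define C where "C = (\<Sum>j\<in>J. (cmod (c j))\<^sup>2)"
  have un: "norm (u n) = sqrt C" for n
    using norm_orthonormal_sum[OF fin(2) on', of c n] by (simp add: u_def C_def real_sqrt_unique)
  have vn: "norm (v n) = sqrt (\<Sum>g\<in>G. (cmod (m g))\<^sup>2)" for n
    using norm_orthonormal_sum[OF G on', of m n] by (simp add: v_def real_sqrt_unique)
  have v: "v n = (\<Sum>j\<in>J. \<Sum>s\<in>S. c j *\<^sub>C apply_bcontfun (F s) (\<theta> (- (j + s)) z) *\<^sub>C e n (j + s))" for n
  proof -
    have "(\<Sum>s\<in>S. c j *\<^sub>C apply_bcontfun (F s) (\<theta> (- (j + s)) z) *\<^sub>C e n (j + s))
        = (\<Sum>g\<in>G. c j *\<^sub>C apply_bcontfun (F (g - j)) (\<theta> (- g) z) *\<^sub>C e n g)" if "j \<in> J" for j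
    proof -
      have "(\<Sum>s\<in>S. c j *\<^sub>C apply_bcontfun (F s) (\<theta> (- (j + s)) z) *\<^sub>C e n (j + s))
          = (\<Sum>g\<in>(\<lambda>s. j + s) ` S. c j *\<^sub>C apply_bcontfun (F (g - j)) (\<theta> (- g) z) *\<^sub>C e n g)"
        by (subst sum.reindex) (auto simp: inj_on_def)
      also have "\<dots> = (\<Sum>g\<in>G. c j *\<^sub>C apply_bcontfun (F (g - j)) (\<theta> (- g) z) *\<^sub>C e n g)"
      proof (rule sum.mono_neutral_left[OF G])
        show "(\<lambda>s. j + s) ` S \<subseteq> G" using that by (auto simp: G_def)
        show "\<forall>g\<in>G - (\<lambda>s. j + s) ` S. c j *\<^sub>C apply_bcontfun (F (g - j)) (\<theta> (- g) z) *\<^sub>C e n g = 0"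
        proof
          fix g assume "g \<in> G - (\<lambda>s. j + s) ` S"
          then have "g - j \<notin> S" by (force simp: image_iff)
          then show "c j *\<^sub>C apply_bcontfun (F (g - j)) (\<theta> (- g) z) *\<^sub>C e n g = 0" by (simp add: S(2))
        qed
      qed
      finally show ?thesis .
    qed
    then have "(\<Sum>j\<in>J. \<Sum>s\<in>S. c j *\<^sub>C apply_bcontfun (F s) (\<theta> (- (j + s)) z) *\<^sub>C e n (j + s))
        = (\<Sum>j\<in>J. \<Sum>g\<in>G. c j *\<^sub>C apply_bcontfun (F (g - j)) (\<theta> (- g) z) *\<^sub>C e n g)" by simp
    also have "\<dots> = v n"
      unfolding v_def m_def complex_vector.scale_sum_left
      by (subst sum.swap) (simp add: scaleC_scaleC mult.commute)
    finally show ?thesis ..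
  qed
  have \<rho>u: "\<rho> F (u n) = (\<Sum>j\<in>J. \<Sum>s\<in>S. c j *\<^sub>C (\<rho> (delta s (F s))) (e n j))" for n
  proof -
    have "\<rho> F (u n) = (\<Sum>s\<in>S. (\<rho> (delta s (F s))) (u n))"
      by (subst star_rep_finite_support[OF rep S]) (simp_all add: blinfun.sum_left)
    also have "\<dots> = (\<Sum>s\<in>S. \<Sum>j\<in>J. c j *\<^sub>C (\<rho> (delta s (F s))) (e n j))"
      by (simp add: u_def blinfun.sum_right clinear_opD[OF star_rep_l1D(1)[OF rep delta_l1 delta_l1]])
    finally show ?thesis by (simp only: sum.swap[of _ S J])
  qed
  have "(\<lambda>n. \<Sum>j\<in>J. \<Sum>s\<in>S. c j *\<^sub>C ((\<rho> (delta s (F s))) (e n j)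
      - apply_bcontfun (F s) (\<theta> (- (j + s)) z) *\<^sub>C e n (j + s))) \<longlonglongrightarrow> (\<Sum>j\<in>J. \<Sum>s\<in>S. c j *\<^sub>C 0)"
    by (intro tendsto_sum bounded_linear.tendsto[OF bounded_linear_scaleC] lim)
  then have d: "(\<lambda>n. \<rho> F (u n) - v n) \<longlonglongrightarrow> 0"
    by (simp add: \<rho>u v sum_subtractf complex_vector.scale_right_diff_distrib)
  have "norm (v n) \<le> norm (\<rho> F) * sqrt C + norm (\<rho> F (u n) - v n)" for n
  proof -
    have "norm (v n) \<le> norm (\<rho> F (u n)) + norm (\<rho> F (u n) - v n)"
      using norm_triangle_ineq4[of "\<rho> F (u n)" "\<rho> F (u n) - v n"] by simp
    then show ?thesis using norm_blinfun[of "\<rho> F" "u n"] by (simp add: un)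
  qed
  then have "sqrt (\<Sum>g\<in>G. (cmod (m g))\<^sup>2) \<le> norm (\<rho> F) * sqrt C + norm (\<rho> F (u n) - v n)" for n
    by (simp add: vn)
  moreover have "(\<lambda>n. norm (\<rho> F) * sqrt C + norm (\<rho> F (u n) - v n)) \<longlonglongrightarrow> norm (\<rho> F) * sqrt C + 0"
    by (intro tendsto_intros tendsto_norm_zero d)
  ultimately have "sqrt (\<Sum>g\<in>G. (cmod (m g))\<^sup>2) \<le> norm (\<rho> F) * sqrt C"
    by (intro LIMSEQ_le_const[where X = "\<lambda>n. norm (\<rho> F) * sqrt C + norm (\<rho> F (u n) - v n)"]) auto
  then have "(sqrt (\<Sum>g\<in>G. (cmod (m g))\<^sup>2))\<^sup>2 \<le> (norm (\<rho> F) * sqrt C)\<^sup>2"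
    by (intro power_mono) (auto intro: sum_nonneg)
  then have "(\<Sum>g\<in>G. (cmod (m g))\<^sup>2) \<le> (norm (\<rho> F))\<^sup>2 * C"
    by (simp add: power_mult_distrib sum_nonneg C_def)
  moreover have "(\<Sum>g\<in>B. (cmod (m g))\<^sup>2) \<le> (\<Sum>g\<in>G. (cmod (m g))\<^sup>2)"
    using G by (intro sum_mono2) (auto simp: G_def)
  ultimately show ?thesis by (simp add: m_def C_def)
qed

end

text \<open>
  The Folner condition: for every finite \<open>S\<close> there are finite sets \<open>B\<close> such that \<open>B - S\<close> is not much
  larger than \<open>B\<close>.
\<close>

locale amenable_action = point_action +
  assumes folner: "finite (S :: 'a set) \<Longrightarrow> 0 < \<epsilon> \<Longrightarrow>
    \<exists>B. finite B \<and> B \<noteq> {} \<and> real (card ((\<lambda>(b, s). b - s) ` (B \<times> S))) \<le> (1 + \<epsilon>) * real (card B)"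
begin

text \<open>
  With \<open>V\<^sub>g = \<rho>(\<delta>\<^sub>g \<otimes> 1)\<close> and \<open>x\<^sub>j = V\<^sub>-\<^sub>j \<xi>\<close>, the vectors \<open>V\<^sub>-\<^sub>g \<rho>(F) \<xi>\<close> arise from \<open>(x\<^sub>j)\<close> by the matrix with
  entries \<open>\<alpha>\<^sub>-\<^sub>g(F(g - j))\<close>.  They all have the norm of \<open>\<rho>(F) \<xi>\<close>.  Summing over a Folner set \<open>B\<close>, the
  bound on the matrix gives \<open>|B| \<parallel>\<rho>(F)\<xi>\<parallel>\<^sup>2 \<le> C\<^sup>2 |B - S| \<parallel>\<xi>\<parallel>\<^sup>2\<close>.
\<close>

lemma orbit_bound_dominates:
  fixes \<rho> :: "('a \<Rightarrow> 'b \<Rightarrow>\<^sub>C complex) \<Rightarrow> 'h::complex_hilbert \<Rightarrow>\<^sub>L 'h"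
  assumes rep: "star_rep (l1_alg \<alpha>) \<rho>" and S: "finite S" "\<And>s. s \<notin> S \<Longrightarrow> F s = 0" and C: "0 \<le> C"
    and bound: "\<And>z B J c. finite B \<Longrightarrow> finite J \<Longrightarrow>
      (\<Sum>g\<in>B. (cmod (\<Sum>j\<in>J. apply_bcontfun (F (g - j)) (\<theta> (- g) z) * c j))\<^sup>2) \<le> C\<^sup>2 * (\<Sum>j\<in>J. (cmod (c j))\<^sup>2)"
  shows "norm (\<rho> F) \<le> C"
proof (rule norm_blinfun_bound[OF C])
  fix \<xi>
  note D = star_rep_l1D[OF rep]
  define V where "V g = \<rho> (delta g unit_fun)" for g
  define \<pi> where "\<pi> f = \<rho> (delta 0 f)" for f
  have comp: "\<rho> (delta s f) o\<^sub>L \<rho> (delta t k) = \<rho> (delta (s + t) (f * \<alpha> s k))" for s t f k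
    by (simp add: smult_delta flip: D(4)[OF delta_l1 delta_l1])
  have adj: "is_adjoint (\<rho> (delta s f)) (\<rho> (delta (- s) (star (\<alpha> (- s) f))))" for s f
    using D(5)[OF delta_l1 delta_l1, of s f] sstar_delta[of s f] by simp
  have rep\<pi>: "star_rep cstar_alg \<pi>"
  proof -
    have "delta (0::'a) (f + g) = (\<lambda>s. delta 0 f s + delta 0 g s)" "delta (0::'a) (c *\<^sub>C f) = (\<lambda>s. c *\<^sub>C delta 0 f s)"
      for f g :: "'b \<Rightarrow>\<^sub>C complex" and c by (auto simp: delta_apply)
    then show ?thesis
      unfolding star_rep_def cstar_alg_def \<pi>_def
      using adj[of 0] by (simp add: D[OF delta_l1 delta_l1] comp)
  qed
  have contr: "norm (V g x) \<le> norm x" for g x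
  proof -
    have "norm (V g x) \<le> norm (V g) * norm x" by (rule norm_blinfun)
    also have "norm (V g) \<le> norm (unit_fun :: 'b \<Rightarrow>\<^sub>C complex)"
      using star_rep_l1_contractive[OF rep delta_l1, of g unit_fun] by (simp add: V_def l1norm_delta)
    also have "norm (unit_fun :: 'b \<Rightarrow>\<^sub>C complex) \<le> 1" by (rule norm_bound) simp
    finally show ?thesis by (simp add: mult_right_mono)
  qed
  define y where "y = \<rho> F \<xi>"
  define x where "x j = (V (- j)) \<xi>" for j
  have y: "y = (\<Sum>s\<in>S. (\<rho> (delta s (F s))) \<xi>)"
    by (simp add: y_def star_rep_finite_support[OF rep S] blinfun.sum_left)
  have ny: "norm ((V (- g)) y) = norm y" for g
  proof (rule order_antisym[OF contr])
    have "V g ((V (- g)) y) = y"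
      using arg_cong[OF comp[of 0 unit_fun], of "\<lambda>T. blinfun_apply T \<xi>"] comp[of g unit_fun "- g" unit_fun]
      unfolding y V_def blinfun.sum_right
      by (simp flip: blinfun_apply_blinfun_compose add: comp)
    then show "norm y \<le> norm ((V (- g)) y)" using contr[of g "(V (- g)) y"] by simp
  qed
  have le: "(norm y)\<^sup>2 \<le> C\<^sup>2 * (norm \<xi>)\<^sup>2 * (1 + \<epsilon>)" if "0 < \<epsilon>" for \<epsilon>
  proof -
    obtain B where B: "finite B" "B \<noteq> {}" "real (card ((\<lambda>(b, s). b - s) ` (B \<times> S))) \<le> (1 + \<epsilon>) * real (card B)"
      using folner[OF S(1) \<open>0 < \<epsilon>\<close>] by blast
    define J where "J = (\<lambda>(b, s). b - s) ` (B \<times> S)"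
    have J: "finite J" using B(1) S(1) by (simp add: J_def)
    have Vy: "(V (- g)) y = (\<Sum>j\<in>J. (\<pi> (\<alpha> (- g) (F (g - j)))) (x j))" if g: "g \<in> B" for g
    proof -
      have "(V (- g)) y = (\<Sum>s\<in>S. (\<pi> (\<alpha> (- g) (F s))) (x (g - s)))"
        unfolding y V_def \<pi>_def x_def blinfun.sum_right
        by (simp flip: blinfun_apply_blinfun_compose add: comp algebra_simps)
      also have "\<dots> = (\<Sum>j\<in>(\<lambda>s. g - s) ` S. (\<pi> (\<alpha> (- g) (F (g - j)))) (x j))"
        by (subst sum.reindex) (auto simp: inj_on_def)
      also have "\<dots> = (\<Sum>j\<in>J. (\<pi> (\<alpha> (- g) (F (g - j)))) (x j))"
      proof (rule sum.mono_neutral_left[OF J])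
        show "(\<lambda>s. g - s) ` S \<subseteq> J" using g by (auto simp: J_def)
        show "\<forall>j\<in>J - (\<lambda>s. g - s) ` S. (\<pi> (\<alpha> (- g) (F (g - j)))) (x j) = 0"
        proof
          fix j assume "j \<in> J - (\<lambda>s. g - s) ` S"
          then have "g - j \<notin> S" by (force simp: image_iff)
          then show "(\<pi> (\<alpha> (- g) (F (g - j)))) (x j) = 0"
            by (simp add: S(2) star_rep_zero[OF rep\<pi>])
        qed
      qed
      finally show ?thesis .
    qed
    have "real (card B) * (norm y)\<^sup>2 = (\<Sum>g\<in>B. (norm ((V (- g)) y))\<^sup>2)" by (simp add: ny)
    also have "\<dots> = (\<Sum>g\<in>B. (norm (\<Sum>j\<in>J. (\<pi> (\<alpha> (- g) (F (g - j)))) (x j)))\<^sup>2)"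
      by (simp add: Vy)
    also have "\<dots> \<le> C\<^sup>2 * (\<Sum>j\<in>J. (norm (x j))\<^sup>2)"
      by (rule pointwise_matrix_bound[OF compact rep\<pi> B(1) J]) (use bound[OF B(1) J] in auto)
    also have "\<dots> \<le> C\<^sup>2 * (\<Sum>j\<in>J. (norm \<xi>)\<^sup>2)"
      unfolding x_def by (intro mult_left_mono sum_mono power_mono contr) auto
    also have "\<dots> \<le> C\<^sup>2 * (norm \<xi>)\<^sup>2 * ((1 + \<epsilon>) * real (card B))"
      using mult_left_mono[OF B(3), of "C\<^sup>2 * (norm \<xi>)\<^sup>2"] by (simp add: J_def mult.commute mult.left_commute)
    finally have "real (card B) * (norm y)\<^sup>2 \<le> real (card B) * (C\<^sup>2 * (norm \<xi>)\<^sup>2 * (1 + \<epsilon>))"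
      by (simp add: mult.commute mult.left_commute)
    moreover have "0 < card B" using B by (simp add: card_gt_0_iff)
    ultimately show ?thesis by simp
  qed
  have "(norm y)\<^sup>2 \<le> C\<^sup>2 * (norm \<xi>)\<^sup>2"
  proof (rule tendsto_lowerbound)
    show "((\<lambda>\<epsilon>. C\<^sup>2 * (norm \<xi>)\<^sup>2 * (1 + \<epsilon>)) \<longlongrightarrow> C\<^sup>2 * (norm \<xi>)\<^sup>2) (at_right 0)"
      by (auto intro!: tendsto_eq_intros)
    show "\<forall>\<^sub>F \<epsilon> in at_right 0. (norm y)\<^sup>2 \<le> C\<^sup>2 * (norm \<xi>)\<^sup>2 * (1 + \<epsilon>)"
      using le by (simp add: eventually_at_right_less eventually_mono[OF eventually_at_right_less])
  qed simp
  then show "norm (\<rho> F \<xi>) \<le> C * norm \<xi>"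
    unfolding y_def[symmetric] power_mult_distrib[symmetric] by (rule power2_le_imp_le) (use C in simp)
qed

text \<open>
  Different representations may serve for different points.  This is used with one representation that
  localizes everywhere, and with the family of the orbit representations.
\<close>

theorem localizing_family_dominates:
  fixes \<rho> :: "('a \<Rightarrow> 'b \<Rightarrow>\<^sub>C complex) \<Rightarrow> 'h::complex_hilbert \<Rightarrow>\<^sub>L 'h"
    and L :: "'b \<Rightarrow> ('a \<Rightarrow> 'b \<Rightarrow>\<^sub>C complex) \<Rightarrow> 'k::complex_hilbert \<Rightarrow>\<^sub>L 'k"
  assumes rep: "star_rep (l1_alg \<alpha>) \<rho>"
    and L: "\<And>z. star_rep (l1_alg \<alpha>) (L z)" "\<And>z. localizes (L z) z"
    and F: "F \<in> l1" and C: "\<And>z. norm (L z F) \<le> C"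
  shows "norm (\<rho> F) \<le> C"
proof (rule field_le_epsilon)
  fix e :: real assume "0 < e"
  obtain S K where S: "finite S" "\<And>s. K s = (if s \<in> S then F s else 0)" "K \<in> l1"
    "l1norm (\<lambda>s. F s - K s) \<le> e / 2"
    by (rule l1_finite_approx[OF F half_gt_zero[OF \<open>0 < e\<close>]]) blast
  have d: "norm (\<tau> F - \<tau> K) \<le> e / 2" if "star_rep (l1_alg \<alpha>) \<tau>" for \<tau> :: "('a \<Rightarrow> 'b \<Rightarrow>\<^sub>C complex) \<Rightarrow> 'l::complex_hilbert \<Rightarrow>\<^sub>L 'l"
    using star_rep_l1_dist[OF that F S(3)] S(4) by linarith
  have LK: "norm (L z K) \<le> C + e / 2" for z
    using C[of z] d[OF L(1)[of z]] norm_triangle_ineq2[of "L z K" "L z F"] by (simp add: norm_minus_commute)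
  have C0: "0 \<le> C + e / 2" using LK norm_ge_zero order_trans by blast
  have "norm (\<rho> K) \<le> C + e / 2"
  proof (rule orbit_bound_dominates[OF rep S(1) _ C0])
    fix z and B J :: "'a set" and c :: "'a \<Rightarrow> complex" assume fin: "finite B" "finite J"
    have "(\<Sum>g\<in>B. (cmod (\<Sum>j\<in>J. apply_bcontfun (K (g - j)) (\<theta> (- g) z) * c j))\<^sup>2)
        \<le> (norm (L z K))\<^sup>2 * (\<Sum>j\<in>J. (cmod (c j))\<^sup>2)"
      by (rule localized_matrix_bound[OF L S(1) _ fin]) (simp add: S(2))
    also have "\<dots> \<le> (C + e / 2)\<^sup>2 * (\<Sum>j\<in>J. (cmod (c j))\<^sup>2)"
      by (intro mult_right_mono power_mono LK) (auto intro: sum_nonneg)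
    finally show "(\<Sum>g\<in>B. (cmod (\<Sum>j\<in>J. apply_bcontfun (K (g - j)) (\<theta> (- g) z) * c j))\<^sup>2)
        \<le> (C + e / 2)\<^sup>2 * (\<Sum>j\<in>J. (cmod (c j))\<^sup>2)" .
  qed (simp add: S(2))
  then show "norm (\<rho> F) \<le> C + e"
    using d[OF rep] norm_triangle_ineq2[of "\<rho> F" "\<rho> K"] by simp
qed

end

subsection \<open>Induced representations\<close>

context point_action
begin

context
  fixes \<pi> :: "('z \<Rightarrow>\<^sub>C complex) \<Rightarrow> 'h::complex_hilbert \<Rightarrow>\<^sub>L 'h" and \<iota> :: "'g \<Rightarrow> 'i"
  assumes rep: "star_rep cstar_alg \<pi>" and \<iota>: "inj \<iota>"
begin

text \<open>
  The representation of the crossed product induced from \<open>\<pi>\<close>, carried by the coordinates in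
  \<open>range \<iota>\<close>, a copy of \<open>G\<close>.  The functions act by \<open>0\<close> on the other coordinates, whereas the shifts leave
  them fixed, so that the shifts are unitary.  For \<open>\<iota> = id\<close> this is the canonical representation; for the
  evaluation at a point, it is the orbit representation.
\<close>

definition induced_fun :: "('z \<Rightarrow>\<^sub>C complex) \<Rightarrow> ('i, 'h) l2 \<Rightarrow>\<^sub>L ('i, 'h) l2"
  where "induced_fun f = weighted_comp id (\<lambda>i. if i \<in> range \<iota> then \<pi> (\<alpha> (- inv \<iota> i) f) else 0)"

definition induced_index :: "'g \<Rightarrow> 'i \<Rightarrow> 'i"
  where "induced_index s i = (if i \<in> range \<iota> then \<iota> (inv \<iota> i - s) else i)"

definition induced_shift :: "'g \<Rightarrow> ('i, 'h) l2 \<Rightarrow>\<^sub>L ('i, 'h) l2"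
  where "induced_shift s = weighted_comp (induced_index s) (\<lambda>_. id_blinfun)"

lemma induced_index_add: "induced_index s (induced_index t i) = induced_index (s + t) i"
  using \<iota> by (auto simp: induced_index_def algebra_simps)

lemma induced_index_zero: "induced_index 0 i = i"
  using \<iota> by (auto simp: induced_index_def f_inv_into_f)

lemma bij_induced_index: "bij (induced_index s)"
  by (rule bij_betw_byWitness[where f' = "induced_index (- s)"])
    (auto simp: induced_index_add induced_index_zero)

lemma induced_fun_apply: "l2_apply (induced_fun f x) i
    = (if i \<in> range \<iota> then \<pi> (\<alpha> (- inv \<iota> i) f) (l2_apply x i) else 0)"
proof -
  define w where "w i = (if i \<in> range \<iota> then \<pi> (\<alpha> (- inv \<iota> i) f) else 0)" for i
  have w: "norm (w i) \<le> norm f" for i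
    using order_trans[OF star_rep_contractive[OF rep] norm_\<alpha>_le] by (simp add: w_def)
  have "l2_apply (weighted_comp id w x) i = w i (l2_apply x (id i))"
    by (rule weighted_comp_apply[OF inj_on_id w])
  moreover have "induced_fun f = weighted_comp id w" by (simp add: induced_fun_def w_def[abs_def])
  ultimately show ?thesis by (simp add: w_def)
qed

lemma induced_shift_apply: "l2_apply (induced_shift s x) i = l2_apply x (induced_index s i)"
  using weighted_comp_apply[OF bij_is_inj[OF bij_induced_index], of "\<lambda>_. id_blinfun", OF order_refl]
  by (simp add: induced_shift_def)

lemma induced_fun_single: "induced_fun f (l2_single (\<iota> j) h) = l2_single (\<iota> j) (\<pi> (\<alpha> (- j) f) h)"
  using \<iota> by (intro l2_eqI) (auto simp: induced_fun_apply l2_single_apply)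

lemma induced_shift_single: "induced_shift s (l2_single (\<iota> j) h) = l2_single (\<iota> (j + s)) h"
  using \<iota> by (intro l2_eqI) (auto simp: induced_shift_apply induced_index_def l2_single_apply inj_eq)

lemma induced_covariant_pair: "covariant_pair induced_fun induced_shift"
proof -
  note r = star_rep_cstarD[OF rep]
  have "is_adjoint (induced_fun f) (induced_fun (star f))" for f
    unfolding is_adjoint_def cinner_l2_def
    by (auto intro!: infsum_cong simp: induced_fun_apply is_adjointD[OF r(5)])
  moreover have "clinear_op (induced_fun f)" for f
    by (auto simp: clinear_op_def intro!: l2_eqI simp: induced_fun_apply clinear_opD[OF r(1)])
  moreover have "induced_fun (f + g) = induced_fun f + induced_fun g" "induced_fun (c *\<^sub>C f) = c *\<^sub>C induced_fun f"
    "induced_fun (f * g) = induced_fun f o\<^sub>L induced_fun g" for f g c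
    by (auto intro!: blinfun_eqI l2_eqI simp: induced_fun_apply blinfun.add_left r)
  ultimately have "star_rep cstar_alg induced_fun"
    by (simp add: star_rep_def cstar_alg_def)
  moreover have "clinear_op (induced_shift s)" for s
    by (auto simp: clinear_op_def intro!: l2_eqI simp: induced_shift_apply)
  moreover have "is_adjoint (induced_shift s) (induced_shift (- s))" for s
    unfolding is_adjoint_def cinner_l2_def
  proof (intro allI)
    fix x y :: "('i, 'h) l2"
    have "(\<Sum>\<^sub>\<infinity>i. cinner (l2_apply (induced_shift s x) i) (l2_apply y i))
        = (\<Sum>\<^sub>\<infinity>i. cinner (l2_apply x (induced_index s i)) (l2_apply y (induced_index (- s) (induced_index s i))))"
      by (simp add: induced_shift_apply induced_index_add induced_index_zero)
    also have "\<dots> = (\<Sum>\<^sub>\<infinity>i. cinner (l2_apply x i) (l2_apply y (induced_index (- s) i)))"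
      by (rule infsum_reindex_bij_betw[OF bij_induced_index])
    finally show "(\<Sum>\<^sub>\<infinity>i. cinner (l2_apply (induced_shift s x) i) (l2_apply y i))
        = (\<Sum>\<^sub>\<infinity>i. cinner (l2_apply x i) (l2_apply (induced_shift (- s) y) i))"
      by (simp add: induced_shift_apply)
  qed
  moreover have "induced_shift 0 = id_blinfun" "induced_shift s o\<^sub>L induced_shift t = induced_shift (s + t)" for s t
    by (auto intro!: blinfun_eqI l2_eqI simp: induced_shift_apply induced_index_zero induced_index_add add.commute)
  moreover have "induced_shift s o\<^sub>L induced_fun f = induced_fun (\<alpha> s f) o\<^sub>L induced_shift s" for s f
    using \<iota> by (auto intro!: blinfun_eqI l2_eqI
        simp: induced_shift_apply induced_fun_apply induced_index_def \<alpha>_add[symmetric])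
  ultimately show ?thesis by (simp add: covariant_pair_def)
qed

text \<open>
  Vectors \<open>h n\<close> that approximately diagonalize \<open>\<pi>\<close> at \<open>z\<close> give the localized family \<open>\<delta>\<^sub>j \<otimes> h n\<close>.
\<close>

context
  fixes z :: 'z and h :: "nat \<Rightarrow> 'h"
  assumes h: "norm (h n) = 1" "(\<lambda>n. \<pi> f (h n) - apply_bcontfun f z *\<^sub>C h n) \<longlonglongrightarrow> 0"
begin

lemma induced_localized_singles:
  "(\<lambda>n. induced_fun f (l2_single (\<iota> j) (h n)) - f (\<theta> (- j) z) *\<^sub>C l2_single (\<iota> j) (h n)) \<longlonglongrightarrow> 0"
proof -
  have "induced_fun f (l2_single (\<iota> j) (h n)) - f (\<theta> (- j) z) *\<^sub>C l2_single (\<iota> j) (h n)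
      = l2_single (\<iota> j) (\<pi> (\<alpha> (- j) f) (h n) - \<alpha> (- j) f z *\<^sub>C h n)" for n
    unfolding induced_fun_single by (rule l2_eqI) (simp add: l2_single_apply)
  then show ?thesis
    using bounded_linear.tendsto[OF bounded_linear_l2_single h(2)[of "\<alpha> (- j) f"], of "\<iota> j"]
    by (simp add: l2_single_zero)
qed

lemma induced_localizes: "localizes (integrated_form induced_fun induced_shift) z"
proof -
  have "orthonormal (\<lambda>j. l2_single (\<iota> j) (h n)) UNIV" for n
    using h(1)[of n] \<iota> by (auto simp: orthonormal_def cinner_l2_single l2_single_apply cinner_self inj_eq)
  moreover have "(\<lambda>n. integrated_form induced_fun induced_shift (delta s f) (l2_single (\<iota> j) (h n))
      - f (\<theta> (- (j + s)) z) *\<^sub>C l2_single (\<iota> (j + s)) (h n)) \<longlonglongrightarrow> 0" for s f j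
    using induced_localized_singles[of f "j + s"]
    by (simp only: integrated_delta[OF induced_covariant_pair] blinfun_apply_blinfun_compose induced_shift_single)
  ultimately show ?thesis
    unfolding localizes_def by (intro exI[of _ "\<lambda>n j. l2_single (\<iota> j) (h n)"]) simp
qed

end

lemma induced_nondegenerate:
  assumes unital: "\<pi> unit_fun = id_blinfun"
  shows "nondegenerate_rep_on {x. \<forall>i. i \<notin> range \<iota> \<longrightarrow> l2_apply x i = 0} (l1_alg \<alpha>)
    (integrated_form induced_fun induced_shift)"
proof -
  define S where "S = {x :: ('i, 'h) l2. \<forall>i. i \<notin> range \<iota> \<longrightarrow> l2_apply x i = 0}"
  let ?\<rho> = "integrated_form induced_fun induced_shift"
  have sub: "csubspace S" by (auto simp: complex_vector.subspace_def S_def)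
  have cont: "bounded_linear (\<lambda>x :: ('i, 'h) l2. l2_apply x i)" for i
    by (rule bounded_linear_intro[where K = 1]) (auto simp: norm_l2_apply_le)
  have "S = (\<Inter>i\<in>- range \<iota>. {x. l2_apply x i = 0})" by (auto simp: S_def)
  moreover have "closed {x :: ('i, 'h) l2. l2_apply x i = 0}" for i
    by (intro closed_Collect_eq linear_continuous_on[OF cont]) auto
  ultimately have cl: "closed S" by auto
  have entry: "l2_apply (?\<rho> F x) i = (\<Sum>\<^sub>\<infinity>s. l2_apply ((induced_fun (F s) o\<^sub>L induced_shift s) x) i)"
    if "F \<in> l1" for F x i
    unfolding integrated_apply[OF induced_covariant_pair that]
    by (rule infsum_bounded_linear[OF cont integrated_apply_summable[OF induced_covariant_pair that], symmetric])
  have inS: "?\<rho> F x \<in> S" if "F \<in> l1" for F x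
    unfolding S_def by (auto simp: entry[OF that] induced_fun_apply)
  have perp: "?\<rho> F x = 0" if F: "F \<in> l1" and x: "\<forall>y\<in>S. cinner x y = 0" for F x
  proof (rule l2_eqI)
    fix i
    have "l2_apply x (\<iota> g) = 0" for g
    proof (rule cinner_ext)
      fix y
      have "l2_single (\<iota> g) y \<in> S" by (auto simp: S_def l2_single_apply)
      then have "cinner (l2_single (\<iota> g) y) x = 0" using x by (metis cinner_commute complex_cnj_zero)
      then show "cinner (l2_apply x (\<iota> g)) y = cinner 0 y"
        by (simp add: cinner_l2_single) (metis cinner_commute complex_cnj_zero)
    qed
    then show "l2_apply (?\<rho> F x) i = l2_apply 0 i"
      by (cases "i \<in> range \<iota>") (simp_all add: entry[OF F] induced_fun_apply induced_shift_apply induced_index_def)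
  qed
  have unit: "?\<rho> (delta 0 unit_fun) x = x" if "x \<in> S" for x
    using that unital unfolding integrated_delta[OF induced_covariant_pair]
    by (auto intro!: l2_eqI simp: S_def induced_fun_apply induced_shift_apply induced_index_zero)
  have "closure (cspan {?\<rho> F x | F x. F \<in> l1 \<and> x \<in> S}) = S"
  proof
    have "cspan {?\<rho> F x | F x. F \<in> l1 \<and> x \<in> S} \<subseteq> S"
      using inS by (intro complex_vector.span_minimal sub) auto
    then show "closure (cspan {?\<rho> F x | F x. F \<in> l1 \<and> x \<in> S}) \<subseteq> S"
      using cl by (rule closure_minimal)
    show "S \<subseteq> closure (cspan {?\<rho> F x | F x. F \<in> l1 \<and> x \<in> S})"
    proof
      fix x assume x: "x \<in> S"
      then have "?\<rho> (delta 0 unit_fun) x \<in> {?\<rho> F x | F x. F \<in> l1 \<and> x \<in> S}"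
        using delta_l1[of 0 unit_fun] by blast
      then have "x \<in> {?\<rho> F x | F x. F \<in> l1 \<and> x \<in> S}" by (simp only: unit[OF x])
      then show "x \<in> closure (cspan {?\<rho> F x | F x. F \<in> l1 \<and> x \<in> S})"
        by (rule closure_subset[THEN subsetD, OF complex_vector.span_base])
    qed
  qed
  then show ?thesis
    unfolding nondegenerate_rep_on_def S_def[symmetric]
    using sub cl inS perp integrated_star_rep[OF induced_covariant_pair] by simp
qed

end

end

definition evaluation :: "'z::metric_space \<Rightarrow> ('z \<Rightarrow>\<^sub>C complex) \<Rightarrow> complex \<Rightarrow>\<^sub>L complex"
  where "evaluation z f = apply_bcontfun f z *\<^sub>C id_blinfun"

lemma evaluation_apply: "evaluation z f c = f z * c"
  by (simp add: evaluation_def scaleC_complex_def)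

lemma evaluation_star_rep: "star_rep cstar_alg (evaluation z)"
  unfolding star_rep_def cstar_alg_def clinear_op_def is_adjoint_def
  by (auto intro!: blinfun_eqI simp: evaluation_apply blinfun.add_left scaleC_complex_def
      cinner_complex_def star_complex_def algebra_simps)

context amenable_action
begin

text \<open>
  Every representation is dominated by one that localizes at every point; conversely, such a
  representation is dominated by the orbit representations, which live on subspaces of the Hilbert
  space over which the enveloping norm is a supremum.
\<close>

theorem enveloping_norm_localizing:
  fixes \<Lambda> :: "('a \<Rightarrow> 'b \<Rightarrow>\<^sub>C complex) \<Rightarrow> 'k::complex_hilbert \<Rightarrow>\<^sub>L 'k"
  assumes rep: "star_rep (l1_alg \<alpha>) \<Lambda>" and loc: "\<And>z. localizes \<Lambda> z" and F: "F \<in> l1"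
  shows "enveloping_norm (l1_alg \<alpha>) F = norm (\<Lambda> F)"
proof -
  define N where "N = {norm (\<rho> F) | S (\<rho> :: ('a \<Rightarrow> 'b \<Rightarrow>\<^sub>C complex) \<Rightarrow>
      ('a \<Rightarrow> 'b \<Rightarrow>\<^sub>C complex, complex) l2 \<Rightarrow>\<^sub>L ('a \<Rightarrow> 'b \<Rightarrow>\<^sub>C complex, complex) l2).
      nondegenerate_rep_on S (l1_alg \<alpha>) \<rho>}"
  define \<iota> where "\<iota> = (\<lambda>s :: 'a. delta s (unit_fun :: 'b \<Rightarrow>\<^sub>C complex))"
  have unit0: "(unit_fun :: 'b \<Rightarrow>\<^sub>C complex) \<noteq> 0"
    by (metis const_bcontfun.rep_eq zero_bcontfun.rep_eq zero_neq_one)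
  have \<iota>: "inj \<iota>"
  proof (rule injI)
    fix s t assume "\<iota> s = \<iota> t"
    then have "\<iota> s s = \<iota> t s" by simp
    then show "s = t" using unit0 by (simp add: \<iota>_def delta_apply split: if_splits)
  qed
  define \<rho> where "\<rho> z = integrated_form (induced_fun (evaluation z) \<iota>) (induced_shift \<iota>)" for z
  have "evaluation z unit_fun = id_blinfun" for z :: 'b
    by (rule blinfun_eqI) (simp add: evaluation_apply)
  note nondeg = induced_nondegenerate[OF evaluation_star_rep \<iota> this]
  have "localizes (\<rho> z) z" for z
    unfolding \<rho>_def by (rule induced_localizes[OF evaluation_star_rep \<iota>, where h = "\<lambda>_. 1"])
      (simp_all add: evaluation_apply scaleC_complex_def)
  note \<rho> = integrated_star_rep[OF induced_covariant_pair[OF evaluation_star_rep \<iota>]] this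
  have in_N: "norm (\<rho> z F) \<in> N" for z
    unfolding N_def \<rho>_def using nondeg[of z] by blast
  have le: "x \<le> norm (\<Lambda> F)" if "x \<in> N" for x
    using that localizing_family_dominates[of _ "\<lambda>_. \<Lambda>" F "norm (\<Lambda> F)"] rep loc F
    unfolding N_def nondegenerate_rep_on_def by auto
  have "norm (\<rho> z F) \<le> Sup N" for z
    using in_N le by (intro cSup_upper bdd_aboveI) auto
  then have "norm (\<Lambda> F) \<le> Sup N"
    using \<rho> by (intro localizing_family_dominates[OF rep _ _ F, of \<rho>]) (auto simp: \<rho>_def)
  moreover have "Sup N \<le> norm (\<Lambda> F)"
    using in_N le by (intro cSup_least) auto
  ultimately show ?thesis by (simp add: enveloping_norm_def N_def)
qed

end

section \<open>Completions\<close>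

text \<open>
  When the seminorm of a \<open>*\<close>-algebra is the norm of its image under a representation \<open>\<Lambda>\<close> on a Hilbert
  space, a Cauchy sequence is determined up to null sequences by the limit of its image.
\<close>

locale isometric_star_rep =
  fixes A :: "'a star_alg" and \<Lambda> :: "'a \<Rightarrow> 'h::complex_hilbert \<Rightarrow>\<^sub>L 'h"
  assumes rep: "star_rep A \<Lambda>"
    and norm_eq: "a \<in> carr A \<Longrightarrow> snorm A a = norm (\<Lambda> a)"
    and sadd_carr: "a \<in> carr A \<Longrightarrow> b \<in> carr A \<Longrightarrow> sadd A a b \<in> carr A"
    and sscale_carr: "a \<in> carr A \<Longrightarrow> sscale A c a \<in> carr A"
    and smult_carr: "a \<in> carr A \<Longrightarrow> b \<in> carr A \<Longrightarrow> smult A a b \<in> carr A"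
    and sstar_carr: "a \<in> carr A \<Longrightarrow> sstar A a \<in> carr A"
begin

lemma repD:
  assumes "a \<in> carr A" "b \<in> carr A"
  shows "\<Lambda> (sadd A a b) = \<Lambda> a + \<Lambda> b" "\<Lambda> (sscale A c a) = c *\<^sub>C \<Lambda> a"
    "\<Lambda> (smult A a b) = \<Lambda> a o\<^sub>L \<Lambda> b" "is_adjoint (\<Lambda> a) (\<Lambda> (sstar A a))"
  using rep assms by (auto simp: star_rep_def)

lemma rep_sscale: "a \<in> carr A \<Longrightarrow> \<Lambda> (sscale A c a) = c *\<^sub>C \<Lambda> a"
  by (rule repD(2))

definition limit_class :: "('h \<Rightarrow>\<^sub>L 'h) \<Rightarrow> (nat \<Rightarrow> 'a) set"
  where "limit_class T = {u. (\<forall>n. u n \<in> carr A) \<and> (\<lambda>n. \<Lambda> (u n)) \<longlonglongrightarrow> T}"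

lemma sdist_eq:
  assumes "a \<in> carr A" "b \<in> carr A"
  shows "sdist A a b = dist (\<Lambda> a) (\<Lambda> b)"
  using repD(1)[OF assms(1) sscale_carr[OF assms(2)], of "- 1"] repD(2)[OF assms(2,2), of "- 1"] assms
  by (simp add: sdist_def norm_eq sadd_carr sscale_carr dist_norm flip: uminus_eq_scaleC)

lemma cauchy_seqs_eq: "cauchy_seqs A = {u. (\<forall>n. u n \<in> carr A) \<and> Cauchy (\<lambda>n. \<Lambda> (u n))}"
  by (auto simp: cauchy_seqs_def Cauchy_def sdist_eq)

lemma limit_class_cauchy: "u \<in> limit_class T \<Longrightarrow> u \<in> cauchy_seqs A"
  by (auto simp: limit_class_def cauchy_seqs_eq intro: LIMSEQ_imp_Cauchy)

lemma seq_class_eq: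
  assumes u: "u \<in> limit_class T"
  shows "seq_class A u = limit_class T"
proof (intro set_eqI iffI)
  fix v assume "v \<in> seq_class A u"
  then have v: "\<forall>n. v n \<in> carr A" "(\<lambda>n. sdist A (u n) (v n)) \<longlonglongrightarrow> 0"
    by (auto simp: seq_class_def null_rel_def cauchy_seqs_eq)
  have "(\<lambda>n. dist (\<Lambda> (u n)) (\<Lambda> (v n))) \<longlonglongrightarrow> 0"
    using v u by (simp add: sdist_eq limit_class_def)
  then have "(\<lambda>n. \<Lambda> (u n) - \<Lambda> (v n)) \<longlonglongrightarrow> 0" by (simp add: dist_norm tendsto_norm_zero_iff)
  then have "(\<lambda>n. \<Lambda> (u n) - (\<Lambda> (u n) - \<Lambda> (v n))) \<longlonglongrightarrow> T - 0"
    using u by (intro tendsto_diff) (auto simp: limit_class_def)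
  then show "v \<in> limit_class T" using v by (simp add: limit_class_def)
next
  fix v assume v: "v \<in> limit_class T"
  have "(\<lambda>n. dist (\<Lambda> (u n)) (\<Lambda> (v n))) \<longlonglongrightarrow> dist T T"
    using u v by (intro tendsto_dist) (auto simp: limit_class_def)
  then have "(\<lambda>n. sdist A (u n) (v n)) \<longlonglongrightarrow> 0"
    using u v by (simp add: sdist_eq limit_class_def)
  then show "v \<in> seq_class A u"
    using limit_class_cauchy u v by (auto simp: seq_class_def null_rel_def)
qed

lemma limit_class_nonempty:
  assumes "T \<in> closure (\<Lambda> ` carr A)"
  shows "\<exists>u. u \<in> limit_class T"
proof -
  obtain X where X: "\<And>n. X n \<in> \<Lambda> ` carr A" "X \<longlonglongrightarrow> T"
    using assms unfolding closure_sequential by blast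
  have "\<forall>n. \<exists>a. a \<in> carr A \<and> X n = \<Lambda> a" using X(1) by blast
  then obtain u where "\<And>n. u n \<in> carr A" "\<And>n. X n = \<Lambda> (u n)" by metis
  moreover from this have "X = (\<lambda>n. \<Lambda> (u n))" by blast
  ultimately show ?thesis using X(2) by (intro exI[of _ u]) (simp add: limit_class_def)
qed

lemma limit_class_closure: "u \<in> limit_class T \<Longrightarrow> T \<in> closure (\<Lambda> ` carr A)"
  unfolding limit_class_def closure_sequential by (auto intro!: exI[of _ "\<lambda>n. \<Lambda> (u n)"])

lemma limit_class_unique: "u \<in> limit_class S \<Longrightarrow> u \<in> limit_class T \<Longrightarrow> S = T"
  unfolding limit_class_def using LIMSEQ_unique by blast

lemma const_limit_class: "a \<in> carr A \<Longrightarrow> (\<lambda>_. a) \<in> limit_class (\<Lambda> a)"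
  by (simp add: limit_class_def)

lemma seq_class_const: "a \<in> carr A \<Longrightarrow> seq_class A (\<lambda>_. a) = limit_class (\<Lambda> a)"
  by (rule seq_class_eq[OF const_limit_class])

lemma carr_completion: "carr (completion A) = limit_class ` closure (\<Lambda> ` carr A)"
proof -
  have "cauchy_seqs A // null_rel A = (\<lambda>u. seq_class A u) ` cauchy_seqs A"
    by (auto simp: quotient_def seq_class_def)
  also have "\<dots> = limit_class ` closure (\<Lambda> ` carr A)"
  proof (intro set_eqI iffI)
    fix x assume "x \<in> seq_class A ` cauchy_seqs A"
    then obtain u where u: "u \<in> cauchy_seqs A" "x = seq_class A u" by blast
    then obtain T where "(\<lambda>n. \<Lambda> (u n)) \<longlonglongrightarrow> T"
      unfolding cauchy_seqs_eq Cauchy_convergent_iff convergent_def by blast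
    then have "u \<in> limit_class T" using u by (simp add: limit_class_def cauchy_seqs_eq)
    then show "x \<in> limit_class ` closure (\<Lambda> ` carr A)"
      using u limit_class_closure seq_class_eq by blast
  next
    fix x assume "x \<in> limit_class ` closure (\<Lambda> ` carr A)"
    then obtain T where T: "T \<in> closure (\<Lambda> ` carr A)" "x = limit_class T" by blast
    then obtain u where "u \<in> limit_class T" using limit_class_nonempty by blast
    then show "x \<in> seq_class A ` cauchy_seqs A"
      using T limit_class_cauchy seq_class_eq by blast
  qed
  finally show ?thesis by (simp add: completion_def)
qed

lemma UN_constant_class:
  assumes "S \<noteq> {}" and "\<And>u. u \<in> S \<Longrightarrow> f u = (K :: 'b set)"
  shows "(\<Union>u\<in>S. f u) = K"
  using assms by auto

text \<open>
  Every operation of the completion is a union over representatives of classes that do not depend on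
  the representatives, since \<open>\<Lambda>\<close> turns it into a continuous operation on operators.
\<close>

lemma completion_limit_class:
  assumes S: "S \<in> closure (\<Lambda> ` carr A)" and T: "T \<in> closure (\<Lambda> ` carr A)"
  shows "sadd (completion A) (limit_class S) (limit_class T) = limit_class (S + T)"
    and "sscale (completion A) c (limit_class S) = limit_class (c *\<^sub>C S)"
    and "smult (completion A) (limit_class S) (limit_class T) = limit_class (S o\<^sub>L T)"
    and "\<exists>S'. is_adjoint S S' \<and> sstar (completion A) (limit_class S) = limit_class S'"
    and "snorm (completion A) (limit_class S) = norm S"
proof -
  note ne = limit_class_nonempty[OF S] limit_class_nonempty[OF T]
  have ne': "limit_class S \<noteq> {}" "limit_class T \<noteq> {}" using ne by auto
  have in_carr: "\<And>u n R. u \<in> limit_class R \<Longrightarrow> u n \<in> carr A" by (simp add: limit_class_def)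
  have lim: "\<And>u R. u \<in> limit_class R \<Longrightarrow> (\<lambda>n. \<Lambda> (u n)) \<longlonglongrightarrow> R" by (simp add: limit_class_def)
  show "sadd (completion A) (limit_class S) (limit_class T) = limit_class (S + T)"
    unfolding completion_def star_alg.simps
    by (intro UN_constant_class ne' seq_class_eq)
      (auto simp: limit_class_def repD sadd_carr intro!: tendsto_add)
  show "sscale (completion A) c (limit_class S) = limit_class (c *\<^sub>C S)"
    unfolding completion_def star_alg.simps
    by (intro UN_constant_class ne' seq_class_eq)
      (auto simp: limit_class_def rep_sscale sscale_carr intro!: bounded_linear.tendsto[OF bounded_linear_scaleC])
  show "smult (completion A) (limit_class S) (limit_class T) = limit_class (S o\<^sub>L T)"
    unfolding completion_def star_alg.simps
    by (intro UN_constant_class ne' seq_class_eq)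
      (auto simp: limit_class_def repD smult_carr intro!: bounded_bilinear.tendsto[OF bounded_bilinear_blinfun_compose])
  show "snorm (completion A) (limit_class S) = norm S"
  proof -
    have "(THE r. \<forall>u\<in>limit_class S. (\<lambda>n. snorm A (u n)) \<longlonglongrightarrow> r) = norm S"
    proof (rule the_equality)
      show *: "\<forall>u\<in>limit_class S. (\<lambda>n. snorm A (u n)) \<longlonglongrightarrow> norm S"
        using in_carr lim by (auto simp: norm_eq intro!: tendsto_norm)
      fix r assume "\<forall>u\<in>limit_class S. (\<lambda>n. snorm A (u n)) \<longlonglongrightarrow> r"
      then show "r = norm S" using * ne(1) LIMSEQ_unique by blast
    qed
    then show ?thesis by (simp add: completion_def)
  qed
  \<comment> \<open>The adjoints of the members of a Cauchy sequence form a Cauchy sequence.\<close>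
  have adj_norm: "norm (\<Lambda> (sstar A a) - \<Lambda> (sstar A b)) \<le> norm (\<Lambda> a - \<Lambda> b)" if ab: "a \<in> carr A" "b \<in> carr A" for a b
  proof (rule norm_blinfun_bound)
    fix x
    have adj: "is_adjoint (\<Lambda> (sstar A a) - \<Lambda> (sstar A b)) (\<Lambda> a - \<Lambda> b)"
      using is_adjoint_sym[OF repD(4)[OF ab(1,1)]] is_adjoint_sym[OF repD(4)[OF ab(2,2)]]
      by (simp add: is_adjoint_def blinfun.diff_left cinner_diff_left cinner_diff_right)
    let ?y = "(\<Lambda> (sstar A a) - \<Lambda> (sstar A b)) x"
    have "norm ?y ^ 2 \<le> norm ((\<Lambda> a - \<Lambda> b) ?y) * norm x"
      using norm_adjoint_le[OF adj, of x] by simp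
    also have "\<dots> \<le> norm (\<Lambda> a - \<Lambda> b) * norm ?y * norm x"
      by (intro mult_right_mono norm_blinfun) auto
    finally show "norm ?y \<le> norm (\<Lambda> a - \<Lambda> b) * norm x"
      by (cases "norm ?y = 0") (auto simp: power2_eq_square algebra_simps)
  qed simp
  obtain u where u: "u \<in> limit_class S" using ne(1) by blast
  have "Cauchy (\<lambda>n. \<Lambda> (sstar A (u n)))"
  proof (rule metric_CauchyI)
    fix e :: real assume "0 < e"
    then obtain N where "\<forall>m\<ge>N. \<forall>n\<ge>N. dist (\<Lambda> (u m)) (\<Lambda> (u n)) < e"
      using LIMSEQ_imp_Cauchy[OF lim[OF u]] metric_CauchyD by blast
    then show "\<exists>M. \<forall>m\<ge>M. \<forall>n\<ge>M. dist (\<Lambda> (sstar A (u m))) (\<Lambda> (sstar A (u n))) < e"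
      using adj_norm in_carr[OF u] unfolding dist_norm by (intro exI[of _ N]) (meson le_less_trans)
  qed
  then obtain S' where S': "(\<lambda>n. \<Lambda> (sstar A (u n))) \<longlonglongrightarrow> S'"
    unfolding Cauchy_convergent_iff convergent_def by blast
  have adj: "is_adjoint S S'"
    by (rule is_adjoint_tendsto[OF lim[OF u] S']) (use in_carr[OF u] repD(4) in blast)
  have "(\<lambda>n. \<Lambda> (sstar A (v n))) \<longlonglongrightarrow> S'" if v: "v \<in> limit_class S" for v
  proof -
    have "(\<lambda>n. \<Lambda> (v n) - \<Lambda> (u n)) \<longlonglongrightarrow> 0" using tendsto_diff[OF lim[OF v] lim[OF u]] by simp
    then have "(\<lambda>n. \<Lambda> (sstar A (v n)) - \<Lambda> (sstar A (u n))) \<longlonglongrightarrow> 0"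
      by (rule Lim_null_comparison[OF _ tendsto_norm_zero, rotated])
        (use adj_norm in_carr[OF u] in_carr[OF v] in \<open>auto intro!: always_eventually\<close>)
    from tendsto_add[OF this S'] show ?thesis by simp
  qed
  then have "sstar (completion A) (limit_class S) = limit_class S'"
    unfolding completion_def star_alg.simps
    by (intro UN_constant_class ne' seq_class_eq) (auto simp: limit_class_def sstar_carr)
  with adj show "\<exists>S'. is_adjoint S S' \<and> sstar (completion A) (limit_class S) = limit_class S'" by blast
qed

lemma inj_limit_class: "inj_on limit_class (closure (\<Lambda> ` carr A))"
  using limit_class_nonempty limit_class_unique by (metis inj_onI)

theorem completion_star_iso:
  "star_iso (operator_alg (closure (\<Lambda> ` carr A))) (completion A) limit_class"
proof -
  have "limit_class (adjoint_op S) = sstar (completion A) (limit_class S)"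
    if "S \<in> closure (\<Lambda> ` carr A)" for S
    using completion_limit_class(4)[OF that that] adjoint_op_eq by metis
  then show ?thesis
    unfolding star_iso_def operator_alg_def
    using inj_limit_class by (simp add: bij_betw_def carr_completion completion_limit_class)
qed

lemma completion_closure:
  assumes D: "D \<subseteq> carr A" and "D \<noteq> {}"
  shows "{a \<in> carr (completion A). \<forall>e>0. \<exists>F\<in>D. sdist (completion A) a (seq_class A (\<lambda>_. F)) < e}
    = limit_class ` closure (\<Lambda> ` D)"
proof -
  have sd: "sdist (completion A) (limit_class S) (seq_class A (\<lambda>_. F)) = dist (\<Lambda> F) S"
    if S: "S \<in> closure (\<Lambda> ` carr A)" and F: "F \<in> carr A" for S F
  proof -
    have cF: "\<Lambda> F \<in> closure (\<Lambda> ` carr A)" "\<Lambda> (sscale A (- 1) F) \<in> closure (\<Lambda> ` carr A)"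
      by (intro closure_subset[THEN subsetD] imageI F sscale_carr)+
    have m: "\<Lambda> (sscale A (- 1) F) = - \<Lambda> F" using repD(2)[OF F F, of "- 1"] by (simp flip: uminus_eq_scaleC)
    have SF: "S + - \<Lambda> F \<in> closure (\<Lambda> ` carr A)"
    proof -
      obtain u where u: "u \<in> limit_class S" using limit_class_nonempty[OF S] by blast
      then have "(\<lambda>n. sadd A (u n) (sscale A (- 1) F)) \<in> limit_class (S + - \<Lambda> F)"
        using F by (auto simp: limit_class_def repD sadd_carr sscale_carr m intro!: tendsto_diff)
      then show ?thesis by (rule limit_class_closure)
    qed
    have "sdist (completion A) (limit_class S) (seq_class A (\<lambda>_. F))
        = snorm (completion A) (sadd (completion A) (limit_class S) (limit_class (- \<Lambda> F)))"
      by (simp add: sdist_def seq_class_const[OF F] completion_limit_class(2)[OF cF(1) cF(1)] flip: uminus_eq_scaleC)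
    also have "\<dots> = norm (S + - \<Lambda> F)"
      using completion_limit_class(1)[OF S cF(2)] completion_limit_class(5)[OF SF SF] by (simp add: m)
    finally show ?thesis by (simp add: dist_norm norm_minus_commute)
  qed
  have mono: "closure (\<Lambda> ` D) \<subseteq> closure (\<Lambda> ` carr A)" using D by (intro closure_mono image_mono)
  show ?thesis
  proof (intro set_eqI iffI)
    fix a assume a: "a \<in> {a \<in> carr (completion A). \<forall>e>0. \<exists>F\<in>D. sdist (completion A) a (seq_class A (\<lambda>_. F)) < e}"
    then obtain S where S: "S \<in> closure (\<Lambda> ` carr A)" "a = limit_class S" by (auto simp: carr_completion)
    have "S \<in> closure (\<Lambda> ` D)"
      unfolding closure_approachable using a sd[OF S(1)] S(2) D by fastforce
    then show "a \<in> limit_class ` closure (\<Lambda> ` D)" using S by blast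
  next
    fix a assume "a \<in> limit_class ` closure (\<Lambda> ` D)"
    then obtain S where S: "S \<in> closure (\<Lambda> ` D)" "a = limit_class S" by blast
    then have S': "S \<in> closure (\<Lambda> ` carr A)" using mono by blast
    have "\<exists>F\<in>D. sdist (completion A) a (seq_class A (\<lambda>_. F)) < e" if "0 < e" for e
    proof -
      obtain F where "F \<in> D" "dist (\<Lambda> F) S < e" using S(1) \<open>0 < e\<close> unfolding closure_approachable by auto
      then show ?thesis using sd[OF S'] D S(2) by (intro bexI[of _ F]) auto
    qed
    then show "a \<in> {a \<in> carr (completion A). \<forall>e>0. \<exists>F\<in>D. sdist (completion A) a (seq_class A (\<lambda>_. F)) < e}"
      using S' S(2) by (auto simp: carr_completion)
  qed
qed

lemma limit_of_limit_class:
  assumes "S \<in> closure (\<Lambda> ` carr A)"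
  shows "(THE T. \<forall>u\<in>limit_class S. (\<lambda>n. \<Lambda> (u n)) \<longlonglongrightarrow> T) = S"
proof (rule the_equality)
  show "\<forall>u\<in>limit_class S. (\<lambda>n. \<Lambda> (u n)) \<longlonglongrightarrow> S" by (simp add: limit_class_def)
  obtain u where "u \<in> limit_class S" using limit_class_nonempty[OF assms] by blast
  then show "T = S" if "\<forall>u\<in>limit_class S. (\<lambda>n. \<Lambda> (u n)) \<longlonglongrightarrow> T" for T
    using that LIMSEQ_unique by (auto simp: limit_class_def)
qed

end

subsection \<open>Supported functions\<close>

lemma csubspace_closure:
  assumes "csubspace (S :: 'v::complex_normed_vector set)"
  shows "csubspace (closure S)"
proof (rule complex_vector.subspaceI)
  show "0 \<in> closure S" using complex_vector.subspace_0[OF assms] closure_subset by blast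
  show "x + y \<in> closure S" if "x \<in> closure S" "y \<in> closure S" for x y
  proof -
    obtain X Y where "\<And>n. X n \<in> S" "X \<longlonglongrightarrow> x" "\<And>n. Y n \<in> S" "Y \<longlonglongrightarrow> y"
      using \<open>x \<in> closure S\<close> \<open>y \<in> closure S\<close> unfolding closure_sequential by blast
    then show ?thesis unfolding closure_sequential
      by (intro exI[of _ "\<lambda>n. X n + Y n"]) (auto intro: complex_vector.subspace_add[OF assms] tendsto_add)
  qed
  show "c *\<^sub>C x \<in> closure S" if "x \<in> closure S" for c x
  proof -
    obtain X where "\<And>n. X n \<in> S" "X \<longlonglongrightarrow> x" using \<open>x \<in> closure S\<close> unfolding closure_sequential by blast
    then show ?thesis unfolding closure_sequential
      by (intro exI[of _ "\<lambda>n. c *\<^sub>C X n"])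
        (auto intro: complex_vector.subspace_scale[OF assms] bounded_linear.tendsto[OF bounded_linear_scaleC])
  qed
qed

text \<open>
  An induction principle for statements about all elements that are preserved by linear combinations
  and limits, such as membership in a closed subspace.
\<close>

lemma total_induct:
  fixes x :: "'u::complex_normed_vector"
  assumes total: "closure (cspan G) = UNIV"
    and base: "\<And>g. g \<in> G \<Longrightarrow> P g"
    and zero: "P 0"
    and add: "\<And>x y. P x \<Longrightarrow> P y \<Longrightarrow> P (x + y)"
    and scale: "\<And>c x. P x \<Longrightarrow> P (c *\<^sub>C x)"
    and lim: "\<And>X x. (\<And>n. P (X n)) \<Longrightarrow> X \<longlonglongrightarrow> x \<Longrightarrow> P x"
  shows "P x"
proof -
  have span: "P x" if "x \<in> cspan G" for x
    using that by (induction rule: complex_vector.span_induct_alt) (auto intro: base zero add scale)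
  have "x \<in> closure (cspan G)" using total by simp
  then obtain X where "\<And>n. X n \<in> cspan G" "X \<longlonglongrightarrow> x"
    unfolding closure_sequential by blast
  then show ?thesis using span lim by blast
qed

definition supported :: "'g set \<Rightarrow> ('g \<Rightarrow> 'a::real_normed_vector) set"
  where "supported P = {F \<in> l1. \<forall>s. s \<notin> P \<longrightarrow> F s = 0}"

lemma zero_supported: "(\<lambda>_. 0) \<in> supported P"
  by (simp add: supported_def zero_l1)

context point_action
begin

lemma star_rep_l1_delta_linear:
  assumes "star_rep (l1_alg \<alpha>) \<rho>"
  shows "\<rho> (delta s (f + g)) = \<rho> (delta s f) + \<rho> (delta s g)" "\<rho> (delta s (c *\<^sub>C f)) = c *\<^sub>C \<rho> (delta s f)"
proof -
  have "delta s (f + g) = (\<lambda>r. delta s f r + delta s g r)" "delta s (c *\<^sub>C f) = (\<lambda>r. c *\<^sub>C delta s f r)"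
    by (auto simp: delta_apply)
  then show "\<rho> (delta s (f + g)) = \<rho> (delta s f) + \<rho> (delta s g)" "\<rho> (delta s (c *\<^sub>C f)) = c *\<^sub>C \<rho> (delta s f)"
    by (simp_all only: star_rep_l1D(2,3)[OF assms delta_l1 delta_l1])
qed

lemma bounded_linear_star_rep_delta:
  assumes "star_rep (l1_alg \<alpha>) \<rho>"
  shows "bounded_linear (\<lambda>f. \<rho> (delta s f))"
proof (rule bounded_linear_intro[where K = 1])
  show "norm (\<rho> (delta s f)) \<le> norm f * 1" for f
    using star_rep_l1_contractive[OF assms delta_l1, of s f] by (simp add: l1norm_delta)
qed (simp_all add: star_rep_l1_delta_linear[OF assms] scaleR_eq_scaleC)

text \<open>
  Functions with finite support are dense in \<open>\<ell>\<^sup>1\<close> and are sums of functions \<open>\<delta>\<^sub>s \<otimes> f\<close>; for fixed \<open>s\<close> these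
  depend continuously on \<open>f\<close>.
\<close>

lemma closure_image_supported:
  fixes \<rho> :: "('g \<Rightarrow> 'z \<Rightarrow>\<^sub>C complex) \<Rightarrow> 'h::complex_hilbert \<Rightarrow>\<^sub>L 'h"
  assumes rep: "star_rep (l1_alg \<alpha>) \<rho>" and total: "closure (cspan G) = UNIV"
  shows "closure (\<rho> ` supported P) = closure (cspan {\<rho> (delta s f) | s f. s \<in> P \<and> f \<in> G})"
proof
  define W where "W = closure (cspan {\<rho> (delta s f) | s f. s \<in> P \<and> f \<in> G})"
  have W: "csubspace W" "closed W" unfolding W_def by (auto intro: csubspace_closure complex_vector.subspace_span)
  have \<delta>W: "\<rho> (delta s f) \<in> W" if s: "s \<in> P" for s f
  proof (induction f rule: total_induct[OF total])
    case (1 g)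
    then show ?case unfolding W_def using s
      by (intro closure_subset[THEN subsetD, OF complex_vector.span_base]) blast
  next
    case 2
    then show ?case using star_rep_l1_delta_linear(2)[OF rep, of s 0 0] complex_vector.subspace_0[OF W(1)] by simp
  next
    case (5 X x)
    show ?case
      by (rule closed_sequentially[OF W(2)])
        (use 5 in \<open>auto intro: bounded_linear.tendsto[OF bounded_linear_star_rep_delta[OF rep]]\<close>)
  qed (auto simp: star_rep_l1_delta_linear[OF rep] intro: complex_vector.subspace_add[OF W(1)] complex_vector.subspace_scale[OF W(1)])
  have "\<rho> F \<in> W" if F: "F \<in> supported P" for F
  proof -
    have "\<exists>T\<in>W. dist T (\<rho> F) < e" if "0 < e" for e
    proof -
      have Fl: "F \<in> l1" using F by (simp add: supported_def)
      obtain S K where S: "finite S" "\<And>s. K s = (if s \<in> S then F s else 0)" "K \<in> l1"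
        "l1norm (\<lambda>s. F s - K s) \<le> e / 2"
        by (rule l1_finite_approx[OF Fl half_gt_zero[OF \<open>0 < e\<close>]]) blast
      have "norm (\<rho> F - \<rho> K) \<le> e / 2" using star_rep_l1_dist[OF rep Fl S(3)] S(4) by linarith
      then have "dist (\<rho> K) (\<rho> F) < e" using \<open>0 < e\<close> by (simp add: dist_norm norm_minus_commute)
      moreover have "\<rho> K \<in> W"
      proof -
        have "\<rho> K = (\<Sum>s\<in>S. \<rho> (delta s (K s)))"
          by (rule star_rep_finite_support[OF rep S(1)]) (simp add: S(2))
        moreover have "\<rho> (delta s (K s)) \<in> W" for s
        proof (cases "s \<in> P")
          case False
          then have "K s = 0" using F by (simp add: supported_def S(2))
          then show ?thesis
            using star_rep_l1_delta_linear(2)[OF rep, of s 0 0] complex_vector.subspace_0[OF W(1)] by simp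
        qed (rule \<delta>W)
        ultimately show ?thesis by (simp add: complex_vector.subspace_sum[OF W(1)])
      qed
      ultimately show ?thesis by blast
    qed
    then have "\<rho> F \<in> closure W" by (simp add: closure_approachable)
    then show ?thesis using W(2) by simp
  qed
  then show "closure (\<rho> ` supported P) \<subseteq> closure (cspan {\<rho> (delta s f) | s f. s \<in> P \<and> f \<in> G})"
    unfolding W_def[symmetric] by (intro closure_minimal W) auto
  have "csubspace (\<rho> ` supported P)"
  proof (rule complex_vector.subspaceI)
    show "0 \<in> \<rho> ` supported P" using zero_supported[of P] star_rep_l1_zero[OF rep] by force
  next
    fix x y assume "x \<in> \<rho> ` supported P" "y \<in> \<rho> ` supported P"
    then obtain F K where FK: "F \<in> supported P" "K \<in> supported P" "x = \<rho> F" "y = \<rho> K" by blast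
    then have "x + y = \<rho> (\<lambda>s. F s + K s)" "(\<lambda>s. F s + K s) \<in> supported P"
      using star_rep_l1D(2)[OF rep] by (auto simp: supported_def l1_add)
    then show "x + y \<in> \<rho> ` supported P" by blast
  next
    fix c x assume "x \<in> \<rho> ` supported P"
    then obtain F where F: "F \<in> supported P" "x = \<rho> F" by blast
    then have "c *\<^sub>C x = \<rho> (\<lambda>s. c *\<^sub>C F s)" "(\<lambda>s. c *\<^sub>C F s) \<in> supported P"
      using star_rep_l1D(3)[OF rep] by (auto simp: supported_def l1_scaleC)
    then show "c *\<^sub>C x \<in> \<rho> ` supported P" by blast
  qed
  moreover have "delta s f \<in> supported P" if "s \<in> P" for s and f :: "'z \<Rightarrow>\<^sub>C complex"
    unfolding supported_def using that delta_l1[of s f] by (auto simp: delta_apply)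
  ultimately have "cspan {\<rho> (delta s f) | s f. s \<in> P \<and> f \<in> G} \<subseteq> \<rho> ` supported P"
    by (intro complex_vector.span_minimal) blast+
  then show "closure (cspan {\<rho> (delta s f) | s f. s \<in> P \<and> f \<in> G}) \<subseteq> closure (\<rho> ` supported P)"
    by (rule closure_mono)
qed

end

context amenable_action
begin

text \<open>
  A representation that localizes at every point therefore identifies the crossed product with the
  closure of its range, and the semicrossed products with the closures of the ranges of the
  functions supported on \<open>P\<close>.
\<close>

lemma localizing_isometric:
  fixes \<Lambda> :: "('a \<Rightarrow> 'b \<Rightarrow>\<^sub>C complex) \<Rightarrow> 'k::complex_hilbert \<Rightarrow>\<^sub>L 'k"
  assumes rep: "star_rep (l1_alg \<alpha>) \<Lambda>" and loc: "\<And>z. localizes \<Lambda> z"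
  shows "isometric_star_rep (l1_env \<alpha>) \<Lambda>"
proof
  show "star_rep (l1_env \<alpha>) \<Lambda>" using rep by (simp add: l1_env_def star_rep_def)
qed (use smult_l1 sstar_l1 in \<open>auto simp: l1_env_def enveloping_norm_localizing[OF rep loc] l1_add l1_scaleC\<close>)

lemma carr_l1_env: "carr (l1_env \<alpha>) = l1"
  by (simp add: l1_env_def)

lemma semicrossed_product_localizing:
  fixes \<Lambda> :: "('a \<Rightarrow> 'b \<Rightarrow>\<^sub>C complex) \<Rightarrow> 'k::complex_hilbert \<Rightarrow>\<^sub>L 'k"
  assumes "star_rep (l1_alg \<alpha>) \<Lambda>" and "\<And>z. localizes \<Lambda> z"
  shows "semicrossed_product P \<alpha> = isometric_star_rep.limit_class (l1_env \<alpha>) \<Lambda> ` closure (\<Lambda> ` supported P)"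
  using zero_supported[of P]
  by (subst isometric_star_rep.completion_closure[OF localizing_isometric[OF assms], symmetric])
    (auto simp: semicrossed_product_def crossed_product_def cp_of_def supported_def carr_l1_env Bex_def conj_assoc)

end

section \<open>The canonical representation\<close>

lemma int_power_zero: "int_power \<sigma> 0 = id"
  by (simp add: int_power_def)

lemma int_power_add:
  assumes "bij \<sigma>"
  shows "int_power \<sigma> (m + n) = int_power \<sigma> m \<circ> int_power \<sigma> n"
proof -
  have step: "int_power \<sigma> (m + 1) = \<sigma> \<circ> int_power \<sigma> m" for m
  proof (cases "0 \<le> m")
    case True
    then have "nat (m + 1) = Suc (nat m)" by simp
    then show ?thesis using True by (simp add: int_power_def)
  next
    case False
    then have "nat (- m) = Suc (nat (- (m + 1)))" by simp
    moreover have "\<sigma> \<circ> inv \<sigma> = id" using assms by (simp add: bij_is_surj flip: surj_iff)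
    ultimately have "\<sigma> \<circ> int_power \<sigma> m = inv \<sigma> ^^ nat (- (m + 1))"
      using False by (simp add: int_power_def flip: o_assoc) (simp add: o_assoc)
    then show ?thesis using False by (cases "m = - 1") (auto simp: int_power_def)
  qed
  have pred: "int_power \<sigma> (m - 1) = inv \<sigma> \<circ> int_power \<sigma> m" for m
  proof -
    have "inv \<sigma> \<circ> \<sigma> = id" using assms by (simp add: bij_is_inj)
    then show ?thesis using step[of "m - 1"] by (metis comp_assoc diff_add_cancel id_comp)
  qed
  show ?thesis
  proof (induction m rule: int_induct[where k = 0])
    case base
    show ?case by (simp add: int_power_zero)
  next
    case (step1 i)
    then show ?case using step[of "i + n"] step[of i] by (simp add: ac_simps o_assoc)
  next
    case (step2 i)
    then show ?case using pred[of "i + n"] pred[of i] by (simp add: algebra_simps o_assoc)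
  qed
qed

text \<open>
  If \<open>S\<close> lies in \<open>[-M, M]\<close>, the differences lie in an interval with \<open>N + 2M\<close> elements.
\<close>

lemma int_folner:
  assumes "finite (S :: int set)" and "0 < \<epsilon>"
  shows "\<exists>N>0. real (card ((\<lambda>(b, s). b - s) ` ({0..<int N} \<times> S))) \<le> (1 + \<epsilon>) * real N"
proof -
  obtain M :: nat where M: "\<And>s. s \<in> S \<Longrightarrow> \<bar>s\<bar> \<le> int M"
  proof -
    obtain M where "\<And>s. s \<in> S \<Longrightarrow> nat \<bar>s\<bar> \<le> M"
      using finite_nat_set_iff_bounded_le[of "(\<lambda>s. nat \<bar>s\<bar>) ` S"] assms(1) by auto
    then show ?thesis using that by (metis abs_ge_zero nat_le_iff)
  qed
  obtain N :: nat where N: "2 * real M / \<epsilon> < real N" using reals_Archimedean2 by blast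
  have "(\<lambda>(b, s). b - s) ` ({0..<int (Suc N)} \<times> S) \<subseteq> {- int M..<int (Suc N) + int M}"
    using M by fastforce
  then have "card ((\<lambda>(b, s). b - s) ` ({0..<int (Suc N)} \<times> S)) \<le> card {- int M..<int (Suc N) + int M}"
    by (intro card_mono) auto
  then have "real (card ((\<lambda>(b, s). b - s) ` ({0..<int (Suc N)} \<times> S))) \<le> real (Suc N) + 2 * real M" by simp
  also have "2 * real M \<le> \<epsilon> * real (Suc N)"
    using N assms(2) by (simp add: field_simps)
  finally show ?thesis by (intro exI[of _ "Suc N"]) (simp add: algebra_simps)
qed

locale canonical =
  fixes \<sigma> :: "'x::metric_space \<Rightarrow> 'x" and \<pi> :: "('x \<Rightarrow>\<^sub>C complex) \<Rightarrow> 'h::complex_hilbert \<Rightarrow>\<^sub>L 'h"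
  assumes compact_space: "compact (UNIV :: 'x set)"
    and homeo: "homeomorphic_map euclidean euclidean \<sigma>"
    and faithful: "faithful_rep cstar_alg \<pi>"
begin

sublocale amenable_action "int_power \<sigma>" "z_action \<sigma>"
proof
  show "z_action \<sigma> g f z = f (int_power \<sigma> g z)" for g f z
    by (rule apply_z_action[OF homeo])
  show "int_power \<sigma> (g + h) z = int_power \<sigma> g (int_power \<sigma> h z)" for g h z
    by (simp add: int_power_add[OF homeomorphic_map_UNIV(1)[OF homeo]])
  fix S :: "int set" and \<epsilon> :: real assume "finite S" "0 < \<epsilon>"
  from int_folner[OF this] obtain N where N: "N > 0"
    "real (card ((\<lambda>(b, s). b - s) ` ({0..<int N} \<times> S))) \<le> (1 + \<epsilon>) * real N" by blast
  then show "\<exists>B. finite B \<and> B \<noteq> {} \<and> real (card ((\<lambda>(b, s). b - s) ` (B \<times> S))) \<le> (1 + \<epsilon>) * real (card B)"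
    by (intro exI[of _ "{0..<int N}"]) auto
qed (simp_all add: compact_space int_power_zero)

abbreviation \<tau> where "\<tau> \<equiv> tilde_rep \<pi> (z_action \<sigma>)"

abbreviation L where "L \<equiv> l1_rep \<pi> (z_action \<sigma>)"

abbreviation \<kappa> where "\<kappa> \<equiv> canonical_rep \<pi> (z_action \<sigma>)"

abbreviation (input) shift where "shift \<equiv> shift_power :: int \<Rightarrow> (int, 'h) l2 \<Rightarrow>\<^sub>L (int, 'h) l2"

lemma rep: "star_rep cstar_alg \<pi>"
  using faithful by (simp add: faithful_rep_def)

lemma tilde_rep_eq: "\<tau> = induced_fun \<pi> id"
proof
  fix f
  show "\<tau> f = induced_fun \<pi> id f" unfolding tilde_rep_def
    by (rule the_equality)
      (use induced_fun_single[OF rep inj_on_id, of f] in \<open>auto intro!: l2_op_eqI\<close>)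
qed

lemma shift_power_eq: "shift = induced_shift id"
proof
  fix n
  show "shift n = induced_shift id n" unfolding shift_power_def
    by (rule the_equality)
      (use induced_shift_single[OF rep inj_on_id, of n] in \<open>auto intro!: l2_op_eqI\<close>)
qed

lemmas shift_power_single = induced_shift_single[OF rep inj_on_id, folded shift_power_eq, simplified]

lemma canonical_covariant_pair: "covariant_pair \<tau> shift"
  unfolding tilde_rep_eq shift_power_eq by (rule induced_covariant_pair[OF rep inj_on_id])

lemma l1_rep_eq: "L = integrated_form \<tau> shift"
  by (rule ext) (simp add: l1_rep_def integrated_form_def)

lemma star_rep_l1_rep: "star_rep (l1_alg (z_action \<sigma>)) L"
  unfolding l1_rep_eq by (rule integrated_star_rep[OF canonical_covariant_pair])

lemma l1_rep_delta: "L (delta m f) = \<tau> f o\<^sub>L shift m"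
  unfolding l1_rep_eq by (rule integrated_delta[OF canonical_covariant_pair])

lemma localized_singles:
  "\<exists>h. (\<forall>n. norm (h n) = 1) \<and> (\<forall>f j. (\<lambda>n. \<tau> f (l2_single j (h n))
    - f (int_power \<sigma> (- j) x) *\<^sub>C l2_single j (h n)) \<longlonglongrightarrow> 0)"
proof -
  obtain h where h: "\<And>n. norm (h n) = 1" "\<And>f. (\<lambda>n. \<pi> f (h n) - apply_bcontfun f x *\<^sub>C h n) \<longlonglongrightarrow> 0"
    using faithful_rep_approximate_character[OF faithful, of x] by blast
  show ?thesis
    using h(1) induced_localized_singles[OF rep inj_on_id h] unfolding tilde_rep_eq id_apply by blast
qed

lemma l1_rep_localizes: "localizes L x"
proof -
  obtain h where "\<And>n. norm (h n) = 1" "\<And>f. (\<lambda>n. \<pi> f (h n) - apply_bcontfun f x *\<^sub>C h n) \<longlonglongrightarrow> 0"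
    using faithful_rep_approximate_character[OF faithful, of x] by blast
  from induced_localizes[OF rep inj_on_id this] show ?thesis
    by (simp only: l1_rep_eq tilde_rep_eq shift_power_eq)
qed

sublocale isometric_star_rep "l1_env (z_action \<sigma>)" L
  by (rule localizing_isometric[OF star_rep_l1_rep l1_rep_localizes])

lemma canonical_rep_limit_class:
  "T \<in> closure (L ` l1) \<Longrightarrow> \<kappa> (limit_class T) = T"
  unfolding canonical_rep_def using limit_of_limit_class by (simp add: carr_l1_env)

lemma canonical_rep_cp_of:
  "F \<in> l1 \<Longrightarrow> \<kappa> (cp_of (z_action \<sigma>) F) = L F"
  using seq_class_const[of F] canonical_rep_limit_class[of "L F"]
  by (simp add: cp_of_def carr_l1_env closure_subset[THEN subsetD])

text \<open>
  On the completion, the canonical representation inverts the identification of the crossed product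
  with the closed range of \<open>L\<close>.
\<close>

lemma canonical_image:
  "\<kappa> ` limit_class ` closure (L ` supported P)
    = closure (cspan {\<tau> f o\<^sub>L shift m | m f. m \<in> P})"
proof -
  have "closure (L ` supported P) \<subseteq> closure (L ` l1)"
    by (intro closure_mono image_mono) (auto simp: supported_def)
  then have "\<kappa> ` limit_class ` closure (L ` supported P)
      = closure (L ` supported P)"
    using canonical_rep_limit_class by (force simp: image_image image_iff subset_iff)
  also have "\<dots> = closure (cspan {L (delta m f) | m f. m \<in> P \<and> f \<in> UNIV})"
    by (rule closure_image_supported[OF star_rep_l1_rep]) simp
  finally show ?thesis by (simp add: l1_rep_delta)
qed

lemma canonical_image_crossed:
  "\<kappa> ` carr (crossed_product (z_action \<sigma>)) = closure (cspan {\<tau> f o\<^sub>L shift m | m f. m \<in> UNIV})"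
  unfolding canonical_image[symmetric] crossed_product_def carr_completion carr_l1_env supported_def by simp

lemma canonical_image_semicrossed:
  "\<kappa> ` semicrossed_product P (z_action \<sigma>) = closure (cspan {\<tau> f o\<^sub>L shift m | m f. m \<in> P})"
  unfolding semicrossed_product_localizing[OF star_rep_l1_rep l1_rep_localizes] by (rule canonical_image)

end

section \<open>The tensor product of two canonical representations\<close>

lemma clinear_op_span_closure:
  assumes "\<forall>a\<in>A. clinear_op a" and "T \<in> closure (cspan A)"
  shows "clinear_op (T :: 'a::complex_normed_vector \<Rightarrow>\<^sub>L 'b::complex_normed_vector)"
proof -
  have span: "clinear_op T" if "T \<in> cspan A" for T
    using that
  proof (induction rule: complex_vector.span_induct_alt)
    case (step c x y)
    then show ?case using assms(1)
      by (auto simp: clinear_op_def blinfun.add_left scaleC_add_right scaleC_scaleC mult.commute)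
  qed (simp add: clinear_op_def)
  obtain X where "\<And>n. X n \<in> cspan A" "X \<longlonglongrightarrow> T"
    using assms(2) unfolding closure_sequential by blast
  then show ?thesis using clinear_op_tendsto span by blast
qed

text \<open>
  \<open>S \<otimes> T\<close> depends linearly and continuously on each factor.
\<close>

lemma op_tensor_closed_span:
  assumes t: "hilbert_tensor t"
    and A: "\<forall>a\<in>A. clinear_op a" and B: "\<forall>b\<in>B. clinear_op b"
  shows "closure (cspan {op_tensor t S T | S T. S \<in> closure (cspan A) \<and> T \<in> closure (cspan B)})
    = closure (cspan {op_tensor t a b | a b. a \<in> A \<and> b \<in> B})"
proof
  define W where "W = closure (cspan {op_tensor t a b | a b. a \<in> A \<and> b \<in> B})"
  have W: "csubspace W" "closed W" unfolding W_def by (auto intro: csubspace_closure complex_vector.subspace_span)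
  note cA = clinear_op_span_closure[OF A] and cB = clinear_op_span_closure[OF B]
  have sA: "x \<in> closure (cspan A)" if "x \<in> cspan A" for x using that closure_subset by blast
  have sB: "x \<in> closure (cspan B)" if "x \<in> cspan B" for x using that closure_subset by blast
  have lin: "clinear_op (c *\<^sub>C x + y)" if "clinear_op x" "clinear_op y" for c and x y :: "'u::complex_normed_vector \<Rightarrow>\<^sub>L 'u"
    using that by (simp add: clinear_op_def blinfun.add_left scaleC_add_right scaleC_scaleC mult.commute)
  have 1: "clinear_op S \<and> op_tensor t S b \<in> W" if "S \<in> cspan A" and b: "b \<in> B" for S b
    using that(1)
  proof (induction rule: complex_vector.span_induct_alt)
    case base
    have "op_tensor t 0 b = 0"
      by (rule tensor_op_eqI[OF t]) (simp add: op_tensor_apply[OF t _ bspec[OF B b]] clinear_op_def tensor_zero[OF t])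
    then show ?case using complex_vector.subspace_0[OF W(1)] by (simp add: clinear_op_def)
  next
    case (step c x y)
    have "op_tensor t (c *\<^sub>C x + y) b = c *\<^sub>C op_tensor t x b + op_tensor t y b"
      using step by (simp add: op_tensor_add_left[OF t] op_tensor_scaleC[OF t] clinear_op_scaleC bspec[OF A] bspec[OF B b])
    moreover have "op_tensor t x b \<in> W"
      unfolding W_def using step(1) b by (intro closure_subset[THEN subsetD, OF complex_vector.span_base]) blast
    ultimately show ?case using step
      by (simp add: complex_vector.subspace_add[OF W(1)] complex_vector.subspace_scale[OF W(1)] lin bspec[OF A])
  qed
  have 2: "op_tensor t S T \<in> W" if S: "S \<in> cspan A" and "T \<in> cspan B" for S T
  proof -
    have "clinear_op T \<and> op_tensor t S T \<in> W"
      using that(2)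
    proof (induction rule: complex_vector.span_induct_alt)
      case base
      have "op_tensor t S 0 = 0"
        by (rule tensor_op_eqI[OF t]) (simp add: op_tensor_apply[OF t cA[OF sA[OF S]]] clinear_op_def tensor_zero[OF t])
      then show ?case using complex_vector.subspace_0[OF W(1)] by (simp add: clinear_op_def)
    next
      case (step c x y)
      have "op_tensor t S (c *\<^sub>C x + y) = c *\<^sub>C op_tensor t S x + op_tensor t S y"
        using step by (simp add: op_tensor_add_right[OF t] op_tensor_scaleC[OF t] clinear_op_scaleC bspec[OF B] cA[OF sA[OF S]])
      then show ?case using step 1[OF S]
        by (simp add: complex_vector.subspace_add[OF W(1)] complex_vector.subspace_scale[OF W(1)] lin bspec[OF B])
    qed
    then show ?thesis ..
  qed
  have 3: "op_tensor t S T \<in> W" if S: "S \<in> closure (cspan A)" and T: "T \<in> closure (cspan B)" for S T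
  proof -
    obtain X where X: "\<And>n. X n \<in> cspan A" "X \<longlonglongrightarrow> S" using S unfolding closure_sequential by blast
    obtain Y where Y: "\<And>n. Y n \<in> cspan B" "Y \<longlonglongrightarrow> T" using T unfolding closure_sequential by blast
    have "(\<lambda>n. op_tensor t (X n) (Y n)) \<longlonglongrightarrow> op_tensor t S T"
      using X Y by (intro op_tensor_tendsto[OF t] cA[OF sA] cB[OF sB])
    from closed_sequentially[OF W(2) _ this] show ?thesis using 2[OF X(1) Y(1)] by blast
  qed
  then have "cspan {op_tensor t S T | S T. S \<in> closure (cspan A) \<and> T \<in> closure (cspan B)} \<subseteq> W"
    by (intro complex_vector.span_minimal W) auto
  then show "closure (cspan {op_tensor t S T | S T. S \<in> closure (cspan A) \<and> T \<in> closure (cspan B)})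
      \<subseteq> closure (cspan {op_tensor t a b | a b. a \<in> A \<and> b \<in> B})"
    unfolding W_def[symmetric] by (rule closure_minimal[OF _ W(2)])
  have "A \<subseteq> closure (cspan A)" "B \<subseteq> closure (cspan B)"
    using closure_subset[of "cspan A"] closure_subset[of "cspan B"] complex_vector.span_superset by blast+
  then show "closure (cspan {op_tensor t a b | a b. a \<in> A \<and> b \<in> B})
      \<subseteq> closure (cspan {op_tensor t S T | S T. S \<in> closure (cspan A) \<and> T \<in> closure (cspan B)})"
    by (intro closure_mono complex_vector.span_mono) blast
qed

locale canonical_pair =
  one: canonical \<sigma>\<^sub>1 \<pi>\<^sub>1 + two: canonical \<sigma>\<^sub>2 \<pi>\<^sub>2
  for \<sigma>\<^sub>1 :: "'x::metric_space \<Rightarrow> 'x" and \<sigma>\<^sub>2 :: "'y::metric_space \<Rightarrow> 'y"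
    and \<pi>\<^sub>1 :: "('x \<Rightarrow>\<^sub>C complex) \<Rightarrow> 'h1::complex_hilbert \<Rightarrow>\<^sub>L 'h1"
    and \<pi>\<^sub>2 :: "('y \<Rightarrow>\<^sub>C complex) \<Rightarrow> 'h2::complex_hilbert \<Rightarrow>\<^sub>L 'h2" +
  fixes t :: "(int, 'h1) l2 \<Rightarrow> (int, 'h2) l2 \<Rightarrow> 'k::complex_hilbert"
  assumes t: "hilbert_tensor t"
begin

definition \<theta> :: "int \<times> int \<Rightarrow> 'x \<times> 'y \<Rightarrow> 'x \<times> 'y"
  where "\<theta> s = map_prod (int_power \<sigma>\<^sub>1 (fst s)) (int_power \<sigma>\<^sub>2 (snd s))"

sublocale amenable_action \<theta> "z2_action \<sigma>\<^sub>1 \<sigma>\<^sub>2"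
proof
  show "compact (UNIV :: ('x \<times> 'y) set)"
    using compact_Times[OF one.compact two.compact] by simp
  show "\<theta> 0 z = z" for z by (cases z) (simp add: \<theta>_def int_power_zero)
  show "\<theta> (g + h) z = \<theta> g (\<theta> h z)" for g h z
    by (cases z) (simp add: \<theta>_def one.\<theta>_add two.\<theta>_add)
  have "continuous_on UNIV (map_prod (int_power \<sigma>\<^sub>1 m) (int_power \<sigma>\<^sub>2 n))" for m n
    unfolding map_prod_def case_prod_beta
    by (intro continuous_on_Pair continuous_on_compose2[OF continuous_int_power[OF one.homeo]]
        continuous_on_compose2[OF continuous_int_power[OF two.homeo]] continuous_intros) auto
  then show "z2_action \<sigma>\<^sub>1 \<sigma>\<^sub>2 g f z = f (\<theta> g z)" for g f z
    by (cases g) (simp add: z2_action_def apply_comp_aut \<theta>_def)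
  \<comment> \<open>A product of Folner sets for the two projections of \<open>S\<close>; \<open>\<delta>\<close> is chosen so that \<open>(1 + \<delta>)\<^sup>2 \<le> 1 + \<epsilon>\<close>.\<close>
  fix S :: "(int \<times> int) set" and \<epsilon> :: real assume S: "finite S" "0 < \<epsilon>"
  define \<delta> where "\<delta> = min 1 (\<epsilon> / 3)"
  have \<delta>: "0 < \<delta>" "(1 + \<delta>) * (1 + \<delta>) \<le> 1 + \<epsilon>"
  proof -
    show "0 < \<delta>" using S by (simp add: \<delta>_def)
    then have "\<delta> * \<delta> \<le> \<delta> * 1" by (intro mult_left_mono) (auto simp: \<delta>_def)
    moreover have "3 * \<delta> \<le> \<epsilon>" by (simp add: \<delta>_def min_def)
    ultimately show "(1 + \<delta>) * (1 + \<delta>) \<le> 1 + \<epsilon>" by (simp add: algebra_simps)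
  qed
  let ?d = "\<lambda>(b, s). b - s"
  obtain M where M: "M > 0" "real (card (?d ` ({0..<int M} \<times> fst ` S))) \<le> (1 + \<delta>) * real M"
    using int_folner[of "fst ` S" \<delta>] S(1) \<delta>(1) by blast
  obtain N where N: "N > 0" "real (card (?d ` ({0..<int N} \<times> snd ` S))) \<le> (1 + \<delta>) * real N"
    using int_folner[of "snd ` S" \<delta>] S(1) \<delta>(1) by blast
  define B where "B = {0..<int M} \<times> {0..<int N}"
  have "?d ` (B \<times> S) \<subseteq> ?d ` ({0..<int M} \<times> fst ` S) \<times> ?d ` ({0..<int N} \<times> snd ` S)"
    unfolding B_def by force
  then have "card (?d ` (B \<times> S)) \<le> card (?d ` ({0..<int M} \<times> fst ` S) \<times> ?d ` ({0..<int N} \<times> snd ` S))"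
    using S(1) by (intro card_mono) auto
  then have "real (card (?d ` (B \<times> S))) \<le> real (card (?d ` ({0..<int M} \<times> fst ` S))) * real (card (?d ` ({0..<int N} \<times> snd ` S)))"
    by (simp add: card_cartesian_product flip: of_nat_mult)
  also have "\<dots> \<le> ((1 + \<delta>) * real M) * ((1 + \<delta>) * real N)"
    using M N \<delta>(1) by (intro mult_mono) auto
  also have "\<dots> = ((1 + \<delta>) * (1 + \<delta>)) * real (card B)" by (simp add: B_def)
  also have "\<dots> \<le> (1 + \<epsilon>) * real (card B)" by (intro mult_right_mono \<delta>) auto
  finally show "\<exists>B. finite B \<and> B \<noteq> {} \<and> real (card (?d ` (B \<times> S))) \<le> (1 + \<epsilon>) * real (card B)"
    using M N by (intro exI[of _ B]) (auto simp: B_def)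
qed

lemma z2_action_tensor:
  "z2_action \<sigma>\<^sub>1 \<sigma>\<^sub>2 s (tensor_fun f g) = tensor_fun (z_action \<sigma>\<^sub>1 (fst s) f) (z_action \<sigma>\<^sub>2 (snd s) g)"
  using z2_action_tensor_fun[OF one.homeo two.homeo, of "fst s" "snd s"] by simp

text \<open>
  The tensor product of the diagonal parts of the two canonical representations.
\<close>

definition \<Psi> :: "(('x \<times> 'y) \<Rightarrow>\<^sub>C complex) \<Rightarrow> 'k \<Rightarrow>\<^sub>L 'k"
  where "\<Psi> = (SOME \<pi>. star_rep cstar_alg \<pi> \<and> (\<forall>f g. \<pi> (tensor_fun f g) = op_tensor t (one.\<tau> f) (two.\<tau> g)))"

lemma \<Psi>: "star_rep cstar_alg \<Psi>" "\<Psi> (tensor_fun f g) = op_tensor t (one.\<tau> f) (two.\<tau> g)"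
proof -
  have "\<exists>\<pi>. star_rep cstar_alg \<pi> \<and> (\<forall>f g. \<pi> (tensor_fun f g) = op_tensor t (one.\<tau> f) (two.\<tau> g))"
    by (rule tensor_star_rep[OF one.compact two.compact t])
      (use one.covariant_pairD(1)[OF one.canonical_covariant_pair] two.covariant_pairD(1)[OF two.canonical_covariant_pair] in auto)
  from someI_ex[OF this, folded \<Psi>_def]
  show "star_rep cstar_alg \<Psi>" "\<Psi> (tensor_fun f g) = op_tensor t (one.\<tau> f) (two.\<tau> g)" by auto
qed

definition U :: "int \<times> int \<Rightarrow> 'k \<Rightarrow>\<^sub>L 'k"
  where "U s = op_tensor t (shift_power (fst s)) (shift_power (snd s))"

definition \<Lambda> :: "(int \<times> int \<Rightarrow> ('x \<times> 'y) \<Rightarrow>\<^sub>C complex) \<Rightarrow> 'k \<Rightarrow>\<^sub>L 'k"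
  where "\<Lambda> = integrated_form \<Psi> U"

lemmas cov1 = one.covariant_pairD[OF one.canonical_covariant_pair]
lemmas cov2 = two.covariant_pairD[OF two.canonical_covariant_pair]

lemma pair_covariant: "covariant_pair \<Psi> U"
proof -
  note c1 = cov1(3) star_rep_cstarD(1)[OF cov1(1)] and c2 = cov2(3) star_rep_cstarD(1)[OF cov2(1)]
  have cU: "clinear_op (U s)" for s unfolding U_def by (intro clinear_op_tensor t c1 c2)
  have "is_adjoint (U s) (U (- s))" for s
    unfolding U_def fst_uminus snd_uminus by (intro is_adjoint_op_tensor t c1 c2 cov1(4) cov2(4))
  moreover have "U s o\<^sub>L U r = U (s + r)" for s r
    by (simp add: U_def op_tensor_compose[OF t] c1 c2 cov1(5) cov2(5))
  moreover have "U 0 = id_blinfun"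
    by (rule tensor_op_eqI[OF t])
      (use c1(1)[of 0] c2(1)[of 0] in \<open>simp add: U_def op_tensor_apply[OF t] cov1(2) cov2(2)\<close>)
  moreover have "U s o\<^sub>L \<Psi> f = \<Psi> (z2_action \<sigma>\<^sub>1 \<sigma>\<^sub>2 s f) o\<^sub>L U s" for s f
    by (rule tensor_fun_eqI[OF one.compact two.compact
          bounded_linear_compose[OF bounded_linear_compose_right star_rep_bounded_linear[OF \<Psi>(1)]]
          bounded_linear_compose[OF bounded_linear_compose_left
            bounded_linear_compose[OF star_rep_bounded_linear[OF \<Psi>(1)] bounded_linear_\<alpha>]]])
      (simp add: z2_action_tensor \<Psi>(2) U_def op_tensor_compose[OF t] c1 c2 cov1(6) cov2(6))
  ultimately show ?thesis using cU \<Psi>(1) by (simp add: covariant_pair_def)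
qed

lemma star_rep_\<Lambda>: "star_rep (l1_alg (z2_action \<sigma>\<^sub>1 \<sigma>\<^sub>2)) \<Lambda>"
  unfolding \<Lambda>_def by (rule integrated_star_rep[OF pair_covariant])

lemma \<Lambda>_delta_tensor:
  "\<Lambda> (delta (m, n) (tensor_fun f g)) = op_tensor t (one.\<tau> f o\<^sub>L shift_power m) (two.\<tau> g o\<^sub>L shift_power n)"
  unfolding \<Lambda>_def integrated_delta[OF pair_covariant]
  by (simp add: \<Psi>(2) U_def op_tensor_compose[OF t] cov1(3) cov2(3) star_rep_cstarD(1)[OF cov1(1)] star_rep_cstarD(1)[OF cov2(1)])

text \<open>
  The vectors are \<open>(\<delta>\<^sub>i \<otimes> h\<^sub>n) \<otimes> (\<delta>\<^sub>j \<otimes> k\<^sub>n)\<close>, with \<open>h\<^sub>n\<close> and \<open>k\<^sub>n\<close> localized at the two coordinates of \<open>z\<close>.  The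
  limit is checked for elementary tensors and extends to \<open>C(X \<times> Y)\<close> because
  \<open>\<parallel>\<Psi>(f)\<parallel> \<le> \<parallel>f\<parallel>\<close>.
\<close>

lemma \<Lambda>_localizes: "localizes \<Lambda> z"
proof -
  obtain x y where z: "z = (x, y)" by (cases z)
  obtain h where h: "\<And>n. norm (h n) = 1" "\<And>f j. (\<lambda>n. one.\<tau> f (l2_single j (h n))
      - f (int_power \<sigma>\<^sub>1 (- j) x) *\<^sub>C l2_single j (h n)) \<longlonglongrightarrow> 0"
    using one.localized_singles[of x] by blast
  obtain k where k: "\<And>n. norm (k n) = 1" "\<And>f j. (\<lambda>n. two.\<tau> f (l2_single j (k n))
      - f (int_power \<sigma>\<^sub>2 (- j) y) *\<^sub>C l2_single j (k n)) \<longlonglongrightarrow> 0"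
    using two.localized_singles[of y] by blast
  define e where "e n j = t (l2_single (fst j) (h n)) (l2_single (snd j) (k n))" for n j
  have on: "orthonormal (e n) UNIV" for n
    using h(1)[of n] k(1)[of n]
    by (auto simp: orthonormal_def e_def hilbert_tensorD(5)[OF t] cinner_l2_single l2_single_apply cinner_self prod_eq_iff)
  have ne: "norm (e n j) = 1" for n j
    using orthonormal_norm[OF on] by simp
  have Ue: "U s (e n j) = e n (j + s)" for s n j
    by (simp add: e_def U_def op_tensor_apply[OF t cov1(3) cov2(3)] one.shift_power_single two.shift_power_single)
  have lim: "(\<lambda>n. \<Psi> f (e n j) - f (\<theta> (- j) z) *\<^sub>C e n j) \<longlonglongrightarrow> 0" for f j
  proof (induction f rule: total_induct[OF tensor_funs_total[OF one.compact two.compact]])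
    case (1 f)
    then obtain f1 f2 where f: "f = tensor_fun f1 f2" by auto
    define a where "a n = one.\<tau> f1 (l2_single (fst j) (h n))" for n
    define b where "b n = two.\<tau> f2 (l2_single (snd j) (k n))" for n
    define p where "p = f1 (int_power \<sigma>\<^sub>1 (- fst j) x)"
    define q where "q = f2 (int_power \<sigma>\<^sub>2 (- snd j) y)"
    have eq: "\<Psi> f (e n j) - f (\<theta> (- j) z) *\<^sub>C e n j
        = t (a n - p *\<^sub>C l2_single (fst j) (h n)) (b n)
          + p *\<^sub>C t (l2_single (fst j) (h n)) (b n - q *\<^sub>C l2_single (snd j) (k n))" for n
    proof -
      have l: "t (u - u') w = t u w - t u' w" "t w' (v - v') = t w' v - t w' v'" for u u' w v v' w'
        using hilbert_tensorD(1)[OF t, of "u - u'" u' w] hilbert_tensorD(2)[OF t, of w' "v - v'" v'] by simp_all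
      have "\<Psi> f (e n j) = t (a n) (b n)"
        by (simp add: f \<Psi>(2) e_def a_def b_def op_tensor_apply[OF t] star_rep_cstarD(1)[OF cov1(1)] star_rep_cstarD(1)[OF cov2(1)])
      moreover have "f (\<theta> (- j) z) = p * q"
        by (simp add: f z apply_tensor_fun \<theta>_def p_def q_def)
      ultimately show ?thesis
        by (simp add: e_def l hilbert_tensorD(3,4)[OF t] complex_vector.scale_right_diff_distrib scaleC_scaleC)
    qed
    have nb: "norm (b n) \<le> norm (two.\<tau> f2)" for n
      unfolding b_def using norm_blinfun[of "two.\<tau> f2" "l2_single (snd j) (k n)"] by (simp add: norm_l2_single k(1))
    show ?case
    proof (rule Lim_null_comparison)
      show "\<forall>\<^sub>F n in sequentially. norm (\<Psi> f (e n j) - f (\<theta> (- j) z) *\<^sub>C e n j)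
          \<le> norm (a n - p *\<^sub>C l2_single (fst j) (h n)) * norm (two.\<tau> f2) + cmod p * norm (b n - q *\<^sub>C l2_single (snd j) (k n))"
        unfolding eq
        by (intro always_eventually allI order_trans[OF norm_triangle_ineq] add_mono)
          (auto simp: norm_tensor[OF t] norm_scaleC norm_l2_single h(1) intro!: mult_left_mono nb)
      have "(\<lambda>n. norm (a n - p *\<^sub>C l2_single (fst j) (h n)) * norm (two.\<tau> f2) + cmod p * norm (b n - q *\<^sub>C l2_single (snd j) (k n)))
          \<longlonglongrightarrow> 0 * norm (two.\<tau> f2) + cmod p * 0"
        unfolding a_def b_def p_def q_def
        by (intro tendsto_intros tendsto_norm_zero h(2) k(2))
      then show "(\<lambda>n. norm (a n - p *\<^sub>C l2_single (fst j) (h n)) * norm (two.\<tau> f2) + cmod p * norm (b n - q *\<^sub>C l2_single (snd j) (k n))) \<longlonglongrightarrow> 0"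
        by simp
    qed
  next
    case (3 f g)
    from tendsto_add[OF this] show ?case
      by (simp add: star_rep_cstarD(2)[OF \<Psi>(1)] blinfun.add_left scaleC_add_left algebra_simps)
  next
    case (4 c f)
    from bounded_linear.tendsto[OF bounded_linear_scaleC this, of c] show ?case
      by (simp add: star_rep_cstarD(3)[OF \<Psi>(1)] complex_vector.scale_right_diff_distrib scaleC_scaleC scaleC_complex_def)
  next
    case (5 X f)
    show ?case
    proof (rule LIMSEQ_I)
      fix r :: real assume "0 < r"
      then obtain m where m: "norm (X m - f) < r / 3"
        using LIMSEQ_D[OF 5(2), of "r / 3"] by auto
      obtain N where N: "\<And>n. N \<le> n \<Longrightarrow> norm ((\<Psi> (X m)) (e n j) - X m (\<theta> (- j) z) *\<^sub>C e n j) < r / 3"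
        using LIMSEQ_D[OF 5(1)[of m], of "r / 3"] \<open>0 < r\<close> by auto
      have "norm (\<Psi> f (e n j) - f (\<theta> (- j) z) *\<^sub>C e n j) < r" if "N \<le> n" for n
      proof -
        let ?d = "X m - f"
        let ?a = "(\<Psi> (X m)) (e n j) - X m (\<theta> (- j) z) *\<^sub>C e n j"
        let ?b = "\<Psi> ?d (e n j)" and ?c = "?d (\<theta> (- j) z) *\<^sub>C e n j"
        have eq: "\<Psi> f (e n j) - f (\<theta> (- j) z) *\<^sub>C e n j = ?a - (?b - ?c)"
          by (simp add: star_rep_diff[OF \<Psi>(1)] blinfun.diff_left complex_vector.scale_left_diff_distrib)
        have b: "norm ?b < r / 3"
          using norm_blinfun[of "\<Psi> ?d" "e n j"] star_rep_contractive[OF \<Psi>(1), of ?d] m by (simp add: ne)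
        have c: "norm ?c < r / 3"
          using norm_bounded[of ?d "\<theta> (- j) z"] m by (simp add: norm_scaleC ne)
        have "norm (?a - (?b - ?c)) \<le> norm ?a + (norm ?b + norm ?c)"
          by (intro order_trans[OF norm_triangle_ineq4] add_left_mono norm_triangle_ineq4)
        then show ?thesis unfolding eq using N[OF that] b c by linarith
      qed
      then show "\<exists>no. \<forall>n\<ge>no. norm (\<Psi> f (e n j) - f (\<theta> (- j) z) *\<^sub>C e n j - 0) < r"
        by auto
    qed
  qed (simp add: star_rep_zero[OF \<Psi>(1)])
  have "(\<Lambda> (delta s f)) (e n j) = \<Psi> f (e n (j + s))" for s f n j
    unfolding \<Lambda>_def integrated_delta[OF pair_covariant] by (simp add: Ue)
  then have "(\<lambda>n. (\<Lambda> (delta s f)) (e n j) - f (\<theta> (- (j + s)) z) *\<^sub>C e n (j + s)) \<longlonglongrightarrow> 0" for s f j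
    using lim[of f "j + s"] by (simp only:)
  with on show ?thesis unfolding localizes_def by blast
qed

sublocale isometric_star_rep "l1_env (z2_action \<sigma>\<^sub>1 \<sigma>\<^sub>2)" \<Lambda>
  by (rule localizing_isometric[OF star_rep_\<Lambda> \<Lambda>_localizes])

text \<open>
  Both sides are the closed span of the elementary operators
  \<open>\<pi>\<^sub>1(f)U\<^sub>1\<^sup>m \<otimes> \<pi>\<^sub>2(g)U\<^sub>2\<^sup>n\<close> with \<open>m \<in> P\<close> and \<open>n \<in> Q\<close>.
\<close>

lemma spatial_tensor_eq:
  assumes "one.\<kappa> ` D\<^sub>1 = closure (cspan {one.\<tau> f o\<^sub>L shift_power m | m f. m \<in> P})"
    and "two.\<kappa> ` D\<^sub>2 = closure (cspan {two.\<tau> f o\<^sub>L shift_power m | m f. m \<in> Q})"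
  shows "spatial_tensor t one.\<kappa> two.\<kappa> D\<^sub>1 D\<^sub>2
    = closure (\<Lambda> ` supported (P \<times> Q))"
proof -
  have "{op_tensor t (one.\<kappa> a) (two.\<kappa> b) | a b. a \<in> D\<^sub>1 \<and> b \<in> D\<^sub>2}
      = {op_tensor t S T | S T. S \<in> one.\<kappa> ` D\<^sub>1 \<and> T \<in> two.\<kappa> ` D\<^sub>2}"
    by blast
  then have "spatial_tensor t one.\<kappa> two.\<kappa> D\<^sub>1 D\<^sub>2
      = closure (cspan {op_tensor t S T | S T. S \<in> closure (cspan {one.\<tau> f o\<^sub>L shift_power m | m f. m \<in> P})
          \<and> T \<in> closure (cspan {two.\<tau> f o\<^sub>L shift_power m | m f. m \<in> Q})})"
    by (simp add: spatial_tensor_def assms)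
  also have "\<dots> = closure (cspan {op_tensor t a b | a b. a \<in> {one.\<tau> f o\<^sub>L shift_power m | m f. m \<in> P}
      \<and> b \<in> {two.\<tau> f o\<^sub>L shift_power m | m f. m \<in> Q}})"
    by (rule op_tensor_closed_span[OF t])
      (auto intro!: clinear_op_compose cov1(3) cov2(3) star_rep_cstarD(1)[OF cov1(1)] star_rep_cstarD(1)[OF cov2(1)])
  also have "{op_tensor t a b | a b. a \<in> {one.\<tau> f o\<^sub>L shift_power m | m f. m \<in> P} \<and> b \<in> {two.\<tau> f o\<^sub>L shift_power m | m f. m \<in> Q}}
      = {\<Lambda> (delta s f) | s f. s \<in> P \<times> Q \<and> f \<in> range (\<lambda>(f, g). tensor_fun f g)}" (is "?L = ?R")
  proof (intro set_eqI iffI)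
    fix T assume "T \<in> ?L"
    then obtain m f n g where "T = op_tensor t (one.\<tau> f o\<^sub>L shift_power m) (two.\<tau> g o\<^sub>L shift_power n)" "m \<in> P" "n \<in> Q"
      by blast
    then have "T = \<Lambda> (delta (m, n) (tensor_fun f g))" "(m, n) \<in> P \<times> Q" "tensor_fun f g \<in> range (\<lambda>(f, g). tensor_fun f g)"
      by (auto simp: \<Lambda>_delta_tensor)
    then show "T \<in> ?R" by blast
  next
    fix T assume "T \<in> ?R"
    then obtain m n f g where "T = \<Lambda> (delta (m, n) (tensor_fun f g))" "m \<in> P" "n \<in> Q" by auto
    then show "T \<in> ?L" unfolding \<Lambda>_delta_tensor by blast
  qed
  also have "closure (cspan ?R) = closure (\<Lambda> ` supported (P \<times> Q))"
    by (rule closure_image_supported[OF star_rep_\<Lambda> tensor_funs_total[OF one.compact two.compact], symmetric])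
  finally show ?thesis .
qed

end

theorem proposition4p14:
  fixes \<sigma>\<^sub>1 :: "'x::metric_space \<Rightarrow> 'x" and \<sigma>\<^sub>2 :: "'y::metric_space \<Rightarrow> 'y"
    and \<pi>\<^sub>1 :: "('x \<Rightarrow>\<^sub>C complex) \<Rightarrow> 'h1::complex_hilbert \<Rightarrow>\<^sub>L 'h1"
    and \<pi>\<^sub>2 :: "('y \<Rightarrow>\<^sub>C complex) \<Rightarrow> 'h2::complex_hilbert \<Rightarrow>\<^sub>L 'h2"
    and t :: "(int, 'h1) l2 \<Rightarrow> (int, 'h2) l2 \<Rightarrow> 'k::complex_hilbert"
  assumes "compact (UNIV :: 'x set)" and "compact (UNIV :: 'y set)"
    and "homeomorphic_map euclidean euclidean \<sigma>\<^sub>1"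
    and "homeomorphic_map euclidean euclidean \<sigma>\<^sub>2"
    and "faithful_rep cstar_alg \<pi>\<^sub>1" and "faithful_rep cstar_alg \<pi>\<^sub>2"
    and "hilbert_tensor t"
  shows "\<exists>\<Phi>.
    star_iso
      (operator_alg (spatial_tensor t
        (canonical_rep \<pi>\<^sub>1 (z_action \<sigma>\<^sub>1)) (canonical_rep \<pi>\<^sub>2 (z_action \<sigma>\<^sub>2))
        (carr (crossed_product (z_action \<sigma>\<^sub>1))) (carr (crossed_product (z_action \<sigma>\<^sub>2)))))
      (crossed_product (z2_action \<sigma>\<^sub>1 \<sigma>\<^sub>2)) \<Phi> \<and>
    (\<forall>m n f\<^sub>1 f\<^sub>2.
      \<Phi> (op_tensor t
          (canonical_rep \<pi>\<^sub>1 (z_action \<sigma>\<^sub>1) (cp_of (z_action \<sigma>\<^sub>1) (delta m f\<^sub>1)))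
          (canonical_rep \<pi>\<^sub>2 (z_action \<sigma>\<^sub>2) (cp_of (z_action \<sigma>\<^sub>2) (delta n f\<^sub>2))))
      = cp_of (z2_action \<sigma>\<^sub>1 \<sigma>\<^sub>2) (delta (m, n) (tensor_fun f\<^sub>1 f\<^sub>2))) \<and>
    \<Phi> ` spatial_tensor t
        (canonical_rep \<pi>\<^sub>1 (z_action \<sigma>\<^sub>1)) (canonical_rep \<pi>\<^sub>2 (z_action \<sigma>\<^sub>2))
        (semicrossed_product {0..} (z_action \<sigma>\<^sub>1)) (semicrossed_product {0..} (z_action \<sigma>\<^sub>2))
      = semicrossed_product ({0..} \<times> {0..}) (z2_action \<sigma>\<^sub>1 \<sigma>\<^sub>2)"
proof -
  interpret canonical_pair \<sigma>\<^sub>1 \<sigma>\<^sub>2 \<pi>\<^sub>1 \<pi>\<^sub>2 t by unfold_locales fact+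
  let ?P = "{0..} \<times> {0..} :: (int \<times> int) set"
  have "spatial_tensor t one.\<kappa> two.\<kappa>
      (carr (crossed_product (z_action \<sigma>\<^sub>1))) (carr (crossed_product (z_action \<sigma>\<^sub>2))) = closure (\<Lambda> ` l1)"
    using spatial_tensor_eq[OF one.canonical_image_crossed two.canonical_image_crossed] by (simp add: supported_def)
  then have iso: "star_iso (operator_alg (spatial_tensor t one.\<kappa> two.\<kappa>
      (carr (crossed_product (z_action \<sigma>\<^sub>1))) (carr (crossed_product (z_action \<sigma>\<^sub>2)))))
      (crossed_product (z2_action \<sigma>\<^sub>1 \<sigma>\<^sub>2)) limit_class"
    using completion_star_iso by (simp add: crossed_product_def carr_l1_env)
  have gen: "limit_class (op_tensor t
        (one.\<kappa> (cp_of (z_action \<sigma>\<^sub>1) (delta m f\<^sub>1)))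
        (two.\<kappa> (cp_of (z_action \<sigma>\<^sub>2) (delta n f\<^sub>2))))
      = cp_of (z2_action \<sigma>\<^sub>1 \<sigma>\<^sub>2) (delta (m, n) (tensor_fun f\<^sub>1 f\<^sub>2))" for m n f\<^sub>1 f\<^sub>2
    using seq_class_const[of "delta (m, n) (tensor_fun f\<^sub>1 f\<^sub>2)", folded cp_of_def]
    by (simp add: one.canonical_rep_cp_of two.canonical_rep_cp_of delta_l1 one.l1_rep_delta two.l1_rep_delta
        carr_l1_env \<Lambda>_delta_tensor)
  have "semicrossed_product ?P (z2_action \<sigma>\<^sub>1 \<sigma>\<^sub>2) = limit_class ` closure (\<Lambda> ` supported ?P)"
    by (rule semicrossed_product_localizing[OF star_rep_\<Lambda> \<Lambda>_localizes])
  then have semi: "limit_class ` spatial_tensor t one.\<kappa> two.\<kappa>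
      (semicrossed_product {0..} (z_action \<sigma>\<^sub>1)) (semicrossed_product {0..} (z_action \<sigma>\<^sub>2))
      = semicrossed_product ?P (z2_action \<sigma>\<^sub>1 \<sigma>\<^sub>2)"
    using spatial_tensor_eq[OF one.canonical_image_semicrossed two.canonical_image_semicrossed] by simp
  show ?thesis
    by (intro exI[of _ limit_class] conjI allI iso gen semi)
qed

end
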